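(* Let $\Omega\subseteq\mathbb{R}^d$ be open, let $\rho$ be a positive infinitesimal in ${}^*\mathbb{R}$, let $D$ be a $\rho$-delta function, let $\Pi_\Omega$ be a $\rho$-cut-off function for $\Omega$, and let $$\Sigma_{D,\Omega}:\mathcal{D}'(\Omega)\to{}^\rho\mathcal{E}(\Omega),\qquad \Sigma_{D,\Omega}(T)=Q_\Omega\big(({}^*T\,\Pi_\Omega)\star D\big).$$ Then: (i) $\Sigma_{D,\Omega}$ preserves the pairing: for all $T\in\mathcal{D}'(\Omega)$ and all $\varphi\in\mathcal{D}(\Omega)$ we have $\langle T,\varphi\rangle=\langle\Sigma_{D,\Omega}(T),\varphi\rangle$, where the left-hand side is the usual pairing of $T$ and $\varphi$ (a complex number, regarded as an element of ${}^\rho\mathbb{C}$), and the right-hand side is the pairing between ${}^\rho\mathcal{E}(\Omega)$ and $\mathcal{D}(\Omega)$ with values in ${}^\rho\mathbb{C}$. (ii) $\Sigma_{D,\Omega}$ is injective and it preserves all linear operations in $\mathcal{D}'(\Omega)$: the addition, the multiplication by (standard) complex numbers, and the partial differentiation $\partial^\alpha$ of any (standard) order $\alpha\in\mathbb{N}_0^d$. (iii) $\Sigma_{D,\Omega}$ is an extension of the canonical embedding $\sigma_\Omega:\mathcal{E}(\Omega)\to{}^\rho\mathcal{E}(\Omega)$, in the sense that $\sigma_\Omega=\Sigma_{D,\Omega}\circ L_\Omega$, where $L_\Omega:\mathcal{E}(\Omega)\to\mathcal{D}'(\Omega)$ is the Schwartz embedding $\langle L_\Omega(f),\varphi\rangle=\int_\Omega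 f(x)\varphi(x)\,dx$.
   Context: Work in a nonstandard model of the complex numbers $\mathbb{C}$ with degree of saturation larger than $\mathrm{card}(\mathbb{N})$ (in particular, every countable family of internal sets with the finite intersection property has nonempty intersection). ${}^*X$ and ${}^*f$ denote nonstandard extensions of sets and functions; $\approx$ is the infinitesimal relation; integrals over ${}^*\mathbb{R}^d$ are $*$-Lebesgue integrals. $\mathbb{N}=\{1,2,\dots\}$, $\mathbb{N}_0=\{0\}\cup\mathbb{N}$. $\mathcal{E}(\Omega)=C^\infty(\Omega)$, $\mathcal{D}(\Omega)=C_0^\infty(\Omega)$ (complex-valued), and $\mathcal{D}'(\Omega)$ is the space of Schwartz distributions on $\Omega$. The same symbols $\|\cdot\|$ (Euclidean norm), $d(\cdot,\cdot)$ (Euclidean distance), $\partial^\alpha$ and $\star$ (convolution) are used for the nonstandard extensions. Nearstandard points: $\widetilde\Omega$ is the set of $\xi\in{}^*\Omega$ that are finite and whose standard part belongs to $\Omega$. $\rho$-delta function: a function $D\in{}^*\mathcal{D}(\mathbb{R}^d)$ with values in ${}^*\mathbb{R}$ which is symmetric ($D(-x)=D(x)$) and satisfies (a) $D(x)=0$ for $x\in{}^*\mathbb{R}^d$, $\|x\|\ge\rho$; (b) $\int_{{}^*\mathbb{R}^d}D(x)\,dx=1$; (c) $\int_{{}^*\mathbb{R}^d}D(x)x^\alpha\,dx=0$ for all $\alpha\in\mathbb{N}_0^d$, $\alpha\ne0$; (d) $\int_{{}^*\mathbb{R}^d}|D(x)|\,dx\approx1$; (e) $|\ln\rho|^{-1}\big(\rho^{d+|\alpha|}\sup_{x\in{}^*\mathbb{R}^d}|\partial^\alpha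 D(x)|\big)\approx0$ for all $\alpha\in\mathbb{N}_0^d$. $\rho$-cut-off function for $\Omega$: a function $\Pi_\Omega\in{}^*\mathcal{D}(\Omega)$ such that $\Pi_\Omega(x)=1$ for all $x\in\widetilde\Omega$ and $\mathrm{supp}\,\Pi_\Omega\subseteq\Omega_\rho=\{\xi\in{}^*\Omega: d(\xi,\partial\Omega)\ge\rho\}$ (with $d(\xi,\emptyset)=+\infty$ if $\partial\Omega=\emptyset$). Robinson's asymptotic numbers: ${}^\rho\mathbb{C}=\mathbb{C}_{\mathcal M}/\mathbb{C}_0$, where $\mathbb{C}_{\mathcal M}=\{\xi\in{}^*\mathbb{C}:|\xi|<\rho^{-n}\text{ for some }n\in\mathbb{N}\}$ and $\mathbb{C}_0=\{\xi\in{}^*\mathbb{C}:|\xi|<\rho^{n}\text{ for all }n\in\mathbb{N}\}$; $q:\mathbb{C}_{\mathcal M}\to{}^\rho\mathbb{C}$ is the quotient mapping, and $\mathbb{C}$ is embedded in ${}^\rho\mathbb{C}$ by $c\mapsto q(c)$. Asymptotic functions: ${}^\rho\mathcal{E}(\Omega)=\mathcal{E}_{\mathcal M}(\Omega)/\mathcal{E}_0(\Omega)$, where $\mathcal{E}_{\mathcal M}(\Omega)=\{f\in{}^*\mathcal{E}(\Omega):\partial^\alpha f(\xi)\in\mathbb{C}_{\mathcal M}\text{ for all }\alpha\in\mathbb{N}_0^d,\ \xi\in\widetilde\Omega\}$ and $\mathcal{E}_0(\Omega)=\{f\in{}^*\mathcal{E}(\Omega):\partial^\alpha f(\xi)\in\mathbb{C}_0\text{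 for all }\alpha\in\mathbb{N}_0^d,\ \xi\in\widetilde\Omega\}$; $Q_\Omega:\mathcal{E}_{\mathcal M}(\Omega)\to{}^\rho\mathcal{E}(\Omega)$ is the quotient mapping. Operations, including $\partial^\alpha Q_\Omega(f)=Q_\Omega(\partial^\alpha f)$, are induced from representatives. Pairing: $\langle Q_\Omega(f),\varphi\rangle=q\big(\int_{{}^*\Omega}f(x)\,{}^*\varphi(x)\,dx\big)$ for $f\in\mathcal{E}_{\mathcal M}(\Omega)$, $\varphi\in\mathcal{D}(\Omega)$. Canonical embedding: $\sigma_\Omega(f)=Q_\Omega({}^*f)$ for $f\in\mathcal{E}(\Omega)$. ${}^*T\,\Pi_\Omega$ is the (transferred) Schwartz product of the distribution ${}^*T$ with the smooth function $\Pi_\Omega$, so that, as a function on ${}^*\Omega$, $(({}^*T\,\Pi_\Omega)\star D)(x)=\langle{}^*T,\Pi_\Omega(\cdot)D(x-\cdot)\rangle$. This function belongs to $\mathcal{E}_{\mathcal M}(\Omega)$ for each $T\in\mathcal{D}'(\Omega)$, so $\Sigma_{D,\Omega}$ is defined. *)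

theory Defs
  imports "HOL-Analysis.Analysis"
begin

section \<open>Smooth functions, test functions, distributions\<close>

type_synonym 'd cfun = "real^'d \<Rightarrow> complex"
type_synonym 'd functional = "(real^'d \<Rightarrow> complex) \<Rightarrow> complex"

definition partial_deriv :: "'d::finite \<Rightarrow> 'd cfun \<Rightarrow> 'd cfun" where
  "partial_deriv i f x = vector_derivative (\<lambda>t::real. f (x + t *\<^sub>R axis i 1)) (at 0)"

primrec partial_derivs :: "'d::finite list \<Rightarrow> 'd cfun \<Rightarrow> 'd cfun" where
  "partial_derivs [] f = f"
| "partial_derivs (i # is) f = partial_deriv i (partial_derivs is f)"

text \<open>Multi-indices are functions \<open>\<alpha> :: 'd \<Rightarrow> nat\<close>. The index type carries no order, so an
  order of differentiation is chosen arbitrarily; for smooth functions it is irrelevant.\<close>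

definition mderiv :: "('d::finite \<Rightarrow> nat) \<Rightarrow> 'd cfun \<Rightarrow> 'd cfun" where
  "mderiv \<alpha> f = partial_derivs (SOME is. \<forall>i. count_list is i = \<alpha> i) f"

definition msize :: "('d::finite \<Rightarrow> nat) \<Rightarrow> nat" where
  "msize \<alpha> = (\<Sum>i\<in>UNIV. \<alpha> i)"

definition mpower :: "real^'d \<Rightarrow> ('d::finite \<Rightarrow> nat) \<Rightarrow> real" where
  "mpower x \<alpha> = (\<Prod>i\<in>UNIV. (x $ i) ^ \<alpha> i)"

text \<open>An element of \<open>C\<^sup>\<infinity>(\<Omega>)\<close> is represented by any total function that is smooth on the open set
  \<open>\<Omega>\<close>; its values outside \<open>\<Omega>\<close> are never used below.\<close>

definition smooth_functions :: "(real^'d) set \<Rightarrow> 'd::finite cfun set" where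
  "smooth_functions \<Omega> = {f. \<forall>is. \<forall>x\<in>\<Omega>. partial_derivs is f differentiable (at x)}"

definition supp :: "'d::finite cfun \<Rightarrow> (real^'d) set" where
  "supp f = closure {x. f x \<noteq> 0}"

definition test_functions :: "(real^'d) set \<Rightarrow> 'd::finite cfun set" where
  "test_functions \<Omega> = {f \<in> smooth_functions UNIV. compact (supp f) \<and> supp f \<subseteq> \<Omega>}"

text \<open>Continuity is expressed by the usual seminorm estimates on compact subsets. Functionals are
  set to \<open>0\<close> off the test functions, so that equality in HOL is equality of distributions.\<close>

definition distributions :: "(real^'d) set \<Rightarrow> 'd::finite functional set" where
  "distributions \<Omega> = {T.
     (\<forall>\<phi>\<in>test_functions \<Omega>. \<forall>\<psi>\<in>test_functions \<Omega>. T (\<lambda>x. \<phi> x + \<psi> x) = T \<phi> + T \<psi>) \<and>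
     (\<forall>\<phi>\<in>test_functions \<Omega>. \<forall>c. T (\<lambda>x. c * \<phi> x) = c * T \<phi>) \<and>
     (\<forall>K. compact K \<and> K \<subseteq> \<Omega> \<longrightarrow>
        (\<exists>C N. \<forall>\<phi>\<in>test_functions \<Omega>. supp \<phi> \<subseteq> K \<longrightarrow>
           norm (T \<phi>) \<le> C * (\<Sum>\<alpha> | msize \<alpha> \<le> N. SUP x. norm (mderiv \<alpha> \<phi> x)))) \<and>
     (\<forall>\<phi>. \<phi> \<notin> test_functions \<Omega> \<longrightarrow> T \<phi> = 0)}"

definition dist_add :: "'d::finite functional \<Rightarrow> 'd functional \<Rightarrow> 'd functional" where
  "dist_add S T = (\<lambda>\<phi>. S \<phi> + T \<phi>)"

definition dist_scale :: "complex \<Rightarrow> 'd::finite functional \<Rightarrow> 'd functional" where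
  "dist_scale c T = (\<lambda>\<phi>. c * T \<phi>)"

definition dist_deriv ::
    "(real^'d) set \<Rightarrow> ('d::finite \<Rightarrow> nat) \<Rightarrow> 'd functional \<Rightarrow> 'd functional" where
  "dist_deriv \<Omega> \<alpha> T =
     (\<lambda>\<phi>. if \<phi> \<in> test_functions \<Omega> then (- 1) ^ msize \<alpha> * T (mderiv \<alpha> \<phi>) else 0)"

definition schwartz_embedding :: "(real^'d) set \<Rightarrow> 'd::finite cfun \<Rightarrow> 'd functional" where
  "schwartz_embedding \<Omega> f =
     (\<lambda>\<phi>. if \<phi> \<in> test_functions \<Omega> then LINT x:\<Omega>|lebesgue. f x * \<phi> x else 0)"

definition schwartz_product :: "'d::finite functional \<Rightarrow> 'd cfun \<Rightarrow> 'd functional" where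
  "schwartz_product T \<psi> = (\<lambda>\<phi>. T (\<lambda>y. \<psi> y * \<phi> y))"

definition dist_convolution :: "'d::finite functional \<Rightarrow> 'd cfun \<Rightarrow> 'd cfun" where
  "dist_convolution S g = (\<lambda>x. S (\<lambda>y. g (x - y)))"


section \<open>Nonstandard models\<close>

text \<open>The standard universe: the disjoint union of those levels of the superstructure over the
  complex numbers that occur in the theory. Reals are complex numbers with zero imaginary part.
  Functions and functionals are individuals of this universe, so the individuals of a nonstandard
  model include the internal functions and internal functionals.\<close>

datatype ('d::finite) obj =
    Cpx (cpx_of: complex)
  | Pt (pt_of: "real^'d")
  | Fn (fn_of: "real^'d \<Rightarrow> complex")
  | Fnl (fnl_of: "(real^'d \<Rightarrow> complex) \<Rightarrow> complex")

text \<open>First-order formulas with a symbol for every relation on \<open>'s\<close>; a relation is a set of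
  lists, and variables are numbered.\<close>

datatype 's fm =
    Rel "'s list set" "nat list"
  | Eq nat nat
  | Neg "'s fm"
  | Conj "'s fm" "'s fm"
  | Exists nat "'s fm"

primrec sat :: "('s list set \<Rightarrow> 'u list set) \<Rightarrow> 's fm \<Rightarrow> (nat \<Rightarrow> 'u) \<Rightarrow> bool" where
  "sat I (Rel R vs) e \<longleftrightarrow> map e vs \<in> I R"
| "sat I (Eq v w) e \<longleftrightarrow> e v = e w"
| "sat I (Neg \<phi>) e \<longleftrightarrow> \<not> sat I \<phi> e"
| "sat I (Conj \<phi> \<psi>) e \<longleftrightarrow> sat I \<phi> e \<and> sat I \<psi> e"
| "sat I (Exists v \<phi>) e \<longleftrightarrow> (\<exists>u. sat I \<phi> (e(v := u)))"

record ('s, 'u) nsmodel =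
  star_of :: "'s \<Rightarrow> 'u"
  star_rel :: "'s list set \<Rightarrow> 'u list set"

definition transfer_principle :: "('s, 'u) nsmodel \<Rightarrow> bool" where
  "transfer_principle M \<longleftrightarrow>
     (\<forall>\<phi> e. sat (\<lambda>R. R) \<phi> e \<longleftrightarrow> sat (star_rel M) \<phi> (star_of M \<circ> e))"

text \<open>Internal sets are the fibres of starred relations over internal parameters.\<close>

definition internal_set :: "('s, 'u) nsmodel \<Rightarrow> 'u set \<Rightarrow> bool" where
  "internal_set M A \<longleftrightarrow> (\<exists>R ps. A = {u. u # ps \<in> star_rel M R})"

definition countably_saturated :: "('s, 'u) nsmodel \<Rightarrow> bool" where
  "countably_saturated M \<longleftrightarrow>
     (\<forall>A :: nat \<Rightarrow> 'u set. (\<forall>n. internal_set M (A n)) \<and>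
        (\<forall>F. finite F \<longrightarrow> (\<Inter>n\<in>F. A n) \<noteq> {}) \<longrightarrow> (\<Inter>n. A n) \<noteq> {})"

definition nonstandard_model :: "('s, 'u) nsmodel \<Rightarrow> bool" where
  "nonstandard_model M \<longleftrightarrow> transfer_principle M \<and> countably_saturated M"

text \<open>Nonstandard extensions of sets, binary relations, and functions of one to three
  arguments.\<close>

definition star_set :: "('s, 'u) nsmodel \<Rightarrow> 's set \<Rightarrow> 'u set" where
  "star_set M A = {u. [u] \<in> star_rel M {[x] | x. x \<in> A}}"

definition star_pred2 :: "('s, 'u) nsmodel \<Rightarrow> ('s \<Rightarrow> 's \<Rightarrow> bool) \<Rightarrow> 'u \<Rightarrow> 'u \<Rightarrow> bool" where
  "star_pred2 M P u v \<longleftrightarrow> [u, v] \<in> star_rel M {[x, y] | x y. P x y}"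

definition star_fun1 :: "('s, 'u) nsmodel \<Rightarrow> ('s \<Rightarrow> 's) \<Rightarrow> 'u \<Rightarrow> 'u" where
  "star_fun1 M g u = (THE w. [u, w] \<in> star_rel M {[x, g x] | x. True})"

definition star_fun2 :: "('s, 'u) nsmodel \<Rightarrow> ('s \<Rightarrow> 's \<Rightarrow> 's) \<Rightarrow> 'u \<Rightarrow> 'u \<Rightarrow> 'u" where
  "star_fun2 M g u v = (THE w. [u, v, w] \<in> star_rel M {[x, y, g x y] | x y. True})"

definition star_fun3 ::
    "('s, 'u) nsmodel \<Rightarrow> ('s \<Rightarrow> 's \<Rightarrow> 's \<Rightarrow> 's) \<Rightarrow> 'u \<Rightarrow> 'u \<Rightarrow> 'u \<Rightarrow> 'u" where
  "star_fun3 M g t u v =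
     (THE w. [t, u, v, w] \<in> star_rel M {[x, y, z, g x y z] | x y z. True})"

type_synonym ('d, 'u) model = "('d obj, 'u) nsmodel"

definition star_Cpx :: "('d::finite, 'u) model \<Rightarrow> 'u set" where
  "star_Cpx M = star_set M (range Cpx)"

definition star_Real :: "('d::finite, 'u) model \<Rightarrow> 'u set" where
  "star_Real M = star_set M {Cpx (of_real r) | r. True}"

definition star_points :: "('d::finite, 'u) model \<Rightarrow> (real^'d) set \<Rightarrow> 'u set" where
  "star_points M X = star_set M (Pt ` X)"

definition star_smooth :: "('d::finite, 'u) model \<Rightarrow> (real^'d) set \<Rightarrow> 'u set" where
  "star_smooth M \<Omega> = star_set M (Fn ` smooth_functions \<Omega>)"

definition star_test :: "('d::finite, 'u) model \<Rightarrow> (real^'d) set \<Rightarrow> 'u set" where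
  "star_test M \<Omega> = star_set M (Fn ` test_functions \<Omega>)"

definition apply_fn :: "('d::finite, 'u) model \<Rightarrow> 'u \<Rightarrow> 'u \<Rightarrow> 'u" where
  "apply_fn M = star_fun2 M (\<lambda>f x. Cpx (fn_of f (pt_of x)))"

definition star_mderiv :: "('d::finite, 'u) model \<Rightarrow> ('d \<Rightarrow> nat) \<Rightarrow> 'u \<Rightarrow> 'u" where
  "star_mderiv M \<alpha> = star_fun1 M (\<lambda>f. Fn (mderiv \<alpha> (fn_of f)))"

definition star_real_le :: "('d::finite, 'u) model \<Rightarrow> 'u \<Rightarrow> 'u \<Rightarrow> bool" where
  "star_real_le M =
     star_pred2 M (\<lambda>x y. \<exists>a b. x = Cpx (of_real a) \<and> y = Cpx (of_real b) \<and> a \<le> b)"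

definition star_norm_pt :: "('d::finite, 'u) model \<Rightarrow> 'u \<Rightarrow> 'u" where
  "star_norm_pt M = star_fun1 M (\<lambda>x. Cpx (of_real (norm (pt_of x))))"

definition cpx_approx :: "('d::finite, 'u) model \<Rightarrow> 'u \<Rightarrow> 'u \<Rightarrow> bool" where
  "cpx_approx M u v \<longleftrightarrow>
     (\<forall>\<epsilon>::real. \<epsilon> > 0 \<longrightarrow> star_pred2 M (\<lambda>x y. dist (cpx_of x) (cpx_of y) < \<epsilon>) u v)"

definition pt_approx :: "('d::finite, 'u) model \<Rightarrow> 'u \<Rightarrow> 'u \<Rightarrow> bool" where
  "pt_approx M u v \<longleftrightarrow>
     (\<forall>\<epsilon>::real. \<epsilon> > 0 \<longrightarrow> star_pred2 M (\<lambda>x y. dist (pt_of x) (pt_of y) < \<epsilon>) u v)"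

definition finite_pt :: "('d::finite, 'u) model \<Rightarrow> 'u \<Rightarrow> bool" where
  "finite_pt M \<xi> \<longleftrightarrow> (\<exists>r::real. \<xi> \<in> star_points M {x. norm x < r})"

definition standard_part :: "('d::finite, 'u) model \<Rightarrow> 'u \<Rightarrow> real^'d" where
  "standard_part M \<xi> = (THE x. pt_approx M \<xi> (star_of M (Pt x)))"

definition nearstandard :: "('d::finite, 'u) model \<Rightarrow> (real^'d) set \<Rightarrow> 'u set" where
  "nearstandard M \<Omega> = {\<xi> \<in> star_points M \<Omega>. finite_pt M \<xi> \<and> standard_part M \<xi> \<in> \<Omega>}"

definition positive_infinitesimal :: "('d::finite, 'u) model \<Rightarrow> 'u \<Rightarrow> bool" where
  "positive_infinitesimal M \<rho> \<longleftrightarrow>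
     \<rho> \<in> star_set M {Cpx (of_real r) | r. 0 < r} \<and> cpx_approx M \<rho> (star_of M (Cpx 0))"


section \<open>Delta functions and cut-off functions\<close>

definition delta_function :: "('d::finite, 'u) model \<Rightarrow> 'u \<Rightarrow> 'u \<Rightarrow> bool" where
  "delta_function M \<rho> D \<longleftrightarrow>
     D \<in> star_test M UNIV \<and>
     (\<forall>\<xi>\<in>star_points M UNIV. apply_fn M D \<xi> \<in> star_Real M) \<and>
     (\<forall>\<xi>\<in>star_points M UNIV.
        apply_fn M D (star_fun1 M (\<lambda>x. Pt (- pt_of x)) \<xi>) = apply_fn M D \<xi>) \<and>
     (\<forall>\<xi>\<in>star_points M UNIV.
        star_real_le M \<rho> (star_norm_pt M \<xi>) \<longrightarrow> apply_fn M D \<xi> = star_of M (Cpx 0)) \<and>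
     star_fun1 M (\<lambda>f. Cpx (LINT x|lebesgue. fn_of f x)) D = star_of M (Cpx 1) \<and>
     (\<forall>\<alpha>. \<alpha> \<noteq> (\<lambda>i. 0) \<longrightarrow>
        star_fun1 M (\<lambda>f. Cpx (LINT x|lebesgue. fn_of f x * of_real (mpower x \<alpha>))) D
          = star_of M (Cpx 0)) \<and>
     cpx_approx M
       (star_fun1 M (\<lambda>f. Cpx (of_real (LINT x|lebesgue. norm (fn_of f x)))) D)
       (star_of M (Cpx 1)) \<and>
     (\<forall>\<alpha>. cpx_approx M
        (star_fun2 M
           (\<lambda>r f. let s = Re (cpx_of r) in
              Cpx (of_real (inverse \<bar>ln s\<bar> *
                (s ^ (CARD('d) + msize \<alpha>) * (SUP x. norm (mderiv \<alpha> (fn_of f) x))))))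
           \<rho> D)
        (star_of M (Cpx 0)))"

text \<open>The points of \<open>\<^sup>*\<Omega>\<close> at distance at least \<open>\<rho>\<close> from the boundary. The case distinction
  implements the convention that the distance to the empty set is infinite, whereas
  \<open>infdist x {} = 0\<close>.\<close>

definition inner_points :: "('d::finite, 'u) model \<Rightarrow> 'u \<Rightarrow> (real^'d) set \<Rightarrow> 'u set" where
  "inner_points M \<rho> \<Omega> = {\<xi> \<in> star_points M \<Omega>.
     frontier \<Omega> = {} \<or>
     star_real_le M \<rho>
       (star_fun1 M (\<lambda>x. Cpx (of_real (infdist (pt_of x) (frontier \<Omega>)))) \<xi>)}"

definition star_supp :: "('d::finite, 'u) model \<Rightarrow> 'u \<Rightarrow> 'u set" where
  "star_supp M f =
     {\<xi>. star_pred2 M (\<lambda>g x. \<exists>y. x = Pt y \<and> y \<in> supp (fn_of g)) f \<xi>}"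

definition cutoff_function ::
    "('d::finite, 'u) model \<Rightarrow> 'u \<Rightarrow> (real^'d) set \<Rightarrow> 'u \<Rightarrow> bool" where
  "cutoff_function M \<rho> \<Omega> P \<longleftrightarrow>
     P \<in> star_test M \<Omega> \<and>
     (\<forall>\<xi>\<in>nearstandard M \<Omega>. apply_fn M P \<xi> = star_of M (Cpx 1)) \<and>
     star_supp M P \<subseteq> inner_points M \<rho> \<Omega>"


section \<open>Asymptotic numbers and asymptotic functions\<close>

definition moderate_numbers :: "('d::finite, 'u) model \<Rightarrow> 'u \<Rightarrow> 'u set" where
  "moderate_numbers M \<rho> = {\<xi> \<in> star_Cpx M.
     \<exists>n::nat. n \<ge> 1 \<and> star_pred2 M (\<lambda>x r. norm (cpx_of x) < inverse (Re (cpx_of r) ^ n)) \<xi> \<rho>}"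

definition negligible_numbers :: "('d::finite, 'u) model \<Rightarrow> 'u \<Rightarrow> 'u set" where
  "negligible_numbers M \<rho> = {\<xi> \<in> star_Cpx M.
     \<forall>n::nat. n \<ge> 1 \<longrightarrow> star_pred2 M (\<lambda>x r. norm (cpx_of x) < Re (cpx_of r) ^ n) \<xi> \<rho>}"

definition number_rel :: "('d::finite, 'u) model \<Rightarrow> 'u \<Rightarrow> ('u \<times> 'u) set" where
  "number_rel M \<rho> = {(\<xi>, \<eta>). \<xi> \<in> moderate_numbers M \<rho> \<and> \<eta> \<in> moderate_numbers M \<rho> \<and>
     star_fun2 M (\<lambda>x y. Cpx (cpx_of x - cpx_of y)) \<xi> \<eta> \<in> negligible_numbers M \<rho>}"

definition asymptotic_numbers :: "('d::finite, 'u) model \<Rightarrow> 'u \<Rightarrow> 'u set set" where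
  "asymptotic_numbers M \<rho> = moderate_numbers M \<rho> // number_rel M \<rho>"

definition number_class :: "('d::finite, 'u) model \<Rightarrow> 'u \<Rightarrow> 'u \<Rightarrow> 'u set" where
  "number_class M \<rho> \<xi> = number_rel M \<rho> `` {\<xi>}"

definition standard_number :: "('d::finite, 'u) model \<Rightarrow> 'u \<Rightarrow> complex \<Rightarrow> 'u set" where
  "standard_number M \<rho> c = number_class M \<rho> (star_of M (Cpx c))"

definition moderate_functions ::
    "('d::finite, 'u) model \<Rightarrow> 'u \<Rightarrow> (real^'d) set \<Rightarrow> 'u set" where
  "moderate_functions M \<rho> \<Omega> = {f \<in> star_smooth M \<Omega>.
     \<forall>\<alpha>. \<forall>\<xi>\<in>nearstandard M \<Omega>. apply_fn M (star_mderiv M \<alpha> f) \<xi> \<in> moderate_numbers M \<rho>}"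

definition negligible_functions ::
    "('d::finite, 'u) model \<Rightarrow> 'u \<Rightarrow> (real^'d) set \<Rightarrow> 'u set" where
  "negligible_functions M \<rho> \<Omega> = {f \<in> star_smooth M \<Omega>.
     \<forall>\<alpha>. \<forall>\<xi>\<in>nearstandard M \<Omega>. apply_fn M (star_mderiv M \<alpha> f) \<xi> \<in> negligible_numbers M \<rho>}"

definition function_rel ::
    "('d::finite, 'u) model \<Rightarrow> 'u \<Rightarrow> (real^'d) set \<Rightarrow> ('u \<times> 'u) set" where
  "function_rel M \<rho> \<Omega> =
     {(f, g). f \<in> moderate_functions M \<rho> \<Omega> \<and> g \<in> moderate_functions M \<rho> \<Omega> \<and>
        star_fun2 M (\<lambda>f g. Fn (\<lambda>x. fn_of f x - fn_of g x)) f g \<in> negligible_functions M \<rho> \<Omega>}"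

definition asymptotic_functions ::
    "('d::finite, 'u) model \<Rightarrow> 'u \<Rightarrow> (real^'d) set \<Rightarrow> 'u set set" where
  "asymptotic_functions M \<rho> \<Omega> = moderate_functions M \<rho> \<Omega> // function_rel M \<rho> \<Omega>"

definition function_class ::
    "('d::finite, 'u) model \<Rightarrow> 'u \<Rightarrow> (real^'d) set \<Rightarrow> 'u \<Rightarrow> 'u set" where
  "function_class M \<rho> \<Omega> f = function_rel M \<rho> \<Omega> `` {f}"

text \<open>Operations on classes are lifted from representatives in the style of
  \<^theory>\<open>HOL.Equiv_Relations\<close>: the union over all representatives of the resulting class.\<close>

definition asym_add ::
    "('d::finite, 'u) model \<Rightarrow> 'u \<Rightarrow> (real^'d) set \<Rightarrow> 'u set \<Rightarrow> 'u set \<Rightarrow> 'u set" where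
  "asym_add M \<rho> \<Omega> F G = (\<Union>f\<in>F. \<Union>g\<in>G.
     function_class M \<rho> \<Omega> (star_fun2 M (\<lambda>f g. Fn (\<lambda>x. fn_of f x + fn_of g x)) f g))"

definition asym_scale ::
    "('d::finite, 'u) model \<Rightarrow> 'u \<Rightarrow> (real^'d) set \<Rightarrow> complex \<Rightarrow> 'u set \<Rightarrow> 'u set" where
  "asym_scale M \<rho> \<Omega> c F = (\<Union>f\<in>F.
     function_class M \<rho> \<Omega>
       (star_fun2 M (\<lambda>a f. Fn (\<lambda>x. cpx_of a * fn_of f x)) (star_of M (Cpx c)) f))"

definition asym_deriv ::
    "('d::finite, 'u) model \<Rightarrow> 'u \<Rightarrow> (real^'d) set \<Rightarrow> ('d \<Rightarrow> nat) \<Rightarrow> 'u set \<Rightarrow> 'u set" where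
  "asym_deriv M \<rho> \<Omega> \<alpha> F = (\<Union>f\<in>F. function_class M \<rho> \<Omega> (star_mderiv M \<alpha> f))"

definition asym_pairing ::
    "('d::finite, 'u) model \<Rightarrow> 'u \<Rightarrow> (real^'d) set \<Rightarrow> 'u set \<Rightarrow> 'd cfun \<Rightarrow> 'u set" where
  "asym_pairing M \<rho> \<Omega> F \<phi> = (\<Union>f\<in>F.
     number_class M \<rho>
       (star_fun2 M (\<lambda>f g. Cpx (LINT x:\<Omega>|lebesgue. fn_of f x * fn_of g x))
          f (star_of M (Fn \<phi>))))"

definition canonical_embedding ::
    "('d::finite, 'u) model \<Rightarrow> 'u \<Rightarrow> (real^'d) set \<Rightarrow> 'd cfun \<Rightarrow> 'u set" where
  "canonical_embedding M \<rho> \<Omega> f = function_class M \<rho> \<Omega> (star_of M (Fn f))"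

definition distribution_embedding ::
    "('d::finite, 'u) model \<Rightarrow> 'u \<Rightarrow> (real^'d) set \<Rightarrow> 'u \<Rightarrow> 'u \<Rightarrow> 'd functional \<Rightarrow> 'u set" where
  "distribution_embedding M \<rho> \<Omega> D P T = function_class M \<rho> \<Omega>
     (star_fun3 M
        (\<lambda>T p g. Fn (dist_convolution (schwartz_product (fnl_of T) (fn_of p)) (fn_of g)))
        (star_of M (Fnl T)) P D)"

end

theory Submission
  imports Defs
begin

text \<open>
  The theorem is a collection of estimates on the regularisation \<open>(T p) \<star> D\<close> of a standard
  distribution \<open>T\<close> by a standard cut-off function \<open>p\<close> and a standard mollifier \<open>D\<close> supported in a
  ball of radius \<open>r\<close>, provided that all constants are independent of \<open>p\<close>, \<open>D\<close> and \<open>r\<close>.  The internal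
  objects are then handled as follows.  The sets \<open>A\<close> of standard triples with
  \<open>(\<rho>, D, P) \<in> \<^sup>*A\<close> form an ultrafilter; every internal object of the theorem is the value of some
  \<open>\<^sup>*F\<close> at the triple, and it has a property exactly if \<open>F\<close> has the property along the
  ultrafilter (\<open>eventually_type_of_star_values\<close>, \<open>eventually_type_of_ex\<close>).  A point is nearstandard
  exactly if it lies in \<open>\<^sup>*K\<close> for some compact \<open>K \<subseteq> \<Omega>\<close> (\<open>nearstandard_iff\<close>), so that
  moderateness and negligibility become growth conditions in \<open>r\<close>, uniform on each \<open>K\<close>.

  The standard estimates rest on two observations.  Fix a compact \<open>K \<subseteq> \<Omega>\<close> and \<open>\<delta> > 0\<close> such that the
  \<open>2\<delta>\<close>-neighbourhood of \<open>K\<close> lies in \<open>\<Omega>\<close>, let \<open>p = 1\<close> there and \<open>r \<le> \<delta>\<close>.  For \<open>x\<close> near \<open>K\<close> the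
  function \<open>D (x - y)\<close> of \<open>y\<close> lives where \<open>p = 1\<close>, so the cut-off disappears
  (\<open>cutoff_translate_eq\<close>).  Therefore the derivatives of the regularisation on \<open>K\<close> are bounded by
  finitely many derivatives of \<open>D\<close> (\<open>convolution_bound\<close>), that is, by a power of \<open>1 / r\<close>, and
  regularisation commutes with differentiation exactly on a neighbourhood of \<open>K\<close>
  (\<open>convolution_dist_deriv\<close>).  Secondly, since the moments of \<open>D\<close> vanish, Taylor's formula shows
  that convolution with \<open>D\<close> changes a smooth function only by \<open>O(r\<^sup>n)\<close>, for every \<open>n\<close>
  (\<open>mollifier_approximates\<close>).  If \<open>T\<close> is a smooth function \<open>f\<close>, then \<open>T p\<close> is the test function
  \<open>f p\<close>, which agrees with \<open>f\<close> near \<open>K\<close>; this gives (iii).  For (i), a distribution may be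
  exchanged with an integral (\<open>functional_integral_exchange\<close>), so pairing the regularisation with
  \<open>\<phi>\<close> amounts to applying \<open>T\<close> to the mollification of \<open>\<phi>\<close>, which differs from \<open>\<phi>\<close> by
  \<open>O(r\<^sup>n)\<close> together with all its derivatives.  Injectivity is a consequence of (i), because a
  standard number that is negligible is \<open>0\<close>; linearity is immediate.

  Derivatives are indexed by lists of coordinate directions.  This avoids multinomial coefficients
  in the product rule and in Taylor's formula, and symmetry of mixed derivatives
  (\<open>partial_derivs_permute\<close>) makes lists and multi-indices interchangeable.
\<close>

section \<open>Iterated partial derivatives\<close>

lemma partial_derivs_append: "partial_derivs (is @ js) f = partial_derivs is (partial_derivs js f)"
  by (induction "is") auto

lemma has_vector_derivative_along_line:
  fixes f :: "'d::finite cfun"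
  assumes "(f has_derivative F) (at (x + t *\<^sub>R z))"
  shows "((\<lambda>t. f (x + t *\<^sub>R z)) has_vector_derivative F z) (at t)"
proof -
  have "((\<lambda>t. x + t *\<^sub>R z) has_derivative (\<lambda>h. h *\<^sub>R z)) (at t)"
    by (auto intro!: derivative_eq_intros)
  from has_derivative_compose[OF this assms]
  have "((\<lambda>t. f (x + t *\<^sub>R z)) has_derivative (\<lambda>h. F (h *\<^sub>R z))) (at t)" .
  moreover have "F (h *\<^sub>R z) = h *\<^sub>R F z" for h
    using assms by (simp add: has_derivative_linear linear_cmul)
  ultimately show ?thesis by (simp add: has_vector_derivative_def)
qed

lemma partial_deriv_eqI:
  assumes "(f has_derivative F) (at x)"
  shows "partial_deriv i f x = F (axis i 1)"
  using has_vector_derivative_along_line[of f F x 0 "axis i 1"] assms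
  by (simp add: partial_deriv_def vector_derivative_at)

lemma sum_axis_scaleR:
  "(\<Sum>i\<in>UNIV. axis k (1::real) $ i *\<^sub>R c i) = (c k :: 'a::real_vector)"
  "(\<Sum>i\<in>UNIV. (s * axis k (1::real) $ i) *\<^sub>R c i) = (s *\<^sub>R c k :: 'a::real_vector)"
  by (simp_all add: axis_def if_distrib[of "\<lambda>r. r *\<^sub>R _"] if_distrib[of "\<lambda>r. s * r"] cong: if_cong)

lemma has_derivative_partial_deriv:
  fixes f :: "'d::finite cfun"
  assumes "f differentiable (at x)"
  shows "(f has_derivative (\<lambda>h. \<Sum>i\<in>UNIV. h $ i *\<^sub>R partial_deriv i f x)) (at x)"
proof -
  obtain F where F: "(f has_derivative F) (at x)" using assms by (auto simp: differentiable_def)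
  then have lin: "linear F" by (rule has_derivative_linear)
  have "F h = (\<Sum>i\<in>UNIV. h $ i *\<^sub>R partial_deriv i f x)" for h
  proof -
    have "F h = F (\<Sum>i\<in>UNIV. h $ i *\<^sub>R axis i 1)"
      using basis_expansion[of h] by (simp add: scalar_mult_eq_scaleR)
    also have "\<dots> = (\<Sum>i\<in>UNIV. h $ i *\<^sub>R F (axis i 1))"
      using lin by (simp add: linear_sum linear_cmul)
    finally show ?thesis using partial_deriv_eqI[OF F] by simp
  qed
  then have "F = (\<lambda>h. \<Sum>i\<in>UNIV. h $ i *\<^sub>R partial_deriv i f x)" by auto
  with F show ?thesis by simp
qed

lemma partial_deriv_cong:
  assumes "open S" "x \<in> S" "\<And>y. y \<in> S \<Longrightarrow> f y = g y"
  shows "partial_deriv i f x = partial_deriv i g x"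
proof -
  have "continuous_on UNIV (\<lambda>t::real. x + t *\<^sub>R axis i (1::real))"
    by (intro continuous_intros)
  from continuous_open_preimage[OF this open_UNIV assms(1)]
  have "open {t. x + t *\<^sub>R axis i 1 \<in> S}" by (simp add: vimage_def)
  then have "\<forall>\<^sub>F t in nhds 0. x + t *\<^sub>R axis i 1 \<in> S"
    using assms(2) by (auto simp: eventually_nhds intro!: exI[of _ "{t. x + t *\<^sub>R axis i 1 \<in> S}"])
  then have "\<forall>\<^sub>F t in nhds 0. t \<in> UNIV \<longrightarrow> f (x + t *\<^sub>R axis i 1) = g (x + t *\<^sub>R axis i 1)"
    by (rule eventually_mono) (use assms(3) in auto)
  then show ?thesis
    unfolding partial_deriv_def by (intro vector_derivative_cong_eq) auto
qed

lemma partial_derivs_cong: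
  assumes "open S" "\<And>y. y \<in> S \<Longrightarrow> f y = g y" "x \<in> S"
  shows "partial_derivs is f x = partial_derivs is g x"
  using assms(3)
proof (induction "is" arbitrary: x)
  case (Cons i "is")
  show ?case
    unfolding partial_derivs.simps by (rule partial_deriv_cong[OF assms(1) Cons.prems Cons.IH])
qed (use assms in auto)

lemma mderiv_cong:
  assumes "open S" "\<And>y. y \<in> S \<Longrightarrow> f y = g y" "x \<in> S"
  shows "mderiv \<alpha> f x = mderiv \<alpha> g x"
  using partial_derivs_cong[OF assms] by (simp add: mderiv_def)

lemma smooth_differentiable:
  "f \<in> smooth_functions S \<Longrightarrow> x \<in> S \<Longrightarrow> partial_derivs is f differentiable (at x)"
  by (auto simp: smooth_functions_def)

lemma smooth_differentiable0: "f \<in> smooth_functions S \<Longrightarrow> x \<in> S \<Longrightarrow> f differentiable (at x)"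
  using smooth_differentiable[of f S x "[]"] by simp

lemma smooth_has_derivative:
  assumes "f \<in> smooth_functions S" "x \<in> S"
  shows "(f has_derivative (\<lambda>h. \<Sum>i\<in>UNIV. h $ i *\<^sub>R partial_deriv i f x)) (at x)"
  by (rule has_derivative_partial_deriv) (rule smooth_differentiable0[OF assms])

lemma smooth_partial_derivs: "f \<in> smooth_functions S \<Longrightarrow> partial_derivs js f \<in> smooth_functions S"
  by (auto simp: smooth_functions_def partial_derivs_append[symmetric])

lemma smooth_mderiv: "f \<in> smooth_functions S \<Longrightarrow> mderiv \<alpha> f \<in> smooth_functions S"
  by (simp add: mderiv_def smooth_partial_derivs)

lemma smooth_subset: "f \<in> smooth_functions S \<Longrightarrow> R \<subseteq> S \<Longrightarrow> f \<in> smooth_functions R"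
  by (auto simp: smooth_functions_def)

lemma differentiable_cong_open:
  assumes "f differentiable (at x)" "open S" "x \<in> S" "\<And>y. y \<in> S \<Longrightarrow> f y = g y"
  shows "g differentiable (at x)"
  using assms has_derivative_transform_within_open[of f _ x UNIV S g]
  by (auto simp: differentiable_def)

lemma smooth_cong:
  assumes "open S" "\<And>y. y \<in> S \<Longrightarrow> f y = g y" "f \<in> smooth_functions S"
  shows "g \<in> smooth_functions S"
  unfolding smooth_functions_def
proof (intro CollectI allI ballI)
  fix "is" x assume "x \<in> S"
  then show "partial_derivs is g differentiable (at x)"
    by (intro differentiable_cong_open[OF smooth_differentiable[OF assms(3)] assms(1)])
       (auto intro: partial_derivs_cong[OF assms(1,2)])
qed

lemma smooth_continuous_on: "f \<in> smooth_functions S \<Longrightarrow> continuous_on S f"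
  by (meson differentiable_at_imp_differentiable_on differentiable_imp_continuous_on
      smooth_differentiable0)

text \<open>Closure properties of smooth functions follow one pattern: guess the derivatives of all orders
  at once and check a single differentiation step.  Smoothness and the formula for the derivatives
  have to be proved together, since the formula at one order is what makes the next derivative
  meaningful.\<close>

lemma smooth_derivative_family:
  fixes G :: "'d::finite list \<Rightarrow> 'd cfun"
  assumes S: "open S" and base: "\<And>x. x \<in> S \<Longrightarrow> f x = G [] x"
    and diff: "\<And>is x. x \<in> S \<Longrightarrow> G is differentiable (at x)"
    and step: "\<And>i is x. x \<in> S \<Longrightarrow> partial_deriv i (G is) x = G (i # is) x"
  shows "f \<in> smooth_functions S" and "x \<in> S \<Longrightarrow> partial_derivs is f x = G is x"
proof -
  have eq: "partial_derivs is f x = G is x" if "x \<in> S" for x "is"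
    using that
  proof (induction "is" arbitrary: x)
    case (Cons i "is")
    have "partial_deriv i (partial_derivs is f) x = partial_deriv i (G is) x"
      by (rule partial_deriv_cong[OF S Cons.prems]) (rule Cons.IH)
    then show ?case using step[OF Cons.prems] by simp
  qed (use base in simp)
  show "x \<in> S \<Longrightarrow> partial_derivs is f x = G is x" by (rule eq)
  show "f \<in> smooth_functions S"
    unfolding smooth_functions_def
  proof (intro CollectI allI ballI)
    fix "is" x assume x: "x \<in> S"
    show "partial_derivs is f differentiable (at x)"
      by (rule differentiable_cong_open[OF diff[OF x] S x]) (rule eq[symmetric])
  qed
qed

lemma
  assumes S: "open S" and f: "f \<in> smooth_functions S" and g: "g \<in> smooth_functions S"
  shows smooth_add: "(\<lambda>x. f x + g x) \<in> smooth_functions S"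
    and partial_derivs_add: "x \<in> S \<Longrightarrow>
      partial_derivs is (\<lambda>x. f x + g x) x = partial_derivs is f x + partial_derivs is g x"
proof -
  let ?G = "\<lambda>is x. partial_derivs is f x + partial_derivs is g x"
  note d = smooth_has_derivative[OF smooth_partial_derivs[OF f]]
    smooth_has_derivative[OF smooth_partial_derivs[OF g]]
  have D: "?G is differentiable (at x)" if "x \<in> S" for "is" x
    using that by (intro differentiable_add smooth_differentiable[OF f] smooth_differentiable[OF g])
  have E: "partial_deriv i (?G is) x = ?G (i # is) x" if "x \<in> S" for i "is" x
    by (subst partial_deriv_eqI[OF has_derivative_add[OF d(1)[OF that] d(2)[OF that]]])
       (simp add: sum_axis_scaleR)
  show "(\<lambda>x. f x + g x) \<in> smooth_functions S"
    by (rule smooth_derivative_family(1)[OF S, where G = ?G]) (simp_all only: D E partial_derivs.simps(1))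
  show "x \<in> S \<Longrightarrow> partial_derivs is (\<lambda>x. f x + g x) x = ?G is x"
    by (rule smooth_derivative_family(2)[OF S, where G = ?G]) (simp_all only: D E partial_derivs.simps(1))
qed

lemma
  assumes S: "open S" and f: "f \<in> smooth_functions S"
  shows smooth_cmult: "(\<lambda>x. c * f x) \<in> smooth_functions S"
    and partial_derivs_cmult: "x \<in> S \<Longrightarrow>
      partial_derivs is (\<lambda>x. c * f x) x = c * partial_derivs is f x"
proof -
  let ?G = "\<lambda>is x. c * partial_derivs is f x"
  note d = smooth_has_derivative[OF smooth_partial_derivs[OF f]]
  have D: "?G is differentiable (at x)" if "x \<in> S" for "is" x
    using that by (intro differentiable_mult differentiable_const smooth_differentiable[OF f])
  have E: "partial_deriv i (?G is) x = ?G (i # is) x" if "x \<in> S" for i "is" x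
    by (subst partial_deriv_eqI[OF has_derivative_mult_right[OF d[OF that]]])
       (simp add: sum_axis_scaleR)
  show "(\<lambda>x. c * f x) \<in> smooth_functions S"
    by (rule smooth_derivative_family(1)[OF S, where G = ?G]) (simp_all only: D E partial_derivs.simps(1))
  show "x \<in> S \<Longrightarrow> partial_derivs is (\<lambda>x. c * f x) x = ?G is x"
    by (rule smooth_derivative_family(2)[OF S, where G = ?G]) (simp_all only: D E partial_derivs.simps(1))
qed

lemma
  assumes S: "open S" and f: "f \<in> smooth_functions S" and g: "g \<in> smooth_functions S"
  shows smooth_diff: "(\<lambda>x. f x - g x) \<in> smooth_functions S"
    and partial_derivs_diff: "x \<in> S \<Longrightarrow>
      partial_derivs is (\<lambda>x. f x - g x) x = partial_derivs is f x - partial_derivs is g x"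
proof -
  have eq: "(\<lambda>x. f x - g x) = (\<lambda>x. f x + -1 * g x)" by auto
  show "(\<lambda>x. f x - g x) \<in> smooth_functions S"
    unfolding eq by (intro smooth_add smooth_cmult S f g)
  show "partial_derivs is (\<lambda>x. f x - g x) x = partial_derivs is f x - partial_derivs is g x"
    if "x \<in> S"
    unfolding eq partial_derivs_add[OF S f smooth_cmult[OF S g] that] partial_derivs_cmult[OF S g that]
    by simp
qed

lemma partial_derivs_zero: "partial_derivs is (\<lambda>x. 0) = (\<lambda>x. 0)"
proof (induction "is")
  case (Cons i "is")
  then show ?case by (auto simp: partial_deriv_eqI[OF has_derivative_const])
qed simp

lemma smooth_zero: "(\<lambda>x. 0) \<in> smooth_functions S"
  by (auto simp: smooth_functions_def partial_derivs_zero)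

lemma partial_derivs_sum:
  assumes S: "open S" and f: "\<And>a. a \<in> I \<Longrightarrow> f a \<in> smooth_functions S"
  and x: "x \<in> S"
  shows "partial_derivs is (\<lambda>x. \<Sum>a\<in>I. f a x) x = (\<Sum>a\<in>I. partial_derivs is (f a) x)"
proof -
  have "(\<lambda>x. \<Sum>a\<in>I. f a x) \<in> smooth_functions S \<and> (\<forall>x\<in>S.
      partial_derivs is (\<lambda>x. \<Sum>a\<in>I. f a x) x = (\<Sum>a\<in>I. partial_derivs is (f a) x))"
    using f
  proof (induction I rule: infinite_finite_induct)
    case (insert a I)
    then show ?case
      by (auto simp: partial_derivs_add[OF S] intro!: smooth_add[OF S])
  qed (auto simp: partial_derivs_zero smooth_zero)
  then show ?thesis using x by blast
qed

lemma
  assumes R: "open R" and f: "f \<in> smooth_functions S" and sub: "\<And>y. y \<in> R \<Longrightarrow> a + s *\<^sub>R y \<in> S"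
  shows smooth_affine: "(\<lambda>y. f (a + s *\<^sub>R y)) \<in> smooth_functions R"
    and partial_derivs_affine: "x \<in> R \<Longrightarrow>
      partial_derivs is (\<lambda>y. f (a + s *\<^sub>R y)) x = s ^ length is *\<^sub>R partial_derivs is f (a + s *\<^sub>R x)"
proof -
  let ?G = "\<lambda>is x. s ^ length is *\<^sub>R partial_derivs is f (a + s *\<^sub>R x)"
  have d: "(?G is has_derivative (\<lambda>h. s ^ length is *\<^sub>R
      (\<Sum>i\<in>UNIV. (s *\<^sub>R h) $ i *\<^sub>R partial_deriv i (partial_derivs is f) (a + s *\<^sub>R x)))) (at x)"
    if "x \<in> R" for "is" x
  proof -
    have "((\<lambda>y. a + s *\<^sub>R y) has_derivative (\<lambda>h. s *\<^sub>R h)) (at x)"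
      by (auto intro!: derivative_eq_intros)
    from has_derivative_compose[OF this
        smooth_has_derivative[OF smooth_partial_derivs[OF f] sub[OF that]]]
    show ?thesis by (intro has_derivative_scaleR_right) simp
  qed
  have D: "?G is differentiable (at x)" if "x \<in> R" for "is" x
    using d[OF that] by (blast intro: differentiableI)
  have E: "partial_deriv i (?G is) x = ?G (i # is) x" if "x \<in> R" for i "is" x
    by (subst partial_deriv_eqI[OF d[OF that]]) (simp add: sum_axis_scaleR)
  have B: "f (a + s *\<^sub>R x) = ?G [] x" for x by simp
  show "(\<lambda>y. f (a + s *\<^sub>R y)) \<in> smooth_functions R"
    by (rule smooth_derivative_family(1)[OF R, where G = ?G]) (erule D E | rule B)+
  show "x \<in> R \<Longrightarrow> partial_derivs is (\<lambda>y. f (a + s *\<^sub>R y)) x = ?G is x"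
    by (rule smooth_derivative_family(2)[OF R, where G = ?G]) (erule D E | rule B | assumption)+
qed

section \<open>The product rule\<close>

text \<open>The ways to distribute a list of differentiations over the two factors of a product, with
  multiplicity; summing over this list avoids binomial coefficients.\<close>

primrec list_splits :: "'a list \<Rightarrow> ('a list \<times> 'a list) list" where
  "list_splits [] = [([], [])]"
| "list_splits (i # is) =
     map (\<lambda>(js, ks). (i # js, ks)) (list_splits is) @ map (\<lambda>(js, ks). (js, i # ks)) (list_splits is)"

lemma length_list_splits: "length (list_splits is) = 2 ^ length is"
  by (induction "is") auto

lemma list_splits_length_le:
  "(js, ks) \<in> set (list_splits is) \<Longrightarrow> length js \<le> length is \<and> length ks \<le> length is"
  by (induction "is" arbitrary: js ks) force+

lemma
  assumes S: "open S" and f: "f \<in> smooth_functions S" and g: "g \<in> smooth_functions S"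
  shows smooth_mult: "(\<lambda>x. f x * g x) \<in> smooth_functions S"
    and partial_derivs_mult: "x \<in> S \<Longrightarrow> partial_derivs is (\<lambda>x. f x * g x) x =
      (\<Sum>(js, ks)\<leftarrow>list_splits is. partial_derivs js f x * partial_derivs ks g x)"
proof -
  let ?P = "\<lambda>l x. \<Sum>(js, ks)\<leftarrow>l. partial_derivs js f x * partial_derivs ks g x"
  let ?d = "\<lambda>l x i. (\<Sum>(js, ks)\<leftarrow>l. partial_deriv i (partial_derivs js f) x * partial_derivs ks g x)
     + (\<Sum>(js, ks)\<leftarrow>l. partial_derivs js f x * partial_deriv i (partial_derivs ks g) x)"
  let ?G = "\<lambda>is. ?P (list_splits is)"
  have d: "(?P l has_derivative (\<lambda>h. \<Sum>i\<in>UNIV. h $ i *\<^sub>R ?d l x i)) (at x)" if "x \<in> S" for l x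
  proof (induction l)
    case (Cons p l)
    obtain js ks where p: "p = (js, ks)" by force
    have "((\<lambda>x. partial_derivs js f x * partial_derivs ks g x + ?P l x) has_derivative
       (\<lambda>h. (partial_derivs js f x * (\<Sum>i\<in>UNIV. h $ i *\<^sub>R partial_deriv i (partial_derivs ks g) x)
         + (\<Sum>i\<in>UNIV. h $ i *\<^sub>R partial_deriv i (partial_derivs js f) x) * partial_derivs ks g x)
         + (\<Sum>i\<in>UNIV. h $ i *\<^sub>R ?d l x i))) (at x)"
      by (intro has_derivative_add has_derivative_mult Cons
          smooth_has_derivative[OF smooth_partial_derivs[OF f] that]
          smooth_has_derivative[OF smooth_partial_derivs[OF g] that])
    then show ?case
      unfolding p list.map sum_list.Cons prod.case
      by (rule has_derivative_eq_rhs)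
         (simp add: fun_eq_iff sum_distrib_left sum_distrib_right sum.distrib[symmetric] scaleR_add_right
           add_ac)
  qed simp
  have D: "?G is differentiable (at x)" if "x \<in> S" for "is" x
    using d[OF that] by (blast intro: differentiableI)
  have E: "partial_deriv i (?G is) x = ?G (i # is) x" if "x \<in> S" for i "is" x
    by (subst partial_deriv_eqI[OF d[OF that]])
       (simp add: sum_axis_scaleR comp_def case_prod_unfold)
  have B: "f x * g x = ?G [] x" for x by simp
  show "(\<lambda>x. f x * g x) \<in> smooth_functions S"
    by (rule smooth_derivative_family(1)[OF S, where G = ?G]) (erule D E | rule B)+
  show "x \<in> S \<Longrightarrow> partial_derivs is (\<lambda>x. f x * g x) x = ?G is x"
    by (rule smooth_derivative_family(2)[OF S, where G = ?G]) (erule D E | rule B | assumption)+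
qed

text \<open>The product rule for a list of length \<open>n\<close> has \<open>2 ^ n\<close> terms.\<close>

lemma norm_partial_derivs_mult_le:
  assumes S: "open S" and f: "f \<in> smooth_functions S" and g: "g \<in> smooth_functions S" and x: "x \<in> S"
    and A: "\<And>js. length js \<le> length is \<Longrightarrow> norm (partial_derivs js f x) \<le> A"
    and B: "\<And>ks. length ks \<le> length is \<Longrightarrow> norm (partial_derivs ks g x) \<le> B"
  shows "norm (partial_derivs is (\<lambda>x. f x * g x) x) \<le> 2 ^ length is * (A * B)"
proof -
  have "norm (\<Sum>(js, ks)\<leftarrow>l. partial_derivs js f x * partial_derivs ks g x) \<le> length l * (A * B)"
    if "\<And>js ks. (js, ks) \<in> set l \<Longrightarrow> length js \<le> length is \<and> length ks \<le> length is" for l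
    using that
  proof (induction l)
    case (Cons p l)
    obtain js ks where p: "p = (js, ks)" by force
    have len: "length js \<le> length is" "length ks \<le> length is"
      using Cons.prems[of js ks] by (auto simp: p)
    have A0: "A \<ge> 0" using A[of "[]"] order_trans[OF norm_ge_zero] by auto
    have "norm (partial_derivs js f x * partial_derivs ks g x) \<le> A * B"
      unfolding norm_mult by (intro mult_mono A B len A0 norm_ge_zero)
    moreover have "norm (\<Sum>(js, ks)\<leftarrow>l. partial_derivs js f x * partial_derivs ks g x) \<le> length l * (A * B)"
      using Cons by auto
    ultimately show ?case
      unfolding p by (simp add: algebra_simps) (smt (verit) norm_triangle_ineq)
  qed simp
  from this[of "list_splits is"] list_splits_length_le[where 'a='a] show ?thesis
    by (simp add: partial_derivs_mult[OF S f g x] length_list_splits)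
qed

section \<open>Taylor's formula and symmetry of mixed partial derivatives\<close>

definition list_power :: "real^'d \<Rightarrow> 'd::finite list \<Rightarrow> real" where
  "list_power z is = (\<Prod>i\<leftarrow>is. z $ i)"

text \<open>As a list, a multi-index \<open>\<alpha>\<close> of order \<open>k\<close> occurs \<open>k! / \<alpha>!\<close> times, which turns the usual
  coefficient \<open>1 / \<alpha>!\<close> into \<open>1 / k!\<close>.\<close>

definition taylor_poly :: "nat \<Rightarrow> 'd::finite cfun \<Rightarrow> real^'d \<Rightarrow> real^'d \<Rightarrow> complex" where
  "taylor_poly n f x z =
     (\<Sum>k<n. (1 / fact k) *\<^sub>R (\<Sum>is | length is = k. list_power z is *\<^sub>R partial_derivs is f x))"

lemma finite_lists_length_eq_UNIV: "finite {is :: 'd::finite list. length is = k}"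
  using finite_lists_length_eq[of "UNIV :: 'd set" k] by simp

lemma finite_lists_length_le_UNIV: "finite {is :: 'd::finite list. length is \<le> k}"
  using finite_lists_length_le[of "UNIV :: 'd set" k] by simp

lemma card_lists_length_eq_UNIV: "card {is :: 'd::finite list. length is = k} = CARD('d) ^ k"
  using card_lists_length_eq[of "UNIV :: 'd set" k] by simp

lemma abs_list_power_le: "\<bar>list_power z is\<bar> \<le> norm z ^ length is"
proof (induction "is")
  case (Cons i "is")
  have "\<bar>z $ i\<bar> * \<bar>list_power z is\<bar> \<le> norm z * norm z ^ length is"
    by (intro mult_mono Cons component_le_norm_cart) auto
  then show ?case by (simp add: list_power_def abs_mult)
qed (simp add: list_power_def)

lemma sum_lists_length_Suc:
  "(\<Sum>is | length is = Suc k. F is) = (\<Sum>is | length (is :: 'd::finite list) = k. \<Sum>i\<in>UNIV. F (i # is))"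
proof -
  have "(\<Sum>is | length is = Suc k. F is) = (\<Sum>(is, i)\<in>{is. length is = k} \<times> UNIV. F (i # is))"
    by (rule sum.reindex_bij_witness[of _ "\<lambda>(is, i). i # is" "\<lambda>is. (tl is, hd is)"])
       (auto simp: length_Suc_conv)
  then show ?thesis by (simp add: sum.cartesian_product)
qed

lemma taylor_poly_1: "taylor_poly 1 f x z = f x"
  by (simp add: taylor_poly_def list_power_def)

lemma taylor_poly_2:
  "taylor_poly 2 f x z = f x + (\<Sum>i\<in>UNIV. z $ i *\<^sub>R partial_deriv i f x)"
proof -
  have "{..<2} = {0, Suc 0}" by auto
  then show ?thesis by (simp add: taylor_poly_def list_power_def sum_lists_length_Suc)
qed

text \<open>The one-dimensional formula along the segment from \<open>x\<close> to \<open>x + z\<close>.  Its \<open>n\<close>-th derivative is a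
  sum over the \<open>d ^ n\<close> lists of length \<open>n\<close>, and the weight in the integral remainder is at most \<open>1\<close>.\<close>

lemma smooth_taylor_bound:
  fixes f :: "'d::finite cfun"
  assumes f: "f \<in> smooth_functions S" and n: "n > 0"
    and line: "\<And>t. 0 \<le> t \<Longrightarrow> t \<le> 1 \<Longrightarrow> x + t *\<^sub>R z \<in> S"
    and bound: "\<And>is t. length is = n \<Longrightarrow> 0 \<le> t \<Longrightarrow> t \<le> 1 \<Longrightarrow> norm (partial_derivs is f (x + t *\<^sub>R z)) \<le> B"
  shows "norm (f (x + z) - taylor_poly n f x z) \<le> (real CARD('d) * norm z) ^ n * B"
proof -
  define Df where "Df m t = (\<Sum>is | length is = m. list_power z is *\<^sub>R partial_derivs is f (x + t *\<^sub>R z))" for m t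
  have Df: "(Df m has_vector_derivative Df (Suc m) t) (at t within {0..1})" if "0 \<le> t" "t \<le> 1" for m t
  proof -
    have "((\<lambda>t. partial_derivs is f (x + t *\<^sub>R z)) has_vector_derivative
        (\<Sum>i\<in>UNIV. z $ i *\<^sub>R partial_deriv i (partial_derivs is f) (x + t *\<^sub>R z))) (at t)" for "is"
      by (rule has_vector_derivative_along_line)
         (rule smooth_has_derivative[OF smooth_partial_derivs[OF f] line[OF that]])
    then have "((\<lambda>t. \<Sum>is | length is = m. list_power z is *\<^sub>R partial_derivs is f (x + t *\<^sub>R z))
        has_vector_derivative (\<Sum>is | length is = m. list_power z is *\<^sub>R
        (\<Sum>i\<in>UNIV. z $ i *\<^sub>R partial_deriv i (partial_derivs is f) (x + t *\<^sub>R z)))) (at t)"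
      by (intro has_vector_derivative_sum bounded_linear.has_vector_derivative[OF bounded_linear_scaleR_right])
    then have "(Df m has_vector_derivative Df (Suc m) t) (at t)"
      by (simp add: Df_def[abs_def] sum_lists_length_Suc list_power_def scaleR_sum_right mult_ac)
    then show ?thesis by (rule has_vector_derivative_at_within)
  qed
  let ?i = "\<lambda>t. ((1 - t) ^ (n - 1) / fact (n - 1)) *\<^sub>R Df n t"
  have Dfn: "norm (Df n t) \<le> (real CARD('d) * norm z) ^ n * B" if "0 \<le> t" "t \<le> 1" for t
  proof -
    have "norm (Df n t) \<le> (\<Sum>is :: 'd list | length is = n. norm z ^ n * B)"
      unfolding Df_def
    proof (rule sum_norm_le)
      fix "is" :: "'d list" assume "is \<in> {is. length is = n}"
      then have l: "length is = n" by simp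
      show "norm (list_power z is *\<^sub>R partial_derivs is f (x + t *\<^sub>R z)) \<le> norm z ^ n * B"
        unfolding norm_scaleR using abs_list_power_le[of z "is"] l
        by (intro mult_mono bound[OF l that]) auto
    qed
    also have "\<dots> = (real CARD('d) * norm z) ^ n * B"
      by (simp add: card_lists_length_eq_UNIV power_mult_distrib)
    finally show ?thesis .
  qed
  have int: "?i integrable_on {0..1}" and
    eq: "Df 0 1 = (\<Sum>k<n. ((1 - 0) ^ k / fact k) *\<^sub>R Df k 0) + integral {0..1} ?i"
    using Taylor_integrable[of n Df "Df 0" 0 1] Taylor_integral[of n Df "Df 0" 0 1] n Df by simp_all
  have "norm (integral {0..1} ?i) \<le> integral {0..1} (\<lambda>t::real. (real CARD('d) * norm z) ^ n * B)"
  proof (rule integral_norm_bound_integral[OF int])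
    fix t :: real assume "t \<in> {0..1}"
    then have t: "0 \<le> t" "t \<le> 1" by auto
    have "(1 - t) ^ (n - 1) / fact (n - 1) \<le> 1 / 1"
      using t by (intro frac_le) (auto simp: power_le_one fact_ge_1)
    then have "\<bar>(1 - t) ^ (n - 1) / fact (n - 1)\<bar> \<le> 1" using t by auto
    then show "norm (?i t) \<le> (real CARD('d) * norm z) ^ n * B"
      unfolding norm_scaleR using mult_mono[OF _ Dfn[OF t] zero_le_one norm_ge_zero] by (simp only: mult_1)
  qed auto
  moreover have "(\<Sum>k<n. ((1 - 0) ^ k / fact k) *\<^sub>R Df k 0) = taylor_poly n f x z"
    by (simp add: taylor_poly_def Df_def)
  moreover have "Df 0 1 = f (x + z)" by (simp add: Df_def list_power_def)
  moreover have "integral {0..1} ?i = f (x + z) - taylor_poly n f x z"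
    using eq unfolding calculation by (simp only: add_diff_cancel_left')
  ultimately show ?thesis by simp
qed

lemma smooth_bounded_on_compact:
  assumes f: "f \<in> smooth_functions S" and K: "compact K" "K \<subseteq> S"
  obtains B where "B \<ge> 0" "\<And>is x. length is \<le> N \<Longrightarrow> x \<in> K \<Longrightarrow> norm (partial_derivs is f x) \<le> B"
proof -
  let ?A = "(\<lambda>x. norm x) ` (\<Union>is\<in>{is. length is \<le> N}. partial_derivs is f ` K)"
  have "bounded (\<Union>is\<in>{is. length is \<le> N}. partial_derivs is f ` K)"
    using finite_lists_length_le_UNIV
  proof (intro bounded_UN ballI)
    fix "is"
    have "continuous_on K (partial_derivs is f)"
      using smooth_continuous_on[OF smooth_partial_derivs[OF f]] K(2) continuous_on_subset by blast
    then show "bounded (partial_derivs is f ` K)"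
      using K(1) compact_continuous_image compact_imp_bounded by blast
  qed
  then obtain B where "B > 0" "\<forall>y\<in>(\<Union>is\<in>{is. length is \<le> N}. partial_derivs is f ` K). norm y \<le> B"
    unfolding bounded_pos by auto
  then show ?thesis by (intro that[of B]) auto
qed

text \<open>The second difference is symmetric in the two directions, so this expansion, read for both orders
  of \<open>i\<close> and \<open>j\<close>, identifies the mixed derivatives.\<close>

lemma smooth_second_difference:
  fixes f :: "'d::finite cfun"
  assumes f: "f \<in> smooth_functions S" and sub: "cball x (2 * e) \<subseteq> S" and h: "0 < h" "h < e"
    and B: "\<And>is y. length is \<le> 3 \<Longrightarrow> y \<in> cball x (2 * e) \<Longrightarrow> norm (partial_derivs is f y) \<le> B"
  defines "c \<equiv> real CARD('d)"
  shows "norm (f (x + h *\<^sub>R axis i 1 + h *\<^sub>R axis j 1) - f (x + h *\<^sub>R axis i 1) - f (x + h *\<^sub>R axis j 1) + f x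
      - h\<^sup>2 *\<^sub>R partial_deriv i (partial_deriv j f) x) \<le> (c ^ 3 + c ^ 2) * B * h ^ 3"
proof -
  let ?a = "h *\<^sub>R axis i (1::real) :: real^'d" and ?b = "h *\<^sub>R axis j (1::real) :: real^'d"
  \<comment> \<open>The second difference is the difference of \<open>G\<close> in direction \<open>j\<close>; the factor \<open>1\<close> matches
    \<open>smooth_affine\<close>.\<close>
  define G where "G y = f (?a + 1 *\<^sub>R y) - f y" for y
  have na: "norm ?a = h" and nb: "norm ?b = h" using h by simp_all
  have shift: "?a + 1 *\<^sub>R y \<in> ball x (2 * e)" if "y \<in> ball x e" for y
    using that h na norm_triangle_ineq[of "y - x" ?a] by (simp add: dist_norm norm_minus_commute algebra_simps)
  have bsub: "ball x e \<subseteq> ball x (2 * e)" "ball x (2 * e) \<subseteq> S" using h sub by force+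
  have fe: "f \<in> smooth_functions (ball x (2 * e))" using smooth_subset[OF f] bsub by auto
  have fs: "f \<in> smooth_functions (ball x e)" using smooth_subset[OF fe] bsub by auto
  have fa1: "(\<lambda>y. f (?a + 1 *\<^sub>R y)) \<in> smooth_functions (ball x e)"
    by (rule smooth_affine[OF open_ball fe]) (rule shift)
  have fa2: "partial_derivs is (\<lambda>y. f (?a + 1 *\<^sub>R y)) y = partial_derivs is f (?a + y)"
    if "y \<in> ball x e" for "is" y
    using partial_derivs_affine[OF open_ball fe, of x e ?a 1 y "is"] shift that by simp
  have G: "G \<in> smooth_functions (ball x e)"
    unfolding G_def[abs_def] by (intro smooth_diff open_ball fa1 fs)
  have dG: "partial_derivs is G y = partial_derivs is f (y + ?a) - partial_derivs is f y"
    if "y \<in> ball x e" for "is" y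
    unfolding G_def[abs_def] partial_derivs_diff[OF open_ball fa1 fs that] fa2[OF that]
    by (simp add: add.commute)
  have Bb: "norm (partial_derivs is (partial_derivs js f) y) \<le> B"
    if "length is + length js \<le> 3" "y \<in> ball x (2 * e)" for "is" js y
    using B[of "is @ js" y] that unfolding partial_derivs_append by simp
  have th: "\<bar>t * h\<bar> \<le> h" if "0 \<le> t" "t \<le> 1" for t
    using h that mult_right_mono[of t 1 h] by (simp add: abs_mult)
  have line: "x + t *\<^sub>R ?b \<in> ball x e" "x + t *\<^sub>R ?a \<in> ball x e" if "0 \<le> t" "t \<le> 1" for t
    using le_less_trans[OF th[OF that] h(2)] by (simp_all add: dist_norm)
  have T1: "norm (partial_derivs is f (y + ?a) - partial_derivs is f y) \<le> c * h * B"
    if "length is \<le> 2" "y \<in> ball x e" for "is" y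
  proof -
    have l: "y + t *\<^sub>R ?a \<in> ball x (2 * e)" if "0 \<le> t" "t \<le> 1" for t
    proof -
      have "norm (t *\<^sub>R ?a) \<le> h" using th[OF that] by simp
      then show ?thesis
        using \<open>y \<in> ball x e\<close> h norm_triangle_ineq[of "y - x" "t *\<^sub>R ?a"] by (simp add: dist_norm norm_minus_commute algebra_simps)
    qed
    have "norm (partial_derivs is f (y + ?a) - taylor_poly 1 (partial_derivs is f) y ?a) \<le> (c * norm ?a) ^ 1 * B"
      unfolding c_def
      by (rule smooth_taylor_bound[OF smooth_partial_derivs[OF fe]])
        (use l that(1) in \<open>simp_all add: Bb del: mem_ball\<close>)
    then show ?thesis unfolding taylor_poly_1 na by simp
  qed
  have "norm (G (x + ?b) - taylor_poly 2 G x ?b) \<le> (c * norm ?b) ^ 2 * (c * h * B)"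
    unfolding c_def
    by (rule smooth_taylor_bound[OF G]) (use line dG T1[unfolded c_def] in \<open>simp_all del: mem_ball\<close>)
  also have "taylor_poly 2 G x ?b = G x + h *\<^sub>R partial_deriv j G x"
    by (simp add: taylor_poly_2 sum_axis_scaleR)
  finally have 1: "norm (G (x + ?b) - (G x + h *\<^sub>R partial_deriv j G x)) \<le> c ^ 3 * B * h ^ 3"
    unfolding nb by (simp add: power2_eq_square power3_eq_cube mult_ac)
  have x: "x \<in> ball x e" using h by simp
  have "norm (partial_derivs [j] f (x + ?a) - taylor_poly 2 (partial_derivs [j] f) x ?a) \<le> (c * norm ?a) ^ 2 * B"
    unfolding c_def
    by (rule smooth_taylor_bound[OF smooth_partial_derivs[OF fs]])
       (use line bsub(1) in \<open>simp_all add: Bb subset_iff del: mem_ball partial_derivs.simps\<close>)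
  also have "taylor_poly 2 (partial_derivs [j] f) x ?a = partial_deriv j f x + h *\<^sub>R partial_deriv i (partial_deriv j f) x"
    by (simp add: taylor_poly_2 sum_axis_scaleR)
  also have "partial_derivs [j] f (x + ?a) = partial_deriv j G x + partial_deriv j f x"
    using dG[OF x, of "[j]"] by simp
  finally have "norm (partial_deriv j G x - h *\<^sub>R partial_deriv i (partial_deriv j f) x) \<le> c ^ 2 * h ^ 2 * B"
    unfolding na by (simp add: power_mult_distrib)
  then have "h * norm (partial_deriv j G x - h *\<^sub>R partial_deriv i (partial_deriv j f) x) \<le> h * (c ^ 2 * h ^ 2 * B)"
    using h by simp
  then have 2: "norm (h *\<^sub>R (partial_deriv j G x - h *\<^sub>R partial_deriv i (partial_deriv j f) x)) \<le> c ^ 2 * B * h ^ 3"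
    using h by (simp add: power3_eq_cube power2_eq_square mult_ac)
  have eq: "f (x + ?a + ?b) - f (x + ?a) - f (x + ?b) + f x - h\<^sup>2 *\<^sub>R partial_deriv i (partial_deriv j f) x
     = (G (x + ?b) - (G x + h *\<^sub>R partial_deriv j G x))
       + h *\<^sub>R (partial_deriv j G x - h *\<^sub>R partial_deriv i (partial_deriv j f) x)"
    by (simp add: G_def scaleR_diff_right power2_eq_square add_ac)
  show ?thesis
    unfolding eq using norm_triangle_mono[OF 1 2] by (simp only: distrib_right)
qed

lemma partial_deriv_commute:
  fixes f :: "'d::finite cfun"
  assumes S: "open S" and f: "f \<in> smooth_functions S" and x: "x \<in> S"
  shows "partial_deriv i (partial_deriv j f) x = partial_deriv j (partial_deriv i f) x"
proof -
  obtain r where r: "r > 0" "cball x r \<subseteq> S" using S x open_contains_cball[of S] by blast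
  define e where "e = r / 2"
  have e: "e > 0" "cball x (2 * e) \<subseteq> S" using r by (simp_all add: e_def)
  obtain B where B: "B \<ge> 0" "\<And>is y. length is \<le> 3 \<Longrightarrow> y \<in> cball x (2 * e) \<Longrightarrow> norm (partial_derivs is f y) \<le> B"
    using smooth_bounded_on_compact[OF f compact_cball e(2)] by metis
  define C where "C = 2 * ((real CARD('d) ^ 3 + real CARD('d) ^ 2) * B)"
  let ?d = "norm (partial_deriv i (partial_deriv j f) x - partial_deriv j (partial_deriv i f) x)"
  have "?d \<le> C * h" if h: "0 < h" "h < e" for h
  proof -
    let ?a = "h *\<^sub>R axis i (1::real) :: real^'d" and ?b = "h *\<^sub>R axis j (1::real) :: real^'d"
    have sw: "x + ?b + ?a = x + ?a + ?b" by simp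
    let ?D = "f (x + ?a + ?b) - f (x + ?a) - f (x + ?b) + f x"
    have sD: "f (x + ?a + ?b) - f (x + ?b) - f (x + ?a) + f x = ?D" by simp
    have 1: "norm (?D - h\<^sup>2 *\<^sub>R partial_deriv i (partial_deriv j f) x) \<le> C / 2 * h ^ 3"
      using smooth_second_difference[OF f e(2) h B(2), of i j] by (simp add: C_def)
    have 2: "norm (?D - h\<^sup>2 *\<^sub>R partial_deriv j (partial_deriv i f) x) \<le> C / 2 * h ^ 3"
      using smooth_second_difference[OF f e(2) h B(2), of j i] unfolding sw sD by (simp add: C_def)
    have "norm (h\<^sup>2 *\<^sub>R (partial_deriv i (partial_deriv j f) x - partial_deriv j (partial_deriv i f) x)) \<le> C * h ^ 3"
      using norm_triangle_le_diff[OF add_mono[OF 2 1]] by (simp add: scaleR_diff_right)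
    then have "h\<^sup>2 * ?d \<le> h\<^sup>2 * (C * h)" by (simp add: power2_eq_square power3_eq_cube mult_ac)
    then show ?thesis using h by simp
  qed
  then have "\<forall>\<^sub>F h in at_right 0. ?d \<le> C * h"
    using e(1) by (auto simp: eventually_at_right_field intro!: exI[of _ e])
  moreover have "((\<lambda>h. C * h) \<longlongrightarrow> C * 0) (at_right (0::real))" by (intro tendsto_intros)
  ultimately have "?d \<le> C * 0"
    using tendsto_lowerbound[of "\<lambda>h. C * h" "C * 0" "at_right (0::real)" ?d] by simp
  then show ?thesis by simp
qed

lemma partial_derivs_permute:
  assumes S: "open S" and f: "f \<in> smooth_functions S" and x: "x \<in> S" and "mset is = mset js"
  shows "partial_derivs is f x = partial_derivs js f x"
  using x assms(4)
proof (induction "is" arbitrary: js x)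
  case (Cons i "is")
  have "i \<in> set js" using Cons.prems(2) by (metis list.set_intros(1) set_mset_mset)
  then obtain js1 js2 where js: "js = js1 @ i # js2" by (meson split_list)
  have move: "partial_derivs (js1 @ i # js2) f x = partial_derivs (i # js1 @ js2) f x" if "x \<in> S" for x js1
    using that
  proof (induction js1 arbitrary: x)
    case (Cons j js1)
    have "partial_derivs ((j # js1) @ i # js2) f x = partial_deriv j (partial_derivs (i # js1 @ js2) f) x"
      using partial_deriv_cong[OF S Cons.prems Cons.IH] by simp
    also have "\<dots> = partial_deriv i (partial_deriv j (partial_derivs (js1 @ js2) f)) x"
      using partial_deriv_commute[OF S smooth_partial_derivs[OF f] Cons.prems] by simp
    finally show ?case by simp
  qed simp
  have "mset is = mset (js1 @ js2)" using Cons.prems(2) by (simp add: js)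
  then have "partial_derivs is f y = partial_derivs (js1 @ js2) f y" if "y \<in> S" for y
    using Cons.IH that by blast
  then have "partial_derivs (i # is) f x = partial_derivs (i # js1 @ js2) f x"
    unfolding partial_derivs.simps by (rule partial_deriv_cong[OF S Cons.prems(1)])
  then show ?case using move[OF Cons.prems(1)] by (simp add: js)
qed simp

lemma exists_list_with_counts: "\<exists>is. \<forall>i. count_list is i = (\<alpha> :: 'd::finite \<Rightarrow> nat) i"
proof -
  obtain "is" where "mset is = (\<Sum>i\<in>UNIV. replicate_mset (\<alpha> i) i)" by (metis ex_mset)
  then have "count (mset is) i = \<alpha> i" for i by (simp add: count_sum)
  then show ?thesis by (auto simp: count_mset)
qed

lemma length_eq_msize: "length is = msize (count_list is)" for "is" :: "'d::finite list"
  using sum_count_set[of "is" UNIV] by (simp add: msize_def)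

lemma partial_derivs_eq_mderiv:
  assumes "open S" "f \<in> smooth_functions S" "x \<in> S"
  shows "partial_derivs is f x = mderiv (count_list is) f x"
proof -
  have "\<forall>i. count_list (SOME js. \<forall>i. count_list js i = count_list is i) i = count_list is i"
    by (rule someI[of "\<lambda>js. \<forall>i. count_list js i = count_list is i" "is"]) simp
  then show ?thesis
    unfolding mderiv_def by (intro partial_derivs_permute[OF assms]) (simp add: multiset_eq_iff count_mset)
qed

text \<open>One list serves all functions, so an operator \<open>mderiv \<alpha>\<close> may be replaced by iterated partial
  derivatives throughout an argument.\<close>

lemma mderiv_as_list:
  fixes \<alpha> :: "'d::finite \<Rightarrow> nat"
  obtains "is" where "length is = msize \<alpha>" "\<And>f. mderiv \<alpha> f = partial_derivs is f" "count_list is = \<alpha>"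
proof -
  let ?is = "SOME is. \<forall>i. count_list is i = \<alpha> i"
  have "\<forall>i. count_list ?is i = \<alpha> i" by (rule someI_ex[OF exists_list_with_counts])
  then have "count_list ?is = \<alpha>" by auto
  then show ?thesis using that[of ?is] length_eq_msize[of ?is] by (simp add: mderiv_def)
qed

lemma mderiv_mderiv:
  assumes S: "open S" and f: "f \<in> smooth_functions S" and x: "x \<in> S"
  shows "mderiv \<beta> (mderiv \<alpha> f) x = mderiv (\<lambda>i. \<beta> i + \<alpha> i) f x"
proof -
  obtain "is" where i: "\<And>f. mderiv \<alpha> f = partial_derivs is f" "count_list is = \<alpha>" using mderiv_as_list by metis
  obtain js where j: "\<And>f. mderiv \<beta> f = partial_derivs js f" "count_list js = \<beta>" using mderiv_as_list by metis
  have "count_list (js @ is) = (\<lambda>i. \<beta> i + \<alpha> i)" using i(2) j(2) by auto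
  then show ?thesis
    using partial_derivs_eq_mderiv[OF S f x, of "js @ is"] by (simp add: i j partial_derivs_append)
qed

lemma list_power_eq_mpower: "list_power z is = mpower z (count_list is)"
proof (induction "is")
  case (Cons i "is")
  have "mpower z (count_list (i # is)) = (\<Prod>k\<in>UNIV. (if k = i then z $ i else 1) * (z $ k) ^ count_list is k)"
    unfolding mpower_def by (intro prod.cong) auto
  also have "\<dots> = z $ i * mpower z (count_list is)"
    by (simp add: prod.distrib mpower_def)
  finally show ?case using Cons unfolding list_power_def by (simp only: list.map prod_list.Cons)
qed (simp add: list_power_def mpower_def)

section \<open>Test functions\<close>

lemma test_smooth: "\<phi> \<in> test_functions \<Omega> \<Longrightarrow> \<phi> \<in> smooth_functions UNIV"
  by (simp add: test_functions_def)

lemma test_compact_supp: "\<phi> \<in> test_functions \<Omega> \<Longrightarrow> compact (supp \<phi>)"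
  by (simp add: test_functions_def)

lemma test_supp_subset: "\<phi> \<in> test_functions \<Omega> \<Longrightarrow> supp \<phi> \<subseteq> \<Omega>"
  by (simp add: test_functions_def)

lemma test_UNIV: "\<phi> \<in> test_functions \<Omega> \<Longrightarrow> \<phi> \<in> test_functions UNIV"
  by (simp add: test_functions_def)

lemma zero_outside_supp: "x \<notin> supp f \<Longrightarrow> f x = 0"
  using closure_subset[of "{x. f x \<noteq> 0}"] by (auto simp: supp_def)

lemma closed_supp: "closed (supp f)"
  by (simp add: supp_def)

lemma supp_subsetI: "closed K \<Longrightarrow> (\<And>x. x \<notin> K \<Longrightarrow> f x = 0) \<Longrightarrow> supp f \<subseteq> K"
  unfolding supp_def by (rule closure_minimal) auto

lemma testI:
  assumes "f \<in> smooth_functions UNIV" "compact K" "K \<subseteq> \<Omega>" "\<And>x. x \<notin> K \<Longrightarrow> f x = 0"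
  shows "f \<in> test_functions \<Omega>"
proof -
  have sub: "supp f \<subseteq> K" using supp_subsetI[OF compact_imp_closed[OF assms(2)] assms(4)] .
  have "compact (supp f)" using compact_Int_closed[OF assms(2) closed_supp[of f]] sub by (simp add: Int_absorb1)
  then show ?thesis using assms sub by (auto simp: test_functions_def)
qed

lemma test_if_supp_subset:
  "\<phi> \<in> test_functions \<Omega>' \<Longrightarrow> supp \<phi> \<subseteq> \<Omega> \<Longrightarrow> \<phi> \<in> test_functions \<Omega>"
  by (simp add: test_functions_def)

lemma partial_derivs_zero_outside_supp:
  assumes "x \<notin> supp f" shows "partial_derivs is f x = 0"
proof -
  have "open (- supp f)" using closed_supp by (rule open_Compl)
  then have "partial_derivs is f x = partial_derivs is (\<lambda>x. 0) x"
    by (rule partial_derivs_cong) (use assms in \<open>auto simp: zero_outside_supp\<close>)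
  then show ?thesis by (simp add: partial_derivs_zero)
qed

lemma supp_partial_derivs: "supp (partial_derivs is f) \<subseteq> supp f"
  by (rule supp_subsetI[OF closed_supp partial_derivs_zero_outside_supp])

lemma test_partial_derivs: "\<phi> \<in> test_functions \<Omega> \<Longrightarrow> partial_derivs is \<phi> \<in> test_functions \<Omega>"
  by (rule testI[of _ "supp \<phi>"])
     (auto simp: test_functions_def smooth_partial_derivs partial_derivs_zero_outside_supp)

lemma test_mderiv: "\<phi> \<in> test_functions \<Omega> \<Longrightarrow> mderiv \<alpha> \<phi> \<in> test_functions \<Omega>"
  by (simp add: mderiv_def test_partial_derivs)

lemma test_add:
  assumes "\<phi> \<in> test_functions \<Omega>" "\<psi> \<in> test_functions \<Omega>"
  shows "(\<lambda>x. \<phi> x + \<psi> x) \<in> test_functions \<Omega>"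
  by (rule testI[of _ "supp \<phi> \<union> supp \<psi>"])
     (use assms in \<open>auto simp: test_functions_def zero_outside_supp intro!: smooth_add\<close>)

lemma test_cmult:
  assumes "\<phi> \<in> test_functions \<Omega>"
  shows "(\<lambda>x. c * \<phi> x) \<in> test_functions \<Omega>"
  by (rule testI[of _ "supp \<phi>"])
     (use assms in \<open>auto simp: test_functions_def zero_outside_supp intro!: smooth_cmult\<close>)

lemma test_diff:
  assumes "\<phi> \<in> test_functions \<Omega>" "\<psi> \<in> test_functions \<Omega>"
  shows "(\<lambda>x. \<phi> x - \<psi> x) \<in> test_functions \<Omega>"
  using test_add[OF assms(1) test_cmult[OF assms(2), of "-1"]] by simp

lemma test_zero: "(\<lambda>x. 0) \<in> test_functions \<Omega>"
  by (rule testI[of _ "{}"]) (auto simp: smooth_zero)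

lemma test_sum:
  assumes "\<And>a. a \<in> I \<Longrightarrow> f a \<in> test_functions \<Omega>"
  shows "(\<lambda>x. \<Sum>a\<in>I. f a x) \<in> test_functions \<Omega>"
  using assms by (induction I rule: infinite_finite_induct) (auto simp: test_zero intro!: test_add)

text \<open>The product vanishes outside \<open>supp p\<close>, whatever the values of \<open>f\<close> outside \<open>\<Omega>\<close>; it is smooth on
  the open sets \<open>\<Omega>\<close> and \<open>- supp p\<close>, which cover the space.\<close>

lemma test_mult_smooth:
  assumes \<Omega>: "open \<Omega>" and p: "p \<in> test_functions \<Omega>" and f: "f \<in> smooth_functions \<Omega>"
  shows "(\<lambda>x. p x * f x) \<in> test_functions \<Omega>"
proof (rule testI[of _ "supp p"])
  have 1: "(\<lambda>x. p x * f x) \<in> smooth_functions \<Omega>"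
    using smooth_mult[OF \<Omega> smooth_subset[OF test_smooth[OF p]] f] by simp
  have 2: "(\<lambda>x. p x * f x) \<in> smooth_functions (- supp p)"
    by (rule smooth_cong[OF open_Compl[OF closed_supp] _ smooth_zero]) (simp add: zero_outside_supp)
  have "x \<in> \<Omega> \<or> x \<in> - supp p" for x using test_supp_subset[OF p] by auto
  then show "(\<lambda>x. p x * f x) \<in> smooth_functions UNIV"
    using 1 2 unfolding smooth_functions_def by blast
qed (use p in \<open>auto simp: test_functions_def zero_outside_supp\<close>)

lemma test_affine:
  fixes g :: "'d::finite cfun"
  assumes g: "g \<in> test_functions UNIV" and s: "\<bar>s\<bar> = 1"
  shows "(\<lambda>y. g (a + s *\<^sub>R y)) \<in> test_functions UNIV"
proof -
  have s2: "s * s = 1" using s by (metis abs_mult_self_eq mult_1)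
  show "(\<lambda>y. g (a + s *\<^sub>R y)) \<in> test_functions UNIV"
  proof (rule testI[of _ "(\<lambda>w. (- s *\<^sub>R a) + s *\<^sub>R w) ` supp g"])
    show "(\<lambda>y. g (a + s *\<^sub>R y)) \<in> smooth_functions UNIV"
      by (rule smooth_affine[OF open_UNIV test_smooth[OF g]]) simp
    show "compact ((\<lambda>w. (- s *\<^sub>R a) + s *\<^sub>R w) ` supp g)"
      by (intro compact_continuous_image continuous_intros test_compact_supp[OF g])
    fix x assume "x \<notin> (\<lambda>w. (- s *\<^sub>R a) + s *\<^sub>R w) ` supp g"
    moreover have "x = (- s *\<^sub>R a) + s *\<^sub>R (a + s *\<^sub>R x)" using s2 by (simp add: scaleR_add_right)
    ultimately show "g (a + s *\<^sub>R x) = 0" by (metis image_eqI zero_outside_supp)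
  qed simp
qed

lemma
  assumes g: "g \<in> test_functions UNIV"
  shows test_translate: "(\<lambda>y. g (a + y)) \<in> test_functions UNIV"
    and partial_derivs_translate: "partial_derivs is (\<lambda>y. g (a + y)) = (\<lambda>y. partial_derivs is g (a + y))"
    and test_reflect: "(\<lambda>y. g (a - y)) \<in> test_functions UNIV"
    and partial_derivs_reflect:
      "partial_derivs is (\<lambda>y. g (a - y)) = (\<lambda>y. (-1) ^ length is * partial_derivs is g (a - y))"
  using test_affine[OF g, of 1 a] test_affine[OF g, of "-1" a]
    partial_derivs_affine[OF open_UNIV test_smooth[OF g], of a 1 _ "is"]
    partial_derivs_affine[OF open_UNIV test_smooth[OF g], of a "-1" _ "is"]
  by (auto simp: fun_eq_iff scaleR_conv_of_real)

lemma test_bounded: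
  assumes g: "g \<in> test_functions \<Omega>"
  obtains B where "B \<ge> 0" "\<And>is x. length is \<le> N \<Longrightarrow> norm (partial_derivs is g x) \<le> B"
proof -
  obtain B where B: "B \<ge> 0" "\<And>is x. length is \<le> N \<Longrightarrow> x \<in> supp g \<Longrightarrow> norm (partial_derivs is g x) \<le> B"
    using smooth_bounded_on_compact[OF test_smooth[OF g] test_compact_supp[OF g] subset_UNIV] by metis
  have "norm (partial_derivs is g x) \<le> B" if "length is \<le> N" for "is" x
    using B that by (cases "x \<in> supp g") (auto simp: partial_derivs_zero_outside_supp)
  then show ?thesis using that B(1) by blast
qed

lemma smooth_lipschitz:
  fixes f :: "'d::finite cfun"
  assumes f: "f \<in> smooth_functions UNIV" and B: "\<And>i x. norm (partial_deriv i f x) \<le> B"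
  shows "norm (f x - f y) \<le> (real CARD('d) * B) * dist x y"
proof -
  have "norm (partial_derivs is f z) \<le> B" if "length is = 1" for "is" z
    using that B by (cases "is") auto
  then have "norm (f (y + (x - y)) - taylor_poly 1 f y (x - y)) \<le> (real CARD('d) * norm (x - y)) ^ 1 * B"
    by (intro smooth_taylor_bound[OF f]) auto
  then show ?thesis unfolding taylor_poly_1 by (simp add: dist_norm mult_ac)
qed

section \<open>Distributions\<close>

lemma finite_msize_le: "finite {\<alpha> :: 'd::finite \<Rightarrow> nat. msize \<alpha> \<le> N}"
proof (rule finite_surj[OF finite_lists_length_le_UNIV[of N]])
  show "{\<alpha> :: 'd \<Rightarrow> nat. msize \<alpha> \<le> N} \<subseteq> count_list ` {is. length is \<le> N}"
  proof
    fix \<alpha> :: "'d \<Rightarrow> nat" assume "\<alpha> \<in> {\<alpha>. msize \<alpha> \<le> N}"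
    moreover obtain "is" where "length is = msize \<alpha>" "count_list is = \<alpha>" by (rule mderiv_as_list)
    ultimately show "\<alpha> \<in> count_list ` {is. length is \<le> N}" by auto
  qed
qed

lemma distribution_add:
  "T \<in> distributions \<Omega> \<Longrightarrow> \<phi> \<in> test_functions \<Omega> \<Longrightarrow> \<psi> \<in> test_functions \<Omega> \<Longrightarrow>
    T (\<lambda>x. \<phi> x + \<psi> x) = T \<phi> + T \<psi>"
  by (simp add: distributions_def)

lemma distribution_cmult:
  "T \<in> distributions \<Omega> \<Longrightarrow> \<phi> \<in> test_functions \<Omega> \<Longrightarrow> T (\<lambda>x. c * \<phi> x) = c * T \<phi>"
  by (simp add: distributions_def)

lemma distribution_diff:
  assumes "T \<in> distributions \<Omega>" "\<phi> \<in> test_functions \<Omega>" "\<psi> \<in> test_functions \<Omega>"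
  shows "T (\<lambda>x. \<phi> x - \<psi> x) = T \<phi> - T \<psi>"
proof -
  have "(\<lambda>x. \<phi> x - \<psi> x) = (\<lambda>x. \<phi> x + -1 * \<psi> x)" by auto
  then show ?thesis
    by (simp only: distribution_add[OF assms(1,2) test_cmult[OF assms(3)]] distribution_cmult[OF assms(1,3)])
       simp
qed

text \<open>A single bound \<open>B\<close> for the derivatives of order at most \<open>N\<close> replaces the sum of suprema, so that
  pointwise estimates can be inserted directly.\<close>

lemma distribution_bound:
  fixes T :: "'d::finite functional"
  assumes T: "T \<in> distributions \<Omega>" and K: "compact K" "K \<subseteq> \<Omega>"
  obtains C N where "C \<ge> 0"
    "\<And>\<phi> B. \<phi> \<in> test_functions \<Omega> \<Longrightarrow> supp \<phi> \<subseteq> K \<Longrightarrow>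
      (\<And>is x. length is \<le> N \<Longrightarrow> norm (partial_derivs is \<phi> x) \<le> B) \<Longrightarrow> norm (T \<phi>) \<le> C * B"
proof -
  obtain C N where CN: "\<And>\<phi>. \<phi> \<in> test_functions \<Omega> \<Longrightarrow> supp \<phi> \<subseteq> K \<Longrightarrow>
      norm (T \<phi>) \<le> C * (\<Sum>\<alpha> | msize \<alpha> \<le> N. SUP x. norm (mderiv \<alpha> \<phi> x))"
  proof -
    have "\<forall>K. compact K \<and> K \<subseteq> \<Omega> \<longrightarrow>
        (\<exists>C N. \<forall>\<phi>\<in>test_functions \<Omega>. supp \<phi> \<subseteq> K \<longrightarrow>
           norm (T \<phi>) \<le> C * (\<Sum>\<alpha> | msize \<alpha> \<le> N. SUP x. norm (mderiv \<alpha> \<phi> x)))"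
      using T unfolding distributions_def mem_Collect_eq by (elim conjE)
    then show ?thesis using K that by presburger
  qed
  let ?c = "real (card {\<alpha> :: 'd \<Rightarrow> nat. msize \<alpha> \<le> N})"
  show ?thesis
  proof (rule that[of "\<bar>C\<bar> * ?c" N])
    fix \<phi> B assume \<phi>: "\<phi> \<in> test_functions \<Omega>" "supp \<phi> \<subseteq> K"
      and B: "\<And>is x. length is \<le> N \<Longrightarrow> norm (partial_derivs is \<phi> x) \<le> B"
    have S: "(SUP x. norm (mderiv \<alpha> \<phi> x)) \<le> B \<and> 0 \<le> (SUP x. norm (mderiv \<alpha> \<phi> x))" if "msize \<alpha> \<le> N" for \<alpha>
    proof -
      have le: "norm (mderiv \<alpha> \<phi> x) \<le> B" for x
      proof -
        obtain "is" where "length is = msize \<alpha>" "\<And>f. mderiv \<alpha> f = partial_derivs is f" "count_list is = \<alpha>"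
          using mderiv_as_list[of \<alpha>] by metis
        then show ?thesis using B that by simp
      qed
      have bdd: "bdd_above (range (\<lambda>x. norm (mderiv \<alpha> \<phi> x)))" by (rule bdd_aboveI2[OF le])
      have "0 \<le> norm (mderiv \<alpha> \<phi> 0)" by simp
      also have "\<dots> \<le> (SUP x. norm (mderiv \<alpha> \<phi> x))" by (rule cSUP_upper[OF UNIV_I bdd])
      finally show ?thesis using le by (simp add: cSUP_least)
    qed
    let ?S = "\<Sum>\<alpha> | msize \<alpha> \<le> N. SUP x. norm (mderiv \<alpha> \<phi> x)"
    have "norm (T \<phi>) \<le> C * ?S" by (rule CN[OF \<phi>])
    also have "\<dots> \<le> \<bar>C\<bar> * ?S" by (intro mult_right_mono abs_ge_self sum_nonneg) (use S in auto)
    also have "\<dots> \<le> \<bar>C\<bar> * (?c * B)"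
      using sum_bounded_above[of "{\<alpha>. msize \<alpha> \<le> N}" "\<lambda>\<alpha>. SUP x. norm (mderiv \<alpha> \<phi> x)" B] S
      by (intro mult_left_mono) auto
    finally show "norm (T \<phi>) \<le> \<bar>C\<bar> * ?c * B" by (simp add: mult_ac)
  qed simp
qed

lemma distributionI:
  fixes T :: "'d::finite functional"
  assumes add: "\<And>\<phi> \<psi>. \<phi> \<in> test_functions \<Omega> \<Longrightarrow> \<psi> \<in> test_functions \<Omega> \<Longrightarrow> T (\<lambda>x. \<phi> x + \<psi> x) = T \<phi> + T \<psi>"
    and cmult: "\<And>\<phi> c. \<phi> \<in> test_functions \<Omega> \<Longrightarrow> T (\<lambda>x. c * \<phi> x) = c * T \<phi>"
    and off: "\<And>\<phi>. \<phi> \<notin> test_functions \<Omega> \<Longrightarrow> T \<phi> = 0"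
    and bound: "\<And>K. compact K \<Longrightarrow> K \<subseteq> \<Omega> \<Longrightarrow> \<exists>C N. \<forall>\<phi>\<in>test_functions \<Omega>. supp \<phi> \<subseteq> K \<longrightarrow>
      (\<forall>B. (\<forall>is x. length is \<le> N \<longrightarrow> norm (partial_derivs is \<phi> x) \<le> B) \<longrightarrow> norm (T \<phi>) \<le> C * B)"
  shows "T \<in> distributions \<Omega>"
  unfolding distributions_def
proof (intro CollectI conjI allI impI ballI)
  fix K assume K: "compact K \<and> K \<subseteq> \<Omega>"
  obtain C N where CN: "\<forall>\<phi>\<in>test_functions \<Omega>. supp \<phi> \<subseteq> K \<longrightarrow>
      (\<forall>B. (\<forall>is x. length is \<le> N \<longrightarrow> norm (partial_derivs is \<phi> x) \<le> B) \<longrightarrow> norm (T \<phi>) \<le> C * B)"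
    using bound[OF conjunct1[OF K] conjunct2[OF K]] by (elim exE)
  note CN = CN[rule_format]
  have "norm (T \<phi>) \<le> C * (\<Sum>\<alpha> | msize \<alpha> \<le> N. SUP x. norm (mderiv \<alpha> \<phi> x))"
    if \<phi>: "\<phi> \<in> test_functions \<Omega>" "supp \<phi> \<subseteq> K" for \<phi>
  proof (rule CN[OF \<phi>])
    fix "is" :: "'d list" and x assume l: "length is \<le> N"
    have bdd: "bdd_above (range (\<lambda>x. norm (mderiv \<alpha> \<phi> x)))" for \<alpha>
    proof -
      obtain B where B: "\<And>is x. length is \<le> 0 \<Longrightarrow> norm (partial_derivs is (mderiv \<alpha> \<phi>) x) \<le> B"
        using test_bounded[OF test_mderiv[OF \<phi>(1)], where N = 0] by metis
      show ?thesis by (rule bdd_aboveI2[of _ _ B]) (use B[of "[]"] in simp)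
    qed
    have nn: "0 \<le> (SUP x. norm (mderiv \<alpha> \<phi> x))" for \<alpha>
      by (rule order_trans[OF norm_ge_zero cSUP_upper[OF UNIV_I bdd]])
    have "partial_derivs is \<phi> x = mderiv (count_list is) \<phi> x"
      by (rule partial_derivs_eq_mderiv[OF open_UNIV test_smooth[OF \<phi>(1)] UNIV_I])
    also have "norm \<dots> \<le> (SUP x. norm (mderiv (count_list is) \<phi> x))" by (rule cSUP_upper[OF UNIV_I bdd])
    also have "\<dots> \<le> (\<Sum>\<alpha> | msize \<alpha> \<le> N. SUP x. norm (mderiv \<alpha> \<phi> x))"
      by (rule member_le_sum) (use l nn finite_msize_le in \<open>auto simp: length_eq_msize\<close>)
    finally show "norm (partial_derivs is \<phi> x) \<le> (\<Sum>\<alpha> | msize \<alpha> \<le> N. SUP x. norm (mderiv \<alpha> \<phi> x))" .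
  qed
  then show "\<exists>C N. \<forall>\<phi>\<in>test_functions \<Omega>. supp \<phi> \<subseteq> K \<longrightarrow>
           norm (T \<phi>) \<le> C * (\<Sum>\<alpha> | msize \<alpha> \<le> N. SUP x. norm (mderiv \<alpha> \<phi> x))"
    by blast
qed (simp_all add: add cmult off)

section \<open>Integration of continuous functions\<close>

lemma integrable_continuous_compact:
  fixes f :: "'a::euclidean_space \<Rightarrow> 'b::{banach, second_countable_topology}"
  assumes "continuous_on UNIV f" "compact K" "\<And>x. x \<notin> K \<Longrightarrow> f x = 0"
  shows "integrable lebesgue f"
proof -
  have "integrable lborel (\<lambda>x. indicator K x *\<^sub>R f x)"
    by (rule borel_integrable_compact[OF assms(2)]) (use assms(1) continuous_on_subset in blast)
  moreover have "(\<lambda>x. indicator K x *\<^sub>R f x) = f" using assms(3) by (auto simp: indicator_def)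
  ultimately have "integrable lborel f" by simp
  then show ?thesis using borel_measurable_continuous_onI[OF assms(1)] by (simp add: integrable_completion)
qed

lemma test_continuous: "\<phi> \<in> test_functions \<Omega> \<Longrightarrow> continuous_on S \<phi>"
  using smooth_continuous_on[OF test_smooth] continuous_on_subset by blast

lemma integrable_test_mult:
  assumes "\<phi> \<in> test_functions \<Omega>" "continuous_on UNIV g"
  shows "integrable lebesgue (\<lambda>x. \<phi> x * g x)"
  by (rule integrable_continuous_compact[OF _ test_compact_supp[OF assms(1)]])
     (auto simp: zero_outside_supp intro!: continuous_intros assms(2) test_continuous[OF assms(1)])

lemma integrable_norm_test: "\<phi> \<in> test_functions \<Omega> \<Longrightarrow> integrable lebesgue (\<lambda>x. norm (\<phi> x))"
  using integrable_norm[OF integrable_test_mult[of \<phi> \<Omega> "\<lambda>x. 1"]] by simp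

lemma lebesgue_integral_translate:
  fixes f :: "'a::euclidean_space \<Rightarrow> 'b::{banach, second_countable_topology}"
  assumes "continuous_on UNIV f"
  shows "(LINT x|lebesgue. f (a + x)) = (LINT x|lebesgue. f x)"
proof -
  have m: "f \<in> borel_measurable borel" using assms by (rule borel_measurable_continuous_onI)
  have "(LINT x|lebesgue. f x) = integral\<^sup>L (distr lborel borel ((+) a)) f"
    using m by (simp add: integral_completion lborel_distr_plus)
  also have "\<dots> = (LINT x|lborel. f (a + x))" using m by (intro integral_distr) auto
  also have "\<dots> = (LINT x|lebesgue. f (a + x))"
    by (intro integral_completion[symmetric])
      (simp, intro borel_measurable_continuous_onI continuous_on_compose2[OF assms] continuous_intros, simp)
  finally show ?thesis by simp
qed

text \<open>A quadrature rule serving all functions with small oscillation at scale \<open>\<delta>\<close> at once: the nodes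
  are the centres of finitely many balls of radius \<open>\<delta>\<close> that cover \<open>K\<close>, the weights are the measures
  of the pieces of \<open>K\<close> that the balls cut off one after another.\<close>

lemma uniform_quadrature:
  fixes K :: "'a::euclidean_space set"
  assumes K: "compact K" and \<delta>: "\<delta> > 0"
  shows "\<exists>A w. finite A \<and> A \<subseteq> K \<and> (\<forall>(h :: 'a \<Rightarrow> complex) \<eta>. continuous_on UNIV h \<longrightarrow>
      (\<forall>x\<in>K. \<forall>x'\<in>K. dist x x' < \<delta> \<longrightarrow> norm (h x - h x') \<le> \<eta>) \<longrightarrow>
      norm ((LINT x:K|lebesgue. h x) - (\<Sum>a\<in>A. of_real (w a) * h a)) \<le> \<eta> * measure lebesgue K)"
proof -
  obtain A where A: "finite A" "A \<subseteq> K" "K \<subseteq> (\<Union>a\<in>A. ball a \<delta>)"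
    using compactE_image[OF K, of K "\<lambda>a. ball a \<delta>"] \<delta> by (metis UN_I centre_in_ball open_ball subsetI)
  have int: "set_integrable lebesgue K h" if "continuous_on UNIV h" for h :: "'a \<Rightarrow> complex"
  proof -
    have c: "continuous_on K h" using that continuous_on_subset by blast
    have "(\<lambda>x. indicator K x *\<^sub>R h x) \<in> borel_measurable lborel"
      using borel_measurable_integrable[OF borel_integrable_compact[OF K c]] .
    then show ?thesis
      unfolding set_integrable_def using borel_integrable_compact[OF K c] by (simp add: integrable_completion)
  qed
  have "\<exists>w. \<forall>(h :: 'a \<Rightarrow> complex) \<eta>. continuous_on UNIV h \<longrightarrow> (\<forall>x\<in>K. \<forall>x'\<in>K. dist x x' < \<delta> \<longrightarrow> norm (h x - h x') \<le> \<eta>) \<longrightarrow>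
      norm ((LINT x:L|lebesgue. h x) - (\<Sum>a\<in>A. of_real (w a) * h a)) \<le> \<eta> * measure lebesgue L"
    if "L \<in> sets lebesgue" "L \<subseteq> K" "L \<subseteq> (\<Union>a\<in>A. ball a \<delta>)" for L
    using A(1,2) that
  proof (induction A arbitrary: L)
    case empty
    then show ?case by (auto simp: set_lebesgue_integral_def)
  next
    case (insert a A)
    let ?L1 = "L \<inter> ball a \<delta>" and ?L2 = "L - ball a \<delta>"
    have L1: "?L1 \<in> sets lebesgue" and L2: "?L2 \<in> sets lebesgue" using insert.prems by auto
    have "L \<inter> ball a \<delta> \<subseteq> K" "L - ball a \<delta> \<subseteq> K" using insert.prems by auto
    then have fin: "L \<in> lmeasurable" "?L1 \<in> lmeasurable" "?L2 \<in> lmeasurable"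
      by (blast intro: fmeasurableI2[OF lmeasurable_compact[OF K]] L1 L2 insert.prems)+
    have LU: "L = ?L1 \<union> ?L2" "?L1 \<inter> ?L2 = {}" by auto
    have "\<exists>w. \<forall>(h :: 'a \<Rightarrow> complex) \<eta>. continuous_on UNIV h \<longrightarrow> (\<forall>x\<in>K. \<forall>x'\<in>K. dist x x' < \<delta> \<longrightarrow> norm (h x - h x') \<le> \<eta>) \<longrightarrow>
      norm ((LINT x:?L2|lebesgue. h x) - (\<Sum>a\<in>A. of_real (w a) * h a)) \<le> \<eta> * measure lebesgue ?L2"
      by (rule insert.IH) (use insert.prems L2 in auto)
    then obtain w where w: "\<And>(h :: 'a \<Rightarrow> complex) \<eta>. continuous_on UNIV h \<Longrightarrow> (\<forall>x\<in>K. \<forall>x'\<in>K. dist x x' < \<delta> \<longrightarrow> norm (h x - h x') \<le> \<eta>) \<Longrightarrow>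
      norm ((LINT x:?L2|lebesgue. h x) - (\<Sum>a\<in>A. of_real (w a) * h a)) \<le> \<eta> * measure lebesgue ?L2"
      by blast
    show ?case
    proof (intro exI[of _ "w(a := measure lebesgue ?L1)"] allI impI)
      fix h :: "'a \<Rightarrow> complex" and \<eta>
      assume h: "continuous_on UNIV h" and osc: "\<forall>x\<in>K. \<forall>x'\<in>K. dist x x' < \<delta> \<longrightarrow> norm (h x - h x') \<le> \<eta>"
      have iL: "set_integrable lebesgue ?L1 h" "set_integrable lebesgue ?L2 h"
        using set_integrable_subset[OF int[OF h]] L1 L2 insert.prems by auto
      have c: "set_integrable lebesgue ?L1 (\<lambda>x. h a)"
        unfolding set_integrable_def using fin(2) by (auto intro!: integrable_scaleR_left simp: fmeasurable_def)
      have split: "(LINT x:L|lebesgue. h x) = (LINT x:?L1|lebesgue. h x) + (LINT x:?L2|lebesgue. h x)"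
        using set_integral_Un[OF LU(2) iL] LU(1) by simp
      have Kc: "(LINT x:?L1|lebesgue. h a) = of_real (measure lebesgue ?L1) * h a"
        using fin(2) by (simp add: set_lebesgue_integral_def fmeasurable_def scaleR_conv_of_real)
      have "norm ((LINT x:?L1|lebesgue. h x) - (LINT x:?L1|lebesgue. h a))
          = norm (LINT x:?L1|lebesgue. h x - h a)"
        using set_integral_diff(2)[OF iL(1) c] by simp
      also have "\<dots> \<le> (LINT x:?L1|lebesgue. norm (h x - h a))"
        by (rule set_integral_norm_bound[OF set_integral_diff(1)[OF iL(1) c]])
      also have "\<dots> \<le> (LINT x:?L1|lebesgue. \<eta>)"
      proof (rule set_integral_mono)
        show "set_integrable lebesgue ?L1 (\<lambda>x. norm (h x - h a))"
          by (rule set_integrable_norm[OF set_integral_diff(1)[OF iL(1) c]])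
        show "set_integrable lebesgue ?L1 (\<lambda>x. \<eta>)"
          unfolding set_integrable_def using fin(2) by (auto intro!: integrable_scaleR_left simp: fmeasurable_def)
        fix x assume "x \<in> ?L1"
        then show "norm (h x - h a) \<le> \<eta>" using osc insert.prems by (auto simp: dist_commute)
      qed
      also have "\<dots> = \<eta> * measure lebesgue ?L1"
        using fin(2) by (simp add: set_lebesgue_integral_def fmeasurable_def)
      finally have e1: "norm ((LINT x:?L1|lebesgue. h x) - of_real (measure lebesgue ?L1) * h a) \<le> \<eta> * measure lebesgue ?L1"
        unfolding Kc .
      have e2: "norm ((LINT x:?L2|lebesgue. h x) - (\<Sum>a\<in>A. of_real (w a) * h a)) \<le> \<eta> * measure lebesgue ?L2"
        by (rule w[OF h osc])
      have "(\<Sum>b\<in>insert a A. of_real ((w(a := measure lebesgue ?L1)) b) * h b)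
          = of_real (measure lebesgue ?L1) * h a + (\<Sum>b\<in>A. of_real (w b) * h b)"
        using insert.hyps by (auto intro!: sum.cong)
      then have eq: "(LINT x:L|lebesgue. h x) - (\<Sum>b\<in>insert a A. of_real ((w(a := measure lebesgue ?L1)) b) * h b)
         = ((LINT x:?L1|lebesgue. h x) - of_real (measure lebesgue ?L1) * h a)
           + ((LINT x:?L2|lebesgue. h x) - (\<Sum>a\<in>A. of_real (w a) * h a))"
        unfolding split by simp
      have "measure lebesgue L = measure lebesgue ?L1 + measure lebesgue ?L2"
        using measure_Un3[OF fin(2,3)] LU by simp
      then show "norm ((LINT x:L|lebesgue. h x) - (\<Sum>b\<in>insert a A. of_real ((w(a := measure lebesgue ?L1)) b) * h b))
          \<le> \<eta> * measure lebesgue L"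
        unfolding eq using norm_triangle_mono[OF e1 e2] by (simp only: distrib_left)
    qed
  qed
  from this[OF fmeasurableD[OF lmeasurable_compact[OF K]] subset_refl A(3)] A(1,2)
  show ?thesis by blast
qed

section \<open>Functionals of finite order and their translates\<close>

text \<open>Continuity with respect to one seminorm on all test functions.  Multiplication by a test function
  gives a distribution this property, and integration against a test function has it with order
  \<open>0\<close>; the convolutions \<open>(T p) \<star> D\<close> and \<open>D \<star> F\<close> can therefore be treated alike.\<close>

definition finite_order_functional :: "'d::finite functional \<Rightarrow> bool" where
  "finite_order_functional \<Lambda> \<longleftrightarrow>
     (\<forall>\<phi>\<in>test_functions UNIV. \<forall>\<psi>\<in>test_functions UNIV. \<Lambda> (\<lambda>x. \<phi> x + \<psi> x) = \<Lambda> \<phi> + \<Lambda> \<psi>) \<and>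
     (\<forall>\<phi>\<in>test_functions UNIV. \<forall>c. \<Lambda> (\<lambda>x. c * \<phi> x) = c * \<Lambda> \<phi>) \<and>
     (\<exists>C\<ge>0. \<exists>N. \<forall>\<phi>\<in>test_functions UNIV. \<forall>B.
        (\<forall>is x. length is \<le> N \<longrightarrow> norm (partial_derivs is \<phi> x) \<le> B) \<longrightarrow> norm (\<Lambda> \<phi>) \<le> C * B)"

lemma finite_order_add:
  "finite_order_functional \<Lambda> \<Longrightarrow> \<phi> \<in> test_functions UNIV \<Longrightarrow> \<psi> \<in> test_functions UNIV \<Longrightarrow>
    \<Lambda> (\<lambda>x. \<phi> x + \<psi> x) = \<Lambda> \<phi> + \<Lambda> \<psi>"
  by (simp add: finite_order_functional_def)

lemma finite_order_cmult:
  "finite_order_functional \<Lambda> \<Longrightarrow> \<phi> \<in> test_functions UNIV \<Longrightarrow> \<Lambda> (\<lambda>x. c * \<phi> x) = c * \<Lambda> \<phi>"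
  by (simp add: finite_order_functional_def)

lemma finite_order_bound:
  assumes "finite_order_functional \<Lambda>"
  obtains C N where "C \<ge> 0"
    "\<And>\<phi> B. \<phi> \<in> test_functions UNIV \<Longrightarrow>
      (\<And>is x. length is \<le> N \<Longrightarrow> norm (partial_derivs is \<phi> x) \<le> B) \<Longrightarrow> norm (\<Lambda> \<phi>) \<le> C * B"
proof -
  have "\<exists>C\<ge>0. \<exists>N. \<forall>\<phi>\<in>test_functions UNIV. \<forall>B.
        (\<forall>is x. length is \<le> N \<longrightarrow> norm (partial_derivs is \<phi> x) \<le> B) \<longrightarrow> norm (\<Lambda> \<phi>) \<le> C * B"
    using assms unfolding finite_order_functional_def by (elim conjE)
  then obtain C N where 1: "C \<ge> 0" and 2: "\<forall>\<phi>\<in>test_functions UNIV. \<forall>B.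
        (\<forall>is x. length is \<le> N \<longrightarrow> norm (partial_derivs is \<phi> x) \<le> B) \<longrightarrow> norm (\<Lambda> \<phi>) \<le> C * B"
    by (elim exE conjE)
  show ?thesis by (rule that[OF 1, of N]) (rule 2[rule_format])
qed

lemma finite_order_diff:
  assumes "finite_order_functional \<Lambda>" "\<phi> \<in> test_functions UNIV" "\<psi> \<in> test_functions UNIV"
  shows "\<Lambda> (\<lambda>x. \<phi> x - \<psi> x) = \<Lambda> \<phi> - \<Lambda> \<psi>"
proof -
  have "(\<lambda>x. \<phi> x - \<psi> x) = (\<lambda>x. \<phi> x + -1 * \<psi> x)" by auto
  then show ?thesis
    by (simp only: finite_order_add[OF assms(1,2) test_cmult[OF assms(3)]] finite_order_cmult[OF assms(1,3)])
       simp
qed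

lemma finite_order_sum:
  assumes L: "finite_order_functional \<Lambda>" and f: "\<And>a. a \<in> I \<Longrightarrow> f a \<in> test_functions UNIV"
  shows "\<Lambda> (\<lambda>x. \<Sum>a\<in>I. c a * f a x) = (\<Sum>a\<in>I. c a * \<Lambda> (f a))"
proof -
  have zero: "\<Lambda> (\<lambda>x. 0) = 0" using finite_order_cmult[OF L test_zero, of 0] by simp
  show ?thesis using f
  proof (induction I rule: infinite_finite_induct)
    case (insert a I)
    have "\<Lambda> (\<lambda>x. c a * f a x + (\<Sum>a\<in>I. c a * f a x)) = c a * \<Lambda> (f a) + \<Lambda> (\<lambda>x. \<Sum>a\<in>I. c a * f a x)"
      using insert.prems
      by (subst finite_order_add[OF L]) (auto simp: finite_order_cmult[OF L] intro!: test_sum test_cmult)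
    then show ?case using insert by simp
  qed (simp_all add: zero)
qed

lemma has_derivative_quadratic:
  fixes f :: "'a::real_normed_vector \<Rightarrow> 'b::real_normed_vector"
  assumes F: "bounded_linear F" and b: "\<And>h. norm (f (x + h) - f x - F h) \<le> K * (norm h)\<^sup>2"
  shows "(f has_derivative F) (at x)"
proof (rule has_derivativeI_sandwich[OF zero_less_one F])
  fix y assume "y \<noteq> x"
  then have "norm (y - x) > 0" by simp
  moreover have "norm (f y - f x - F (y - x)) \<le> K * (norm (y - x))\<^sup>2" using b[of "y - x"] by simp
  ultimately show "norm (f y - f x - F (y - x)) / norm (y - x) \<le> K * norm (y - x)"
    by (simp add: divide_le_eq power2_eq_square mult_ac)
next
  have "((\<lambda>y. K * norm (y - x)) \<longlongrightarrow> K * norm (x - x)) (at x)" by (intro tendsto_intros)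
  then show "((\<lambda>y. K * norm (y - x)) \<longlongrightarrow> 0) (at x)" by simp
qed

text \<open>The second order Taylor remainder of \<open>g\<close> and of its derivatives is \<open>O(h\<^sup>2)\<close> uniformly in the base
  point, and the functional preserves uniform bounds.\<close>

lemma translates_has_derivative:
  fixes \<Lambda> :: "'d::finite functional"
  assumes L: "finite_order_functional \<Lambda>" and g: "g \<in> test_functions UNIV"
  shows "((\<lambda>x. \<Lambda> (\<lambda>y. g (x + y))) has_derivative
    (\<lambda>h. \<Sum>i\<in>UNIV. h $ i *\<^sub>R \<Lambda> (\<lambda>y. partial_deriv i g (x + y)))) (at x)"
proof -
  obtain C N where C: "C \<ge> 0" and CN: "\<And>\<phi> B. \<phi> \<in> test_functions UNIV \<Longrightarrow>
      (\<And>is x. length is \<le> N \<Longrightarrow> norm (partial_derivs is \<phi> x) \<le> B) \<Longrightarrow> norm (\<Lambda> \<phi>) \<le> C * B"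
    using finite_order_bound[OF L] by metis
  obtain B where B: "\<And>is x. length is \<le> N + 2 \<Longrightarrow> norm (partial_derivs is g x) \<le> B"
    using test_bounded[OF g, where N = "N + 2"] by metis
  define c where "c = real CARD('d)"
  note gs = test_smooth[OF g]
  have dg: "partial_deriv i g \<in> test_functions UNIV" for i
    using test_partial_derivs[OF g, of "[i]"] by simp
  show ?thesis
  proof (rule has_derivative_quadratic)
    show "bounded_linear (\<lambda>h. \<Sum>i\<in>UNIV. h $ i *\<^sub>R \<Lambda> (\<lambda>y. partial_deriv i g (x + y)))"
      by (intro bounded_linear_sum bounded_linear_scaleR_const bounded_linear_vec_nth)
    fix h :: "real^'d"
    define P where "P y = g (x + y) + (\<Sum>i\<in>UNIV. complex_of_real (h $ i) * partial_deriv i g (x + y))" for y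
    define Q where "Q y = (\<Sum>i\<in>UNIV. complex_of_real (h $ i) * partial_deriv i g (x + y))" for y
    have Pt: "P \<in> test_functions UNIV" and Qt: "Q \<in> test_functions UNIV"
      unfolding P_def[abs_def] Q_def[abs_def]
      by (intro test_add test_sum test_cmult test_translate g dg)+
    have dQ: "partial_derivs is Q y = (\<Sum>i\<in>UNIV. complex_of_real (h $ i) * partial_derivs is (partial_deriv i g) (x + y))" for "is" y
      unfolding Q_def[abs_def]
      using test_smooth[OF test_translate[OF dg]] smooth_cmult[OF open_UNIV test_smooth[OF test_translate[OF dg]]]
      by (subst partial_derivs_sum[OF open_UNIV])
         (simp_all add: partial_derivs_cmult[OF open_UNIV] partial_derivs_translate[OF dg])
    have dP: "partial_derivs is P y = taylor_poly 2 (partial_derivs is g) (x + y) h" for "is" y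
    proof -
      have sw: "partial_derivs is (partial_deriv i g) w = partial_deriv i (partial_derivs is g) w" for i w
        using partial_derivs_permute[OF open_UNIV gs, of w "is @ [i]" "i # is"] by (simp add: partial_derivs_append)
      have "P = (\<lambda>y. g (x + y) + Q y)" by (simp add: P_def Q_def fun_eq_iff)
      then have "partial_derivs is P y = partial_derivs is g (x + y) + partial_derivs is Q y"
        using partial_derivs_add[OF open_UNIV test_smooth[OF test_translate[OF g]] test_smooth[OF Qt], of y "is"]
        by (simp add: partial_derivs_translate[OF g])
      then show ?thesis by (simp add: dQ taylor_poly_2 sw scaleR_conv_of_real)
    qed
    have LP: "\<Lambda> P = \<Lambda> (\<lambda>y. g (x + y)) + (\<Sum>i\<in>UNIV. h $ i *\<^sub>R \<Lambda> (\<lambda>y. partial_deriv i g (x + y)))"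
      unfolding P_def[abs_def]
      by (subst finite_order_add[OF L test_translate[OF g]])
         (auto simp: finite_order_sum[OF L test_translate[OF dg]] scaleR_conv_of_real
           intro!: test_sum test_cmult test_translate dg)
    have "norm (\<Lambda> (\<lambda>y. g (x + h + y) - P y)) \<le> C * ((c * norm h) ^ 2 * B)"
    proof (rule CN)
      show "(\<lambda>y. g (x + h + y) - P y) \<in> test_functions UNIV" by (intro test_diff test_translate g Pt)
      fix "is" :: "'d list" and y assume l: "length is \<le> N"
      have "partial_derivs is (\<lambda>y. g (x + h + y) - P y) y
          = partial_derivs is (\<lambda>y. g (x + h + y)) y - partial_derivs is P y"
        by (rule partial_derivs_diff[OF open_UNIV test_smooth[OF test_translate[OF g]] test_smooth[OF Pt] UNIV_I])
      also have "\<dots> = partial_derivs is g ((x + y) + h) - taylor_poly 2 (partial_derivs is g) (x + y) h"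
        unfolding partial_derivs_translate[OF g] dP by (simp add: add_ac)
      also have "norm \<dots> \<le> (c * norm h) ^ 2 * B"
        unfolding c_def
        by (rule smooth_taylor_bound[OF smooth_partial_derivs[OF gs]])
           (use l in \<open>simp_all add: partial_derivs_append[symmetric] B\<close>)
      finally show "norm (partial_derivs is (\<lambda>y. g (x + h + y) - P y) y) \<le> (c * norm h) ^ 2 * B" .
    qed
    then show "norm (\<Lambda> (\<lambda>y. g (x + h + y)) - \<Lambda> (\<lambda>y. g (x + y))
        - (\<Sum>i\<in>UNIV. h $ i *\<^sub>R \<Lambda> (\<lambda>y. partial_deriv i g (x + y)))) \<le> (C * c\<^sup>2 * B) * (norm h)\<^sup>2"
      unfolding finite_order_diff[OF L test_translate[OF g] Pt] LP
      by (simp add: diff_diff_eq power_mult_distrib mult_ac)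
  qed
qed

lemma
  fixes \<Lambda> :: "'d::finite functional"
  assumes L: "finite_order_functional \<Lambda>" and g: "g \<in> test_functions UNIV"
  shows smooth_translates: "(\<lambda>x. \<Lambda> (\<lambda>y. g (x + y))) \<in> smooth_functions UNIV"
    and partial_derivs_translates:
      "partial_derivs is (\<lambda>x. \<Lambda> (\<lambda>y. g (x + y))) x = \<Lambda> (\<lambda>y. partial_derivs is g (x + y))"
proof -
  let ?G = "\<lambda>is x. \<Lambda> (\<lambda>y. partial_derivs is g (x + y))"
  note d = translates_has_derivative[OF L test_partial_derivs[OF g]]
  have D: "?G is differentiable (at x)" for "is" x using d by (rule differentiableI)
  have E: "partial_deriv i (?G is) x = ?G (i # is) x" for i "is" x
    by (subst partial_deriv_eqI[OF d]) (simp add: sum_axis_scaleR)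
  have B: "\<Lambda> (\<lambda>y. g (x + y)) = ?G [] x" for x by simp
  show "(\<lambda>x. \<Lambda> (\<lambda>y. g (x + y))) \<in> smooth_functions UNIV"
    by (rule smooth_derivative_family(1)[OF open_UNIV, where G = ?G]) (rule D E B)+
  show "partial_derivs is (\<lambda>x. \<Lambda> (\<lambda>y. g (x + y))) x = ?G is x"
    by (rule smooth_derivative_family(2)[OF open_UNIV, where G = ?G]) (rule D E B UNIV_I)+
qed

lemma finite_order_integral:
  fixes D :: "'d::finite cfun"
  assumes D: "D \<in> test_functions UNIV"
  shows "finite_order_functional (\<lambda>F. LINT z|lebesgue. D z * F z)"
proof -
  have int: "integrable lebesgue (\<lambda>z. D z * F z)" if "F \<in> test_functions UNIV" for F
    by (rule integrable_test_mult[OF D test_continuous[OF that]])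
  have "norm (LINT z|lebesgue. D z * F z) \<le> (LINT z|lebesgue. norm (D z)) * B"
    if F: "F \<in> test_functions UNIV" and B: "\<And>is x. length is \<le> 0 \<Longrightarrow> norm (partial_derivs is F x) \<le> B" for F B
  proof -
    have "norm (LINT z|lebesgue. D z * F z) \<le> (LINT z|lebesgue. norm (D z) * B)"
    proof (rule Bochner_Integration.integral_norm_bound_integral[OF int[OF F]])
      show "integrable lebesgue (\<lambda>z. norm (D z) * B)"
        by (intro integrable_mult_left integrable_norm_test[OF D])
      show "norm (D z * F z) \<le> norm (D z) * B" for z
        unfolding norm_mult using B[of "[]" z] by (intro mult_left_mono) auto
    qed
    then show ?thesis by simp
  qed
  then show ?thesis
    unfolding finite_order_functional_def
    by (intro conjI ballI allI exI[of _ "LINT z|lebesgue. norm (D z)"] exI[of _ 0] impI)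
       (simp_all add: distrib_left Bochner_Integration.integral_add int mult.left_commute)
qed

text \<open>With the reflection, the value of \<open>(T p) \<star> g\<close> at \<open>x\<close> is the functional applied to the translate
  \<open>\<lambda>y. g (x + y)\<close>.\<close>

lemma finite_order_product:
  fixes T :: "'d::finite functional"
  assumes \<Omega>: "open \<Omega>" and T: "T \<in> distributions \<Omega>" and p: "p \<in> test_functions \<Omega>"
  shows "finite_order_functional (\<lambda>g. T (\<lambda>y. p y * g (- y)))"
proof -
  have reflected: "(\<lambda>y. g (- y)) \<in> test_functions UNIV" if "g \<in> test_functions UNIV" for g :: "'d cfun"
    using test_reflect[OF that, of 0] by simp
  have mult: "(\<lambda>y. p y * g (- y)) \<in> test_functions \<Omega>" if "g \<in> test_functions UNIV" for g
    by (rule test_mult_smooth[OF \<Omega> p smooth_subset[OF test_smooth[OF reflected[OF that]]]]) simp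
  obtain C N where C: "C \<ge> 0" and CN: "\<And>\<phi> B. \<phi> \<in> test_functions \<Omega> \<Longrightarrow> supp \<phi> \<subseteq> supp p \<Longrightarrow>
      (\<And>is x. length is \<le> N \<Longrightarrow> norm (partial_derivs is \<phi> x) \<le> B) \<Longrightarrow> norm (T \<phi>) \<le> C * B"
    using distribution_bound[OF T test_compact_supp[OF p] test_supp_subset[OF p]] by metis
  obtain A where A: "A \<ge> 0" "\<And>is x. length is \<le> N \<Longrightarrow> norm (partial_derivs is p x) \<le> A"
    using test_bounded[OF p, where N = N] by metis
  have "norm (T (\<lambda>y. p y * g (- y))) \<le> (C * 2 ^ N * A) * B"
    if g: "g \<in> test_functions UNIV" and B: "\<And>is x. length is \<le> N \<Longrightarrow> norm (partial_derivs is g x) \<le> B" for g B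
  proof -
    have B0: "B \<ge> 0" by (rule order_trans[OF norm_ge_zero B[of "[]" 0]]) simp
    have "norm (T (\<lambda>y. p y * g (- y))) \<le> C * (2 ^ N * (A * B))"
    proof (rule CN[OF mult[OF g]])
      show "supp (\<lambda>y. p y * g (- y)) \<subseteq> supp p"
        by (rule supp_subsetI[OF closed_supp]) (simp add: zero_outside_supp)
      fix "is" :: "'d list" and x assume l: "length is \<le> N"
      have "norm (partial_derivs is (\<lambda>y. p y * g (- y)) x) \<le> 2 ^ length is * (A * B)"
      proof (rule norm_partial_derivs_mult_le[OF open_UNIV test_smooth[OF p] test_smooth[OF reflected[OF g]] UNIV_I])
        fix js :: "'d list" assume "length js \<le> length is"
        then show "norm (partial_derivs js p x) \<le> A" "norm (partial_derivs js (\<lambda>y. g (- y)) x) \<le> B"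
          using l A(2) B partial_derivs_reflect[OF g, of js 0] by (simp_all add: norm_mult norm_power)
      qed
      also have "\<dots> \<le> 2 ^ N * (A * B)"
        using l A(1) B0 by (intro mult_right_mono power_increasing) auto
      finally show "norm (partial_derivs is (\<lambda>y. p y * g (- y)) x) \<le> 2 ^ N * (A * B)" .
    qed
    then show ?thesis by (simp add: mult_ac)
  qed
  moreover have "C * 2 ^ N * A \<ge> 0" using C A(1) by simp
  ultimately have "\<exists>C\<ge>0. \<exists>N. \<forall>g\<in>test_functions UNIV. \<forall>B. (\<forall>is x. length is \<le> N \<longrightarrow> norm (partial_derivs is g x) \<le> B) \<longrightarrow>
      norm (T (\<lambda>y. p y * g (- y))) \<le> C * B"
    by (intro exI[of _ "C * 2 ^ N * A"] conjI exI[of _ N]) auto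
  then show ?thesis
    unfolding finite_order_functional_def
    using distribution_add[OF T mult mult] distribution_cmult[OF T mult]
    by (auto simp: distrib_left mult.left_commute)
qed

lemma dist_convolution_product:
  "dist_convolution (schwartz_product T p) g x = T (\<lambda>y. p y * g (x - y))"
  by (simp add: dist_convolution_def schwartz_product_def)

lemma
  assumes \<Omega>: "open \<Omega>" and T: "T \<in> distributions \<Omega>" and p: "p \<in> test_functions \<Omega>"
    and g: "g \<in> test_functions UNIV"
  shows smooth_convolution: "dist_convolution (schwartz_product T p) g \<in> smooth_functions UNIV"
    and partial_derivs_convolution: "partial_derivs is (dist_convolution (schwartz_product T p) g) x
      = T (\<lambda>y. p y * partial_derivs is g (x - y))"
  using smooth_translates[OF finite_order_product[OF \<Omega> T p] g]
    partial_derivs_translates[OF finite_order_product[OF \<Omega> T p] g, of "is" x]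
  unfolding dist_convolution_product[abs_def] by simp_all

section \<open>Exchanging a functional with an integral\<close>

lemma le_zero_if_le_all_multiples:
  fixes a M :: real
  assumes "\<And>\<delta>. \<delta> > 0 \<Longrightarrow> a \<le> M * \<delta>"
  shows "a \<le> 0"
proof (rule ccontr)
  assume "\<not> a \<le> 0"
  then have a: "a > 0" by simp
  then have M: "M > 0" using assms[of 1] by simp
  then show False using assms[of "a / (2 * M)"] a by simp
qed

text \<open>A quadrature sum commutes with \<open>\<Lambda>\<close>.  Test functions are Lipschitz, so at scale \<open>\<delta>\<close> one and the
  same quadrature rule approximates both integrals, and the derivatives up to order \<open>N\<close> of the
  right-hand argument uniformly in \<open>y\<close>, with error \<open>O(\<delta>)\<close>.\<close>

lemma functional_integral_exchange:
  fixes \<Lambda> :: "'d::finite functional"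
  assumes L: "finite_order_functional \<Lambda>" and \<phi>: "\<phi> \<in> test_functions UNIV" and g: "g \<in> test_functions UNIV"
  shows "(LINT x|lebesgue. \<phi> x * \<Lambda> (\<lambda>y. g (x + y))) = \<Lambda> (\<lambda>y. LINT x|lebesgue. \<phi> x * g (x + y))"
proof -
  define K where "K = supp \<phi>"
  have K: "compact K" using test_compact_supp[OF \<phi>] by (simp add: K_def)
  define u where "u x = \<Lambda> (\<lambda>y. g (x + y))" for x
  define G where "G y = (LINT x|lebesgue. \<phi> x * g (y + x))" for y
  obtain C N where C: "C \<ge> 0" and CN: "\<And>\<phi> B. \<phi> \<in> test_functions UNIV \<Longrightarrow>
      (\<And>is x. length is \<le> N \<Longrightarrow> norm (partial_derivs is \<phi> x) \<le> B) \<Longrightarrow> norm (\<Lambda> \<phi>) \<le> C * B"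
    using finite_order_bound[OF L] by metis
  have u: "u \<in> smooth_functions UNIV" unfolding u_def[abs_def] by (rule smooth_translates[OF L g])
  have Gs: "G \<in> smooth_functions UNIV" and dG: "partial_derivs is G y = (LINT x|lebesgue. \<phi> x * partial_derivs is g (y + x))" for "is" y
    unfolding G_def[abs_def]
    by (rule smooth_translates[OF finite_order_integral[OF \<phi>] g], rule partial_derivs_translates[OF finite_order_integral[OF \<phi>] g])
  have G: "G \<in> test_functions UNIV"
  proof (rule testI[OF Gs compact_differences[OF test_compact_supp[OF g] K] subset_UNIV])
    fix y assume y: "y \<notin> {a - b |a b. a \<in> supp g \<and> b \<in> K}"
    have "\<phi> x * g (y + x) = 0" for x
    proof (rule ccontr)
      assume "\<phi> x * g (y + x) \<noteq> 0"
      then have "y + x \<in> supp g" "x \<in> K" using zero_outside_supp by (force simp: K_def)+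
      moreover have "y = (y + x) - x" by simp
      ultimately show False using y by blast
    qed
    then show "G y = 0" by (simp only: G_def Bochner_Integration.integral_zero)
  qed
  obtain B1 where B1: "B1 \<ge> 0" "\<And>is x. length is \<le> 1 \<Longrightarrow> norm (partial_derivs is \<phi> x) \<le> B1"
    using test_bounded[OF \<phi>, where N = 1] by metis
  obtain B2 where B2: "B2 \<ge> 0" "\<And>is x. length is \<le> N + 1 \<Longrightarrow> norm (partial_derivs is g x) \<le> B2"
    using test_bounded[OF g, where N = "N + 1"] by metis
  have \<phi>u: "(\<lambda>x. \<phi> x * u x) \<in> test_functions UNIV" by (rule test_mult_smooth[OF open_UNIV \<phi> u])
  obtain B3 where B3: "B3 \<ge> 0" "\<And>is x. length is \<le> 1 \<Longrightarrow> norm (partial_derivs is (\<lambda>x. \<phi> x * u x) x) \<le> B3"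
    using test_bounded[OF \<phi>u, where N = 1] by metis
  define c where "c = real CARD('d)"
  \<comment> \<open>A common Lipschitz constant for \<open>\<lambda>x. \<phi> x * u x\<close> and, uniformly in \<open>y\<close> and in \<open>is\<close>, for
    \<open>\<lambda>x. \<phi> x * partial_derivs is g (y + x)\<close>.\<close>
  define M where "M = c * B3 + (B1 * (c * B2) + (c * B1) * B2)"
  have M0: "0 \<le> B1 * (c * B2) + (c * B1) * B2" "0 \<le> c * B3" using B1 B2 B3 by (simp_all add: c_def)
  have lip1: "norm (\<phi> x * u x - \<phi> x' * u x') \<le> M * dist x x'" for x x'
  proof -
    have "norm (\<phi> x * u x - \<phi> x' * u x') \<le> (c * B3) * dist x x'"
      unfolding c_def by (rule smooth_lipschitz[OF test_smooth[OF \<phi>u]]) (use B3(2)[of "[_]"] in simp)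
    also have "\<dots> \<le> M * dist x x'" using M0 by (intro mult_right_mono) (auto simp: M_def)
    finally show ?thesis .
  qed
  have lip2: "norm (\<phi> x * partial_derivs is g (y + x) - \<phi> x' * partial_derivs is g (y + x')) \<le> M * dist x x'"
    if l: "length is \<le> N" for "is" y x x'
  proof -
    have a: "norm (partial_derivs is g (y + x) - partial_derivs is g (y + x')) \<le> (c * B2) * dist (y + x) (y + x')"
      unfolding c_def
      by (rule smooth_lipschitz[OF smooth_partial_derivs[OF test_smooth[OF g]]]) (use B2(2)[of "_ # is"] l in simp)
    have b: "norm (\<phi> x - \<phi> x') \<le> (c * B1) * dist x x'"
      unfolding c_def by (rule smooth_lipschitz[OF test_smooth[OF \<phi>]]) (use B1(2)[of "[_]"] in simp)
    have "\<phi> x * partial_derivs is g (y + x) - \<phi> x' * partial_derivs is g (y + x')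
        = \<phi> x * (partial_derivs is g (y + x) - partial_derivs is g (y + x')) + (\<phi> x - \<phi> x') * partial_derivs is g (y + x')"
      by (simp add: algebra_simps)
    also have "norm \<dots> \<le> B1 * ((c * B2) * dist x x') + ((c * B1) * dist x x') * B2"
      using a b B1(2)[of "[]" x] B2(2)[of "is" "y + x'"] l B1(1) B2(1)
      by (intro norm_triangle_mono) (auto simp: norm_mult c_def intro!: mult_mono)
    also have "\<dots> = (B1 * (c * B2) + (c * B1) * B2) * dist x x'" by (simp add: algebra_simps)
    also have "\<dots> \<le> M * dist x x'" using M0 by (intro mult_right_mono) (auto simp: M_def)
    finally show ?thesis .
  qed
  have onK: "(LINT x:K|lebesgue. \<phi> x * h x) = (LINT x|lebesgue. \<phi> x * h x)" for h
    unfolding set_lebesgue_integral_def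
    by (intro Bochner_Integration.integral_cong) (auto simp: indicator_def K_def zero_outside_supp)
  let ?\<mu> = "measure lebesgue K"
  have "norm ((LINT x|lebesgue. \<phi> x * u x) - \<Lambda> G) \<le> ((1 + C) * M * ?\<mu>) * \<delta>" if \<delta>: "\<delta> > 0" for \<delta>
  proof -
    obtain A w where "finite A \<and> A \<subseteq> K \<and> (\<forall>(h :: real^'d \<Rightarrow> complex) \<eta>. continuous_on UNIV h \<longrightarrow>
      (\<forall>x\<in>K. \<forall>x'\<in>K. dist x x' < \<delta> \<longrightarrow> norm (h x - h x') \<le> \<eta>) \<longrightarrow>
      norm ((LINT x:K|lebesgue. h x) - (\<Sum>a\<in>A. of_real (w a) * h a)) \<le> \<eta> * ?\<mu>)"
      using uniform_quadrature[OF K \<delta>] by (elim exE)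
    note quad = this[THEN conjunct2, THEN conjunct2, rule_format]
    have Md: "M * dist x x' \<le> M * \<delta>" if "dist x x' < \<delta>" for x x' :: "real^'d"
      using that M0 by (intro mult_left_mono) (auto simp: M_def)
    have e1: "norm ((LINT x|lebesgue. \<phi> x * u x) - (\<Sum>a\<in>A. of_real (w a) * (\<phi> a * u a))) \<le> (M * \<delta>) * ?\<mu>"
      unfolding onK[symmetric]
      by (rule quad) (auto intro!: test_continuous[OF \<phi>u] order_trans[OF lip1 Md])
    define S where "S y = (\<Sum>a\<in>A. (of_real (w a) * \<phi> a) * g (a + y))" for y
    have S: "S \<in> test_functions UNIV" unfolding S_def[abs_def] by (intro test_sum test_cmult test_translate g)
    have LS: "\<Lambda> S = (\<Sum>a\<in>A. of_real (w a) * (\<phi> a * u a))"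
      unfolding S_def[abs_def] by (subst finite_order_sum[OF L test_translate[OF g]]) (simp add: u_def mult.assoc)
    have dS: "partial_derivs is S y = (\<Sum>a\<in>A. of_real (w a) * (\<phi> a * partial_derivs is g (y + a)))" for "is" y
    proof -
      have "partial_derivs is S y = (\<Sum>a\<in>A. (of_real (w a) * \<phi> a) * partial_derivs is g (a + y))"
        unfolding S_def[abs_def]
        by (subst partial_derivs_sum[OF open_UNIV])
           (simp_all add: partial_derivs_cmult[OF open_UNIV test_smooth[OF test_translate[OF g]]]
             smooth_cmult[OF open_UNIV test_smooth[OF test_translate[OF g]]] partial_derivs_translate[OF g])
      then show ?thesis by (simp add: add.commute mult.assoc)
    qed
    have "norm (\<Lambda> (\<lambda>y. G y - S y)) \<le> C * ((M * \<delta>) * ?\<mu>)"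
    proof (rule CN[OF test_diff[OF G S]])
      fix "is" :: "'d list" and y assume l: "length is \<le> N"
      have "partial_derivs is (\<lambda>y. G y - S y) y = (LINT x:K|lebesgue. \<phi> x * partial_derivs is g (y + x))
          - (\<Sum>a\<in>A. of_real (w a) * (\<phi> a * partial_derivs is g (y + a)))"
        unfolding partial_derivs_diff[OF open_UNIV test_smooth[OF G] test_smooth[OF S] UNIV_I] dG dS onK ..
      also have "norm \<dots> \<le> (M * \<delta>) * ?\<mu>"
      proof (rule quad)
        show "continuous_on UNIV (\<lambda>x. \<phi> x * partial_derivs is g (y + x))"
          using test_continuous[OF test_translate[OF test_partial_derivs[OF g]]]
          by (intro continuous_on_mult test_continuous[OF \<phi>])
      qed (rule order_trans[OF lip2[OF l] Md])
      finally show "norm (partial_derivs is (\<lambda>y. G y - S y) y) \<le> (M * \<delta>) * ?\<mu>" .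
    qed
    then have e2: "norm (\<Lambda> S - \<Lambda> G) \<le> C * ((M * \<delta>) * ?\<mu>)"
      unfolding finite_order_diff[OF L G S] by (simp add: norm_minus_commute)
    have "norm ((LINT x|lebesgue. \<phi> x * u x) - \<Lambda> G) \<le> (M * \<delta>) * ?\<mu> + C * ((M * \<delta>) * ?\<mu>)"
      using norm_triangle_mono[OF e1[folded LS] e2] by simp
    then show ?thesis by (simp add: algebra_simps)
  qed
  then have "norm ((LINT x|lebesgue. \<phi> x * u x) - \<Lambda> G) \<le> 0" by (rule le_zero_if_le_all_multiples)
  moreover have "G = (\<lambda>y. LINT x|lebesgue. \<phi> x * g (x + y))" by (simp add: G_def fun_eq_iff add.commute)
  ultimately show ?thesis by (simp add: u_def)
qed

section \<open>Mollification and the regularisation of distributions\<close>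

text \<open>The part of the definition of a delta function that a single standard function can satisfy: only
  moments of order below \<open>n\<close> vanish, and an \<open>L\<^sup>1\<close> norm infinitely close to \<open>1\<close> becomes one of at
  most \<open>2\<close>.\<close>

definition mollifier :: "nat \<Rightarrow> real \<Rightarrow> 'd::finite cfun \<Rightarrow> bool" where
  "mollifier n r D \<longleftrightarrow> 0 < r \<and> D \<in> test_functions UNIV \<and> (\<forall>x. r \<le> norm x \<longrightarrow> D x = 0) \<and>
     (\<forall>x. D (- x) = D x) \<and> (LINT x|lebesgue. D x) = 1 \<and>
     (\<forall>\<alpha>. 0 < msize \<alpha> \<and> msize \<alpha> < n \<longrightarrow> (LINT x|lebesgue. D x * of_real (mpower x \<alpha>)) = 0) \<and>
     (LINT x|lebesgue. norm (D x)) \<le> 2"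

lemma mollifier_test: "mollifier n r D \<Longrightarrow> D \<in> test_functions UNIV"
  by (simp add: mollifier_def)

lemma partial_derivs_zero_outside_cball:
  assumes "\<And>x. r \<le> norm x \<Longrightarrow> D x = 0" "norm x > r"
  shows "partial_derivs is D x = 0"
proof (rule partial_derivs_zero_outside_supp)
  have "supp D \<subseteq> cball 0 r" by (rule supp_subsetI) (auto intro: assms(1))
  then show "x \<notin> supp D" using assms(2) by auto
qed

lemma continuous_mpower: "continuous_on UNIV (\<lambda>x. of_real (mpower x \<alpha>) :: complex)"
  unfolding mpower_def by (intro continuous_intros)

text \<open>The vanishing moments leave only the constant term of the Taylor polynomial.\<close>

lemma mollifier_taylor_poly:
  fixes D :: "'d::finite cfun"
  assumes D: "mollifier n r D" and n: "n > 0"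
  shows "integrable lebesgue (\<lambda>z. D z * taylor_poly n F y z)"
    and "(LINT z|lebesgue. D z * taylor_poly n F y z) = F y"
proof -
  have D1: "(LINT x|lebesgue. D x) = 1"
    and mom: "\<And>\<alpha>. 0 < msize \<alpha> \<Longrightarrow> msize \<alpha> < n \<Longrightarrow> (LINT x|lebesgue. D x * of_real (mpower x \<alpha>)) = 0"
    using D by (auto simp: mollifier_def)
  have eq: "D z * taylor_poly n F y z = (\<Sum>k<n. \<Sum>is | length is = k.
      (of_real (1 / fact k) * partial_derivs is F y) * (D z * of_real (mpower z (count_list is))))" for z
    by (simp add: taylor_poly_def sum_distrib_left scaleR_conv_of_real list_power_eq_mpower mult_ac)
  have int: "integrable lebesgue (\<lambda>z. c * (D z * of_real (mpower z \<alpha>)))" for c \<alpha>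
    by (intro integrable_mult_right integrable_test_mult[OF mollifier_test[OF D] continuous_mpower])
  show "integrable lebesgue (\<lambda>z. D z * taylor_poly n F y z)"
    unfolding eq by (intro Bochner_Integration.integrable_sum int)
  have moment: "(LINT z|lebesgue. (of_real (1 / fact k) * partial_derivs is F y) * (D z * of_real (mpower z (count_list is))))
      = (if is = [] then F y else 0)" if "length is = k" "k < n" for k and "is" :: "'d list"
  proof (cases "is = []")
    case True
    then show ?thesis using that D1 by (simp add: mpower_def)
  next
    case False
    then have "length is \<noteq> 0" by simp
    then have "0 < msize (count_list is)" "msize (count_list is) < n"
      using that by (auto simp: length_eq_msize[symmetric])
    then show ?thesis using False mom by simp
  qed
  have "(LINT z|lebesgue. D z * taylor_poly n F y z)
      = (\<Sum>k<n. \<Sum>is :: 'd list | length is = k. if is = [] then F y else 0)"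
    unfolding eq
    by (simp add: Bochner_Integration.integral_sum int Bochner_Integration.integrable_sum moment del: of_real_divide integral_mult_right_zero integral_mult_right)
  also have "\<dots> = (\<Sum>k<n. if k = 0 then F y else 0)"
    by (intro sum.cong refl) (auto simp: sum.delta[OF finite_lists_length_eq_UNIV])
  also have "\<dots> = F y" using n by (simp add: sum.delta)
  finally show "(LINT z|lebesgue. D z * taylor_poly n F y z) = F y" .
qed

lemma mollifier_approximates:
  fixes D F :: "'d::finite cfun"
  assumes D: "mollifier n r D" and n: "n > 0" and F: "F \<in> smooth_functions UNIV"
    and B: "\<And>is w. length is = n \<Longrightarrow> dist y w \<le> r \<Longrightarrow> norm (partial_derivs is F w) \<le> B"
  shows "norm ((LINT z|lebesgue. D z * F (y + z)) - F y) \<le> 2 * (real CARD('d) * r) ^ n * B"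
proof -
  have r: "r > 0" and D0: "\<And>x. r \<le> norm x \<Longrightarrow> D x = 0" and D2: "(LINT x|lebesgue. norm (D x)) \<le> 2"
    using D by (auto simp: mollifier_def)
  note Dt = mollifier_test[OF D]
  \<comment> \<open>Any list of length \<open>n\<close> shows that \<open>B\<close> is nonnegative.\<close>
  have "norm (partial_derivs (replicate n undefined) F y) \<le> B" using r by (intro B) auto
  then have B0: "B \<ge> 0" by (rule order_trans[OF norm_ge_zero])
  let ?c = "(real CARD('d) * r) ^ n * B"
  have c0: "?c \<ge> 0" using B0 r by simp
  have "continuous_on UNIV (\<lambda>z. F (y + z))"
    by (rule continuous_on_compose2[OF smooth_continuous_on[OF F]]) (auto intro!: continuous_intros)
  then have i1: "integrable lebesgue (\<lambda>z. D z * F (y + z))" by (rule integrable_test_mult[OF Dt])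
  note i2 = mollifier_taylor_poly(1)[OF D n, of F y]
  have "(LINT z|lebesgue. D z * F (y + z)) - F y = (LINT z|lebesgue. D z * F (y + z)) - (LINT z|lebesgue. D z * taylor_poly n F y z)"
    by (simp add: mollifier_taylor_poly(2)[OF D n])
  also have "\<dots> = (LINT z|lebesgue. D z * F (y + z) - D z * taylor_poly n F y z)"
    by (rule Bochner_Integration.integral_diff[OF i1 i2, symmetric])
  also have "norm \<dots> \<le> (LINT z|lebesgue. norm (D z) * ?c)"
  proof (rule Bochner_Integration.integral_norm_bound_integral)
    show "integrable lebesgue (\<lambda>z. D z * F (y + z) - D z * taylor_poly n F y z)"
      by (rule Bochner_Integration.integrable_diff[OF i1 i2])
    show "integrable lebesgue (\<lambda>z. norm (D z) * ?c)" by (intro integrable_mult_left integrable_norm_test[OF Dt])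
    fix z
    show "norm (D z * F (y + z) - D z * taylor_poly n F y z) \<le> norm (D z) * ?c"
    proof (cases "norm z < r")
      case True
      have "norm (F (y + z) - taylor_poly n F y z) \<le> (real CARD('d) * norm z) ^ n * B"
      proof (rule smooth_taylor_bound[OF F n UNIV_I])
        fix t :: real and "is" :: "'d list" assume t: "0 \<le> t" "t \<le> 1" and l: "length is = n"
        have "dist y (y + t *\<^sub>R z) = t * norm z" using t by (simp add: dist_norm)
        also have "\<dots> \<le> 1 * r" using t True by (intro mult_mono) auto
        finally show "norm (partial_derivs is F (y + t *\<^sub>R z)) \<le> B" using B[OF l] by simp
      qed
      also have "\<dots> \<le> ?c" using True B0 by (intro mult_right_mono power_mono mult_left_mono) auto
      finally show ?thesis unfolding right_diff_distrib[symmetric] norm_mult by (rule mult_left_mono) simp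
    next
      case False
      then show ?thesis using D0[of z] by simp
    qed
  qed
  also have "\<dots> = (LINT z|lebesgue. norm (D z)) * ?c" by simp
  also have "\<dots> \<le> 2 * ?c" by (rule mult_right_mono[OF D2 c0])
  finally show ?thesis by (simp add: mult_ac)
qed

definition closed_nbhd :: "(real^'d) set \<Rightarrow> real \<Rightarrow> (real^'d::finite) set" where
  "closed_nbhd K \<delta> = (\<Union>x\<in>K. cball x \<delta>)"

lemma compact_closed_nbhd:
  assumes "compact K" shows "compact (closed_nbhd K \<delta>)"
proof -
  have "closed_nbhd K \<delta> = {x + y |x y. x \<in> K \<and> y \<in> cball 0 \<delta>}"
  proof (intro set_eqI iffI)
    fix z assume "z \<in> closed_nbhd K \<delta>"
    then obtain x where "x \<in> K" "dist x z \<le> \<delta>" by (auto simp: closed_nbhd_def)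
    then show "z \<in> {x + y |x y. x \<in> K \<and> y \<in> cball 0 \<delta>}"
      by (intro CollectI exI[of _ x] exI[of _ "z - x"]) (auto simp: dist_norm norm_minus_commute)
  next
    fix z assume "z \<in> {x + y |x y. x \<in> K \<and> y \<in> cball 0 \<delta>}"
    then obtain x y where "z = x + y" "x \<in> K" "norm y \<le> \<delta>" by auto
    then show "z \<in> closed_nbhd K \<delta>" unfolding closed_nbhd_def by (intro UN_I[of x]) (simp_all add: dist_norm)
  qed
  then show ?thesis using compact_sums[OF assms compact_cball[of 0 \<delta>]] by (simp only:)
qed

lemma subset_closed_nbhd: "\<delta> \<ge> 0 \<Longrightarrow> K \<subseteq> closed_nbhd K \<delta>"
  by (force simp: closed_nbhd_def)

lemma exists_closed_nbhd_subset:
  assumes "compact K" "open \<Omega>" "K \<subseteq> \<Omega>"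
  obtains \<delta> where "\<delta> > 0" "closed_nbhd K (2 * \<delta>) \<subseteq> \<Omega>"
proof -
  obtain e where "e > 0" "(\<Union>x\<in>K. cball x e) \<subseteq> \<Omega>"
    using compact_subset_open_imp_cball_epsilon_subset[OF assms] by blast
  then show ?thesis using that[of "e / 2"] by (simp add: closed_nbhd_def)
qed

text \<open>A point \<open>y\<close> in the support of the translate has distance at most \<open>r \<le> \<delta>\<close> from \<open>x\<close>, which has
  distance at most \<open>\<delta>\<close> from \<open>K\<close>.\<close>

lemma cutoff_translate_eq:
  assumes p: "\<And>y. y \<in> closed_nbhd K (2 * \<delta>) \<Longrightarrow> p y = 1"
    and D: "\<And>x. r \<le> norm x \<Longrightarrow> D x = 0" and r: "r \<le> \<delta>" and x: "x \<in> closed_nbhd K \<delta>"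
  shows "p y * partial_derivs is D (x - y) = partial_derivs is D (x - y)"
proof (cases "norm (x - y) > r")
  case True
  then show ?thesis using partial_derivs_zero_outside_cball[OF D True] by simp
next
  case False
  obtain k where k: "k \<in> K" "dist k x \<le> \<delta>" using x by (auto simp: closed_nbhd_def)
  have "dist k y \<le> dist k x + dist x y" by (rule dist_triangle)
  then have "dist k y \<le> 2 * \<delta>" using k(2) False r by (simp add: dist_norm)
  then have "y \<in> closed_nbhd K (2 * \<delta>)" using k(1) by (auto simp: closed_nbhd_def)
  then show ?thesis using p by simp
qed

lemma supp_translate_subset:
  assumes D: "\<And>x. r \<le> norm x \<Longrightarrow> D x = 0" and r: "r \<le> \<delta>" and x: "x \<in> closed_nbhd K \<delta>" and K: "compact K"
  shows "supp (\<lambda>y. D (x - y)) \<subseteq> closed_nbhd K (2 * \<delta>)"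
proof (rule supp_subsetI[OF compact_imp_closed[OF compact_closed_nbhd[OF K]]])
  fix y assume y: "y \<notin> closed_nbhd K (2 * \<delta>)"
  obtain k where k: "k \<in> K" "dist k x \<le> \<delta>" using x by (auto simp: closed_nbhd_def)
  have "\<not> dist k y \<le> 2 * \<delta>" using k(1) y by (auto simp: closed_nbhd_def)
  then have "dist x y > \<delta>" using k(2) dist_triangle[of k y x] by linarith
  then show "D (x - y) = 0" using r by (intro D) (simp add: dist_norm)
qed

text \<open>The cut-off disappears near \<open>K\<close>, hence the constants depend on \<open>T\<close> and \<open>K\<close> but not on \<open>p\<close>, \<open>D\<close>
  and \<open>r\<close>.  This uniformity is what permits \<open>p\<close>, \<open>D\<close> and \<open>r\<close> to become internal.\<close>

lemma convolution_bound:
  fixes T :: "'d::finite functional"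
  assumes \<Omega>: "open \<Omega>" and T: "T \<in> distributions \<Omega>" and K: "compact K" and sub: "closed_nbhd K (2 * \<delta>) \<subseteq> \<Omega>"
    and \<delta>: "\<delta> > 0"
  obtains C N where "C \<ge> 0" "\<And>p D r x is B. p \<in> test_functions \<Omega> \<Longrightarrow> (\<And>y. y \<in> closed_nbhd K (2 * \<delta>) \<Longrightarrow> p y = 1) \<Longrightarrow>
      D \<in> test_functions UNIV \<Longrightarrow> (\<And>x. r \<le> norm x \<Longrightarrow> D x = 0) \<Longrightarrow> r \<le> \<delta> \<Longrightarrow> x \<in> K \<Longrightarrow>
      (\<And>js x. length js \<le> N + length is \<Longrightarrow> norm (partial_derivs js D x) \<le> B) \<Longrightarrow>
      norm (partial_derivs is (dist_convolution (schwartz_product T p) D) x) \<le> C * B"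
proof -
  obtain C N where C: "C \<ge> 0" and CN: "\<And>\<phi> B. \<phi> \<in> test_functions \<Omega> \<Longrightarrow> supp \<phi> \<subseteq> closed_nbhd K (2 * \<delta>) \<Longrightarrow>
      (\<And>is x. length is \<le> N \<Longrightarrow> norm (partial_derivs is \<phi> x) \<le> B) \<Longrightarrow> norm (T \<phi>) \<le> C * B"
    using distribution_bound[OF T compact_closed_nbhd[OF K] sub] by metis
  show ?thesis
  proof (rule that[OF C])
    fix p D :: "'d cfun" and r B x and "is" :: "'d list"
    assume p: "p \<in> test_functions \<Omega>" "\<And>y. y \<in> closed_nbhd K (2 * \<delta>) \<Longrightarrow> p y = 1"
      and D: "D \<in> test_functions UNIV" "\<And>x. r \<le> norm x \<Longrightarrow> D x = 0" and r: "r \<le> \<delta>" and x: "x \<in> K"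
      and B: "\<And>js x. length js \<le> N + length is \<Longrightarrow> norm (partial_derivs js D x) \<le> B"
    have x': "x \<in> closed_nbhd K \<delta>" using subset_closed_nbhd \<delta> x by (meson less_imp_le subsetD)
    note dD = test_partial_derivs[OF D(1)]
    have s1: "supp (\<lambda>y. D (x - y)) \<subseteq> closed_nbhd K (2 * \<delta>)" by (rule supp_translate_subset[OF D(2) r x' K])
    have "supp (\<lambda>y. partial_derivs is D (x - y)) \<subseteq> supp (\<lambda>y. D (x - y))"
    proof (rule supp_subsetI[OF closed_supp])
      fix y assume "y \<notin> supp (\<lambda>y. D (x - y))"
      from partial_derivs_zero_outside_supp[OF this, of "is"]
      show "partial_derivs is D (x - y) = 0" by (simp add: partial_derivs_reflect[OF D(1)])
    qed
    then have s: "supp (\<lambda>y. partial_derivs is D (x - y)) \<subseteq> closed_nbhd K (2 * \<delta>)" using s1 by simp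
    have "norm (T (\<lambda>y. partial_derivs is D (x - y))) \<le> C * B"
    proof (rule CN[OF _ s])
      show "(\<lambda>y. partial_derivs is D (x - y)) \<in> test_functions \<Omega>"
        by (rule test_if_supp_subset[OF test_reflect[OF dD] order_trans[OF s sub]])
      fix js :: "'d list" and y assume "length js \<le> N"
      then show "norm (partial_derivs js (\<lambda>y. partial_derivs is D (x - y)) y) \<le> B"
        using B[of "js @ is"] by (simp add: partial_derivs_reflect[OF dD] norm_mult norm_power partial_derivs_append)
    qed
    moreover have "p y * partial_derivs is D (x - y) = partial_derivs is D (x - y)" for y
      by (rule cutoff_translate_eq[OF p(2) D(2) r x'])
    ultimately show "norm (partial_derivs is (dist_convolution (schwartz_product T p) D) x) \<le> C * B"
      unfolding partial_derivs_convolution[OF \<Omega> T p(1) D(1)] by (simp only:)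
  qed
qed

lemma mult_const_power: "2 * (c * r) ^ n * B = (2 * c ^ n * B) * r ^ n" for c r B :: real
  by (simp add: power_mult_distrib mult_ac)

text \<open>Exchanging \<open>T\<close> with the integral turns the pairing into \<open>T (p \<psi>) = T \<psi>\<close> for the mollification
  \<open>\<psi>\<close> of \<open>\<phi>\<close>, and every derivative of \<open>\<psi> - \<phi>\<close> is \<open>O(r\<^sup>n)\<close>.\<close>

lemma pairing_convolution_approx:
  fixes T :: "'d::finite functional"
  assumes \<Omega>: "open \<Omega>" and T: "T \<in> distributions \<Omega>" and \<phi>: "\<phi> \<in> test_functions \<Omega>" and n: "n > 0"
    and sub: "closed_nbhd (supp \<phi>) (2 * \<delta>) \<subseteq> \<Omega>" and \<delta>: "\<delta> > 0"
  shows "\<exists>C. \<forall>p D r. p \<in> test_functions \<Omega> \<longrightarrow> (\<forall>y\<in>closed_nbhd (supp \<phi>) (2 * \<delta>). p y = 1) \<longrightarrow>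
      mollifier n r D \<longrightarrow> r \<le> \<delta> \<longrightarrow>
      norm ((LINT x:\<Omega>|lebesgue. dist_convolution (schwartz_product T p) D x * \<phi> x) - T \<phi>) \<le> C * r ^ n"
proof -
  let ?K = "closed_nbhd (supp \<phi>) (2 * \<delta>)"
  obtain C N where C: "C \<ge> 0" and CN: "\<And>\<phi> B. \<phi> \<in> test_functions \<Omega> \<Longrightarrow> supp \<phi> \<subseteq> ?K \<Longrightarrow>
      (\<And>is x. length is \<le> N \<Longrightarrow> norm (partial_derivs is \<phi> x) \<le> B) \<Longrightarrow> norm (T \<phi>) \<le> C * B"
    using distribution_bound[OF T compact_closed_nbhd[OF test_compact_supp[OF \<phi>]] sub] by metis
  obtain B where B: "\<And>is x. length is \<le> N + n \<Longrightarrow> norm (partial_derivs is \<phi> x) \<le> B"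
    using test_bounded[OF \<phi>, where N = "N + n"] by metis
  show ?thesis
  proof (intro exI[of _ "C * (2 * real CARD('d) ^ n * B)"] allI impI)
    fix p D :: "'d cfun" and r
    assume p_test: "p \<in> test_functions \<Omega>" and p_one: "\<forall>y\<in>?K. p y = 1" and D: "mollifier n r D" and r: "r \<le> \<delta>"
    note p = p_test p_one[rule_format]
    note Dt = mollifier_test[OF D]
    have D0: "\<And>x. r \<le> norm x \<Longrightarrow> D x = 0" using D by (simp add: mollifier_def)
    define \<psi> where "\<psi> y = (LINT z|lebesgue. D z * \<phi> (y + z))" for y
    note fo = finite_order_integral[OF Dt]
    have \<psi>s: "\<psi> \<in> smooth_functions UNIV" and d\<psi>: "partial_derivs is \<psi> y = (LINT z|lebesgue. D z * partial_derivs is \<phi> (y + z))" for "is" y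
      unfolding \<psi>_def[abs_def]
      by (rule smooth_translates[OF fo test_UNIV[OF \<phi>]], rule partial_derivs_translates[OF fo test_UNIV[OF \<phi>]])
    have \<psi>0: "\<psi> y = 0" if y: "y \<notin> ?K" for y
    proof -
      have "D z * \<phi> (y + z) = 0" for z
      proof (rule ccontr)
        assume nz: "D z * \<phi> (y + z) \<noteq> 0"
        then have "y + z \<in> supp \<phi>" using zero_outside_supp[of "y + z" \<phi>] by force
        moreover have "norm z < r" using nz D0[of z] by force
        ultimately have "y \<in> ?K"
          unfolding closed_nbhd_def using r \<delta> by (intro UN_I[of "y + z"]) (auto simp: dist_norm)
        then show False using y by simp
      qed
      then show ?thesis by (simp only: \<psi>_def Bochner_Integration.integral_zero)
    qed
    have Kc: "compact ?K" by (rule compact_closed_nbhd[OF test_compact_supp[OF \<phi>]])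
    have \<psi>: "\<psi> \<in> test_functions \<Omega>" by (rule testI[OF \<psi>s Kc sub \<psi>0])
    have "(LINT x:\<Omega>|lebesgue. dist_convolution (schwartz_product T p) D x * \<phi> x)
        = (LINT x|lebesgue. \<phi> x * T (\<lambda>y. p y * D (x + - y)))"
      unfolding set_lebesgue_integral_def dist_convolution_product
      using zero_outside_supp[of _ \<phi>] test_supp_subset[OF \<phi>]
      by (intro Bochner_Integration.integral_cong) (auto simp: indicator_def)
    also have "\<dots> = T (\<lambda>y. p y * (LINT x|lebesgue. \<phi> x * D (x + - y)))"
      by (rule functional_integral_exchange[OF finite_order_product[OF \<Omega> T p(1)] test_UNIV[OF \<phi>] Dt])
    also have "(\<lambda>y. p y * (LINT x|lebesgue. \<phi> x * D (x + - y))) = \<psi>"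
    proof
      fix y
      have "continuous_on UNIV (\<lambda>x. \<phi> x * D (x + - y))"
        by (intro continuous_intros test_continuous[OF \<phi>] continuous_on_compose2[OF test_continuous[OF Dt, of UNIV]]) auto
      from lebesgue_integral_translate[OF this, of y]
      have "(LINT x|lebesgue. \<phi> x * D (x + - y)) = \<psi> y" by (simp add: \<psi>_def mult.commute)
      then show "p y * (LINT x|lebesgue. \<phi> x * D (x + - y)) = \<psi> y" using \<psi>0 p(2) by (cases "y \<in> ?K") auto
    qed
    also have "T \<psi> - T \<phi> = T (\<lambda>x. \<psi> x - \<phi> x)" by (rule distribution_diff[OF T \<psi> \<phi>, symmetric])
    also have "norm \<dots> \<le> C * (2 * (real CARD('d) * r) ^ n * B)"
    proof (rule CN[OF test_diff[OF \<psi> \<phi>]])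
      have "supp \<phi> \<subseteq> ?K" using \<delta> by (intro subset_closed_nbhd) simp
      then show "supp (\<lambda>x. \<psi> x - \<phi> x) \<subseteq> ?K"
        using \<psi>0 zero_outside_supp[of _ \<phi>] by (intro supp_subsetI[OF compact_imp_closed[OF Kc]]) auto
      fix "is" :: "'d list" and x assume l: "length is \<le> N"
      have "norm ((LINT z|lebesgue. D z * partial_derivs is \<phi> (x + z)) - partial_derivs is \<phi> x)
          \<le> 2 * (real CARD('d) * r) ^ n * B"
        by (rule mollifier_approximates[OF D n smooth_partial_derivs[OF test_smooth[OF \<phi>]]])
           (use l in \<open>simp add: partial_derivs_append[symmetric] B\<close>)
      then show "norm (partial_derivs is (\<lambda>x. \<psi> x - \<phi> x) x) \<le> 2 * (real CARD('d) * r) ^ n * B"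
        unfolding partial_derivs_diff[OF open_UNIV \<psi>s test_smooth[OF \<phi>] UNIV_I] d\<psi> .
    qed
    finally show "norm ((LINT x:\<Omega>|lebesgue. dist_convolution (schwartz_product T p) D x * \<phi> x) - T \<phi>)
        \<le> (C * (2 * real CARD('d) ^ n * B)) * r ^ n"
      unfolding mult_const_power mult.assoc[of C] .
  qed
qed

lemma dist_deriv_distribution:
  fixes T :: "'d::finite functional"
  assumes T: "T \<in> distributions \<Omega>"
  shows "dist_deriv \<Omega> \<alpha> T \<in> distributions \<Omega>"
proof -
  obtain "is" where al: "\<And>f. mderiv \<alpha> f = partial_derivs is f"
    using mderiv_as_list[of \<alpha>] by metis
  have ad: "partial_derivs is (\<lambda>x. \<phi> x + \<psi> x) = (\<lambda>x. partial_derivs is \<phi> x + partial_derivs is \<psi> x)"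
    if "\<phi> \<in> test_functions \<Omega>" "\<psi> \<in> test_functions \<Omega>" for \<phi> \<psi>
    by (rule ext) (rule partial_derivs_add[OF open_UNIV test_smooth[OF that(1)] test_smooth[OF that(2)] UNIV_I])
  have cm: "partial_derivs is (\<lambda>x. c * \<phi> x) = (\<lambda>x. c * partial_derivs is \<phi> x)"
    if "\<phi> \<in> test_functions \<Omega>" for \<phi> c
    by (rule ext) (rule partial_derivs_cmult[OF open_UNIV test_smooth[OF that] UNIV_I])
  show ?thesis
  proof (rule distributionI)
    fix K assume "compact K" "K \<subseteq> \<Omega>"
    then obtain C N where CN: "\<And>\<phi> B. \<phi> \<in> test_functions \<Omega> \<Longrightarrow> supp \<phi> \<subseteq> K \<Longrightarrow>
      (\<And>is x. length is \<le> N \<Longrightarrow> norm (partial_derivs is \<phi> x) \<le> B) \<Longrightarrow> norm (T \<phi>) \<le> C * B"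
      using distribution_bound[OF T] by metis
    have "norm (dist_deriv \<Omega> \<alpha> T \<phi>) \<le> C * B"
      if \<phi>: "\<phi> \<in> test_functions \<Omega>" "supp \<phi> \<subseteq> K"
        and B: "\<forall>js x. length js \<le> N + length is \<longrightarrow> norm (partial_derivs js \<phi> x) \<le> B" for \<phi> B
    proof -
      have "norm (T (partial_derivs is \<phi>)) \<le> C * B"
        by (rule CN[OF test_partial_derivs[OF \<phi>(1)] order_trans[OF supp_partial_derivs \<phi>(2)]])
           (simp add: partial_derivs_append[symmetric] B)
      then show ?thesis using \<phi>(1) by (simp add: dist_deriv_def al norm_mult norm_power)
    qed
    then show "\<exists>C N. \<forall>\<phi>\<in>test_functions \<Omega>. supp \<phi> \<subseteq> K \<longrightarrow>
      (\<forall>B. (\<forall>is x. length is \<le> N \<longrightarrow> norm (partial_derivs is \<phi> x) \<le> B) \<longrightarrow> norm (dist_deriv \<Omega> \<alpha> T \<phi>) \<le> C * B)"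
      by (intro exI[of _ C] exI[of _ "N + length is"] ballI impI allI)
  next
    fix \<phi> \<psi> assume t: "\<phi> \<in> test_functions \<Omega>" "\<psi> \<in> test_functions \<Omega>"
    show "dist_deriv \<Omega> \<alpha> T (\<lambda>x. \<phi> x + \<psi> x) = dist_deriv \<Omega> \<alpha> T \<phi> + dist_deriv \<Omega> \<alpha> T \<psi>"
      using test_add[OF t] t
      by (simp add: dist_deriv_def al ad[OF t] distribution_add[OF T test_partial_derivs test_partial_derivs] distrib_left)
  next
    fix \<phi> c assume t: "\<phi> \<in> test_functions \<Omega>"
    show "dist_deriv \<Omega> \<alpha> T (\<lambda>x. c * \<phi> x) = c * dist_deriv \<Omega> \<alpha> T \<phi>"
      using test_cmult[OF t, of c] t
      by (simp add: dist_deriv_def al cm[OF t] distribution_cmult[OF T test_partial_derivs])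
  qed (simp add: dist_deriv_def)
qed

text \<open>Both functions are \<open>T\<close> applied to the same translate of a derivative of \<open>D\<close>, not only on \<open>K\<close> but
  on an open neighbourhood, so all derivatives of their difference vanish on \<open>K\<close>.\<close>

lemma convolution_dist_deriv:
  fixes T :: "'d::finite functional"
  assumes \<Omega>: "open \<Omega>" and T: "T \<in> distributions \<Omega>" and K: "compact K" and \<delta>: "\<delta> > 0"
    and p: "p \<in> test_functions \<Omega>" "\<And>y. y \<in> closed_nbhd K (2 * \<delta>) \<Longrightarrow> p y = 1"
    and D: "D \<in> test_functions UNIV" "\<And>x. r \<le> norm x \<Longrightarrow> D x = 0" and r: "r \<le> \<delta>" and x: "x \<in> K"
  shows "partial_derivs is (\<lambda>x. dist_convolution (schwartz_product (dist_deriv \<Omega> \<alpha> T) p) D x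
    - mderiv \<alpha> (dist_convolution (schwartz_product T p) D) x) x = 0"
proof -
  let ?V = "\<Union>k\<in>K. ball k \<delta>"
  obtain js where al: "length js = msize \<alpha>" "\<And>f. mderiv \<alpha> f = partial_derivs js f" 
    using mderiv_as_list[of \<alpha>] by metis
  have "dist_convolution (schwartz_product (dist_deriv \<Omega> \<alpha> T) p) D x
    - mderiv \<alpha> (dist_convolution (schwartz_product T p) D) x = 0" if "x \<in> ?V" for x
  proof -
    have x': "x \<in> closed_nbhd K \<delta>" using that by (force simp: closed_nbhd_def)
    have eq: "p y * partial_derivs is D (x - y) = partial_derivs is D (x - y)" for "is" y
      by (rule cutoff_translate_eq[OF p(2) D(2) r x'])
    have "(\<lambda>y. p y * D (x - y)) \<in> test_functions \<Omega>"
      by (rule test_mult_smooth[OF \<Omega> p(1) smooth_subset[OF test_smooth[OF test_reflect[OF D(1)]]]]) simp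
    moreover have eq0: "(\<lambda>y. p y * D (x - y)) = (\<lambda>y. D (x - y))"
      using eq[of _ "[]"] by (simp only: partial_derivs.simps)
    ultimately have t: "(\<lambda>y. D (x - y)) \<in> test_functions \<Omega>" by (simp only:)
    have dt: "(\<lambda>y. partial_derivs js D (x - y)) \<in> test_functions \<Omega>"
      using test_cmult[OF test_partial_derivs[OF t, of js], of "(- 1) ^ length js"]
      by (simp add: partial_derivs_reflect[OF D(1)] mult.assoc[symmetric] power_mult_distrib[symmetric])
    have "dist_convolution (schwartz_product (dist_deriv \<Omega> \<alpha> T) p) D x = dist_deriv \<Omega> \<alpha> T (\<lambda>y. D (x - y))"
      unfolding dist_convolution_product eq0 ..
    also have "\<dots> = (- 1) ^ length js * T (\<lambda>y. (- 1) ^ length js * partial_derivs js D (x - y))"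
      using t by (simp add: dist_deriv_def al partial_derivs_reflect[OF D(1)])
    also have "\<dots> = T (\<lambda>y. partial_derivs js D (x - y))"
      by (simp add: distribution_cmult[OF T dt] mult.assoc[symmetric] power_mult_distrib[symmetric])
    also have "\<dots> = mderiv \<alpha> (dist_convolution (schwartz_product T p) D) x"
      unfolding al partial_derivs_convolution[OF \<Omega> T p(1) D(1)] eq ..
    finally show ?thesis by simp
  qed
  then have "partial_derivs is (\<lambda>x. dist_convolution (schwartz_product (dist_deriv \<Omega> \<alpha> T) p) D x
    - mderiv \<alpha> (dist_convolution (schwartz_product T p) D) x) x = partial_derivs is (\<lambda>x. 0) x"
    by (rule partial_derivs_cong[of ?V, rotated]) (use x \<delta> in \<open>auto intro!: bexI[of _ x]\<close>)
  then show ?thesis by (simp add: partial_derivs_zero)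
qed

lemma schwartz_embedding_distribution:
  fixes f :: "'d::finite cfun"
  assumes \<Omega>: "open \<Omega>" and f: "f \<in> smooth_functions \<Omega>"
  shows "schwartz_embedding \<Omega> f \<in> distributions \<Omega>"
proof -
  have int: "set_integrable lebesgue \<Omega> (\<lambda>x. f x * \<phi> x)" if \<phi>: "\<phi> \<in> test_functions \<Omega>" for \<phi>
  proof -
    note t = test_mult_smooth[OF \<Omega> \<phi> f]
    have "integrable lebesgue (\<lambda>x. (\<phi> x * f x) * 1)" by (rule integrable_test_mult[OF t]) simp
    moreover have "indicator \<Omega> x *\<^sub>R (f x * \<phi> x) = (\<phi> x * f x) * 1" for x
      using zero_outside_supp[of x \<phi>] test_supp_subset[OF \<phi>] by (auto simp: indicator_def)
    ultimately show ?thesis by (simp add: set_integrable_def)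
  qed
  show ?thesis
  proof (rule distributionI)
    fix K assume K: "compact K" "K \<subseteq> \<Omega>"
    obtain A where A: "A \<ge> 0" "\<And>is x. length is \<le> 0 \<Longrightarrow> x \<in> K \<Longrightarrow> norm (partial_derivs is f x) \<le> A"
      using smooth_bounded_on_compact[OF f K, where N = 0] by metis
    have "norm (schwartz_embedding \<Omega> f \<phi>) \<le> (A * measure lebesgue K) * B"
      if \<phi>: "\<phi> \<in> test_functions \<Omega>" "supp \<phi> \<subseteq> K"
        and B: "\<forall>is x. length is \<le> 0 \<longrightarrow> norm (partial_derivs is \<phi> x) \<le> B" for \<phi> B
    proof -
      have Bx: "norm (\<phi> x) \<le> B" for x using B[rule_format, of "[]" x] by simp
      have B0: "B \<ge> 0" by (rule order_trans[OF norm_ge_zero Bx])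
      have "norm (schwartz_embedding \<Omega> f \<phi>) = norm (LINT x|lebesgue. indicator \<Omega> x *\<^sub>R (f x * \<phi> x))"
        using \<phi> by (simp add: schwartz_embedding_def set_lebesgue_integral_def)
      also have "\<dots> \<le> (LINT x|lebesgue. indicator K x *\<^sub>R (A * B))"
      proof (rule Bochner_Integration.integral_norm_bound_integral)
        show "integrable lebesgue (\<lambda>x. indicator \<Omega> x *\<^sub>R (f x * \<phi> x))"
          using int[OF \<phi>(1)] by (simp add: set_integrable_def)
        show "integrable lebesgue (\<lambda>x. indicator K x *\<^sub>R (A * B))"
          using lmeasurable_compact[OF K(1)] by (auto intro!: integrable_scaleR_left simp: fmeasurable_def)
        fix x
        show "norm (indicator \<Omega> x *\<^sub>R (f x * \<phi> x)) \<le> indicator K x *\<^sub>R (A * B)"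
        proof (cases "x \<in> K")
          case True
          then have "norm (f x * \<phi> x) \<le> A * B"
            unfolding norm_mult using A(2)[of "[]" x] Bx A(1) B0 by (intro mult_mono) auto
          then show ?thesis using True K(2) by (auto simp: indicator_def)
        next
          case False
          then have "\<phi> x = 0" using zero_outside_supp[of x \<phi>] \<phi>(2) by blast
          then show ?thesis using False by simp
        qed
      qed
      also have "\<dots> = (A * measure lebesgue K) * B"
        using lmeasurable_compact[OF K(1)] by (simp add: fmeasurable_def)
      finally show ?thesis .
    qed
    then show "\<exists>C N. \<forall>\<phi>\<in>test_functions \<Omega>. supp \<phi> \<subseteq> K \<longrightarrow>
      (\<forall>B. (\<forall>is x. length is \<le> N \<longrightarrow> norm (partial_derivs is \<phi> x) \<le> B) \<longrightarrow> norm (schwartz_embedding \<Omega> f \<phi>) \<le> C * B)"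
      by (intro exI[of _ "A * measure lebesgue K"] exI[of _ 0] ballI impI allI)
  next
    fix \<phi> \<psi> assume t: "\<phi> \<in> test_functions \<Omega>" "\<psi> \<in> test_functions \<Omega>"
    show "schwartz_embedding \<Omega> f (\<lambda>x. \<phi> x + \<psi> x) = schwartz_embedding \<Omega> f \<phi> + schwartz_embedding \<Omega> f \<psi>"
      using set_integral_add(2)[OF int[OF t(1)] int[OF t(2)]] t test_add[OF t]
      by (simp add: schwartz_embedding_def distrib_left)
  next
    fix \<phi> c assume t: "\<phi> \<in> test_functions \<Omega>"
    show "schwartz_embedding \<Omega> f (\<lambda>x. c * \<phi> x) = c * schwartz_embedding \<Omega> f \<phi>"
      using t test_cmult[OF t, of c]
      by (simp add: schwartz_embedding_def mult.left_commute[of _ c])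
  qed (simp add: schwartz_embedding_def)
qed

text \<open>The product \<open>F = p f\<close> is a test function, so by the symmetry of \<open>D\<close> the regularisation is the
  mollification of \<open>F\<close>; and \<open>F = f\<close> near \<open>K\<close>.\<close>

lemma convolution_schwartz_embedding_approx:
  fixes f :: "'d::finite cfun"
  assumes \<Omega>: "open \<Omega>" and f: "f \<in> smooth_functions \<Omega>" and K: "compact K" and n: "n > 0"
    and sub: "closed_nbhd K (2 * \<delta>) \<subseteq> \<Omega>" and \<delta>: "\<delta> > 0"
  shows "\<exists>C. \<forall>p D r x. p \<in> test_functions \<Omega> \<longrightarrow> (\<forall>y\<in>closed_nbhd K (2 * \<delta>). p y = 1) \<longrightarrow>
      mollifier n r D \<longrightarrow> r \<le> \<delta> \<longrightarrow> x \<in> K \<longrightarrow>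
      norm (partial_derivs ks (\<lambda>x. dist_convolution (schwartz_product (schwartz_embedding \<Omega> f) p) D x - f x) x) \<le> C * r ^ n"
proof -
  let ?K = "closed_nbhd K (2 * \<delta>)" and ?V = "\<Union>k\<in>K. ball k (2 * \<delta>)"
  obtain B where B: "\<And>js x. length js \<le> n + length ks \<Longrightarrow> x \<in> ?K \<Longrightarrow> norm (partial_derivs js f x) \<le> B"
    using smooth_bounded_on_compact[OF f compact_closed_nbhd[OF K] sub, where N = "n + length ks"] by metis
  have VK: "?V \<subseteq> ?K" by (force simp: closed_nbhd_def)
  have V: "open ?V" by auto
  have KV: "w \<in> ?V" if "x \<in> K" "dist x w \<le> \<delta>" for x w using that \<delta> by (force simp: dist_commute)
  have K\<Omega>: "K \<subseteq> \<Omega>" using sub subset_closed_nbhd[of "2 * \<delta>" K] \<delta> by auto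
  show ?thesis
  proof (intro exI[of _ "2 * real CARD('d) ^ n * B"] allI impI)
    fix p D :: "'d cfun" and r x
    assume p_test: "p \<in> test_functions \<Omega>" and p_one: "\<forall>y\<in>?K. p y = 1" and D: "mollifier n r D"
      and r: "r \<le> \<delta>" and x: "x \<in> K"
    note p = p_test p_one[rule_format]
    note Dt = mollifier_test[OF D]
    have sym: "D (- x) = D x" for x using D by (simp add: mollifier_def)
    define F where "F y = p y * f y" for y
    have F: "F \<in> test_functions \<Omega>" unfolding F_def[abs_def] by (rule test_mult_smooth[OF \<Omega> p(1) f])
    let ?u = "dist_convolution (schwartz_product (schwartz_embedding \<Omega> f) p) D"
    have dF: "partial_derivs js F w = partial_derivs js f w" if "w \<in> ?V" for js w
    proof (rule partial_derivs_cong[OF V _ that])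
      fix y assume "y \<in> ?V"
      then have "p y = 1" using VK by (intro p(2)) (rule subsetD)
      then show "F y = f y" by (simp add: F_def)
    qed
    have u: "?u = (\<lambda>x. LINT z|lebesgue. D z * F (x + z))"
    proof
      fix x
      have "(\<lambda>y. p y * D (x - y)) \<in> test_functions \<Omega>"
        by (rule test_mult_smooth[OF \<Omega> p(1) smooth_subset[OF test_smooth[OF test_reflect[OF Dt]]]]) simp
      then have "?u x = (LINT y:\<Omega>|lebesgue. f y * (p y * D (x - y)))"
        by (simp add: dist_convolution_product schwartz_embedding_def)
      also have "\<dots> = (LINT y|lebesgue. F y * D (x - y))"
        unfolding set_lebesgue_integral_def
        using zero_outside_supp[of _ p] test_supp_subset[OF p(1)]
        by (intro Bochner_Integration.integral_cong) (auto simp: indicator_def F_def)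
      also have "\<dots> = (LINT z|lebesgue. F (x + z) * D (x - (x + z)))"
        by (rule lebesgue_integral_translate[symmetric])
          (intro continuous_on_mult test_continuous[OF F] test_continuous[OF test_reflect[OF Dt]])
      finally show "?u x = (LINT z|lebesgue. D z * F (x + z))" by (simp add: sym mult.commute)
    qed
    note fo = finite_order_integral[OF Dt]
    have us: "?u \<in> smooth_functions UNIV" unfolding u by (rule smooth_translates[OF fo test_UNIV[OF F]])
    have du: "partial_derivs ks ?u x = (LINT z|lebesgue. D z * partial_derivs ks F (x + z))"
      unfolding u by (rule partial_derivs_translates[OF fo test_UNIV[OF F]])
    have xV: "x \<in> ?V" using KV[OF x] \<delta> by simp
    have "norm ((LINT z|lebesgue. D z * partial_derivs ks F (x + z)) - partial_derivs ks F x)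
        \<le> 2 * (real CARD('d) * r) ^ n * B"
    proof (rule mollifier_approximates[OF D n smooth_partial_derivs[OF test_smooth[OF F]]])
      fix js :: "'d list" and w assume l: "length js = n" and "dist x w \<le> r"
      then have w: "w \<in> ?V" using KV[OF x, of w] r by linarith
      have "norm (partial_derivs (js @ ks) f w) \<le> B" using l by (intro B subsetD[OF VK w]) simp
      then show "norm (partial_derivs js (partial_derivs ks F) w) \<le> B"
        using dF[OF w, of "js @ ks"] by (simp add: partial_derivs_append)
    qed
    moreover have "partial_derivs ks (\<lambda>x. ?u x - f x) x
        = (LINT z|lebesgue. D z * partial_derivs ks F (x + z)) - partial_derivs ks F x"
      unfolding du[symmetric] dF[OF xV]
      by (rule partial_derivs_diff[OF \<Omega> smooth_subset[OF us] f]) (use x K\<Omega> in auto)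
    ultimately show "norm (partial_derivs ks (\<lambda>x. ?u x - f x) x) \<le> (2 * real CARD('d) ^ n * B) * r ^ n"
      unfolding mult_const_power by simp
  qed
qed

section \<open>Types of tuples in a nonstandard model\<close>

abbreviation All_fm :: "nat \<Rightarrow> 's fm \<Rightarrow> 's fm" where
  "All_fm v \<phi> \<equiv> Neg (Exists v (Neg \<phi>))"

primrec close_fm :: "nat \<Rightarrow> 's fm \<Rightarrow> 's fm" where
  "close_fm 0 \<phi> = \<phi>"
| "close_fm (Suc n) \<phi> = All_fm n (close_fm n \<phi>)"

lemma sat_close_fm: "sat I (close_fm n \<phi>) e \<longleftrightarrow> (\<forall>e'. (\<forall>i\<ge>n. e' i = e i) \<longrightarrow> sat I \<phi> e')"
proof (induction n arbitrary: e)
  case 0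
  have "(\<forall>i\<ge>0. e' i = e i) \<longleftrightarrow> e' = e" for e' :: "nat \<Rightarrow> 'b" by (auto simp: fun_eq_iff)
  then show ?case by simp
next
  case (Suc n)
  have "(\<forall>u e'. (\<forall>i\<ge>n. e' i = (e(n := u)) i) \<longrightarrow> sat I \<phi> e') \<longleftrightarrow> (\<forall>e'. (\<forall>i\<ge>Suc n. e' i = e i) \<longrightarrow> sat I \<phi> e')"
  proof (intro iffI allI impI)
    fix e' :: "nat \<Rightarrow> 'b"
    assume *: "\<forall>u e'. (\<forall>i\<ge>n. e' i = (e(n := u)) i) \<longrightarrow> sat I \<phi> e'" and e': "\<forall>i\<ge>Suc n. e' i = e i"
    have "\<forall>i\<ge>n. e' i = (e(n := e' n)) i" using e' by auto
    then show "sat I \<phi> e'" using * by blast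
  next
    fix u and e' :: "nat \<Rightarrow> 'b"
    assume *: "\<forall>e'. (\<forall>i\<ge>Suc n. e' i = e i) \<longrightarrow> sat I \<phi> e'" and e': "\<forall>i\<ge>n. e' i = (e(n := u)) i"
    have "\<forall>i\<ge>Suc n. e' i = e i" using e' by auto
    then show "sat I \<phi> e'" using * by blast
  qed
  then show ?case unfolding close_fm.simps sat.simps Suc.IH not_ex not_not .
qed

definition tuple_env :: "'u \<Rightarrow> 'u list \<Rightarrow> nat \<Rightarrow> 'u" where
  "tuple_env c us i = (if i < length us then us ! i else c)"

lemma map_tuple_env: "map (tuple_env c us) [0..<length us] = us"
  by (rule nth_equalityI) (auto simp: tuple_env_def)

text \<open>Universal closure turns validity into a sentence, to which transfer applies.  Quantifying over all
  environments that are constantly \<open>c\<close> beyond the tuple makes a list of the free variables of \<open>\<phi>\<close>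
  superfluous, and lets \<open>c\<close> serve as a standard parameter.\<close>

lemma transfer_valid:
  assumes M: "transfer_principle M"
    and valid: "\<And>e. (\<forall>i\<ge>length us. e i = c) \<Longrightarrow> sat (\<lambda>R. R) \<phi> e"
  shows "sat (star_rel M) \<phi> (tuple_env (star_of M c) us)"
proof -
  let ?n = "length us"
  have "sat (\<lambda>R. R) (close_fm ?n \<phi>) (\<lambda>_. c)" using valid by (simp add: sat_close_fm)
  then have "sat (star_rel M) (close_fm ?n \<phi>) (star_of M \<circ> (\<lambda>_. c))"
    using M unfolding transfer_principle_def by blast
  then show ?thesis unfolding sat_close_fm by (simp add: tuple_env_def)
qed

abbreviation in_star :: "('s, 'u) nsmodel \<Rightarrow> ('s list \<Rightarrow> bool) \<Rightarrow> 'u list \<Rightarrow> bool" where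
  "in_star M P us \<equiv> us \<in> star_rel M {xs. P xs}"

lemma in_star_True:
  assumes M: "transfer_principle M" shows "in_star M (\<lambda>xs. length xs = length us) us"
  using transfer_valid[OF M, of us undefined "Rel {xs. length xs = length us} [0..<length us]"]
  by (simp add: map_tuple_env)

lemma in_star_mono2:
  assumes M: "transfer_principle M" and "in_star M P us" "in_star M Q us"
    and "\<And>xs. length xs = length us \<Longrightarrow> P xs \<Longrightarrow> Q xs \<Longrightarrow> S xs"
  shows "in_star M S us"
  using transfer_valid[OF M, of us undefined "Neg (Conj (Conj (Rel {xs. P xs} [0..<length us])
    (Rel {xs. Q xs} [0..<length us])) (Neg (Rel {xs. S xs} [0..<length us])))"] assms(2-)
  by (auto simp: map_tuple_env)

lemma in_star_False:
  assumes M: "transfer_principle M" shows "\<not> in_star M (\<lambda>xs. False) us"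
  using transfer_valid[OF M, of us undefined "Neg (Rel {xs. False} [0..<length us])"]
  by (simp add: map_tuple_env)

lemma in_star_Not:
  assumes M: "transfer_principle M" shows "in_star M (\<lambda>xs. \<not> P xs) us \<longleftrightarrow> \<not> in_star M P us"
proof -
  have "in_star M P us \<or> in_star M (\<lambda>xs. \<not> P xs) us"
    using transfer_valid[OF M, of us undefined "Neg (Conj (Neg (Rel {xs. P xs} [0..<length us]))
      (Neg (Rel {xs. \<not> P xs} [0..<length us])))"]
    by (auto simp: map_tuple_env)
  moreover have "\<not> (in_star M P us \<and> in_star M (\<lambda>xs. \<not> P xs) us)"
    using in_star_mono2[OF M, of us P "\<lambda>xs. \<not> P xs" "\<lambda>xs. False"] in_star_False[OF M, of us] by blast
  ultimately show ?thesis by blast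
qed

text \<open>The standard properties of a tuple of internal elements form an ultrafilter, the type of the tuple
  in the sense of model theory.  Expressed through \<open>eventually\<close>, transfer needs no formulas.\<close>

definition type_of :: "('s, 'u) nsmodel \<Rightarrow> 'u list \<Rightarrow> 's list filter" where
  "type_of M us = Abs_filter (\<lambda>P. in_star M P us)"

lemma eventually_type_of:
  assumes M: "transfer_principle M"
  shows "eventually P (type_of M us) \<longleftrightarrow> in_star M P us"
  unfolding type_of_def
proof (rule eventually_Abs_filter, rule is_filter.intro)
  show "in_star M (\<lambda>xs. True) us"
    by (rule in_star_mono2[OF M in_star_True[OF M] in_star_True[OF M]]) simp
  show "in_star M (\<lambda>xs. P xs \<and> Q xs) us" if "in_star M P us" "in_star M Q us" for P Q
    by (rule in_star_mono2[OF M that]) simp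
  show "in_star M Q us" if "\<forall>xs. P xs \<longrightarrow> Q xs" "in_star M P us" for P Q
    by (rule in_star_mono2[OF M that(2,2)]) (simp add: that(1))
qed

lemma type_of_neq_bot: "transfer_principle M \<Longrightarrow> type_of M us \<noteq> bot"
  using eventually_type_of[of M "\<lambda>_. False" us] in_star_False[of M us] by auto

lemma eventually_type_of_not:
  assumes M: "transfer_principle M"
  shows "eventually (\<lambda>xs. \<not> P xs) (type_of M us) \<longleftrightarrow> \<not> eventually P (type_of M us)"
  using in_star_Not[OF M] by (simp add: eventually_type_of[OF M])

lemma eventually_length_type_of:
  "transfer_principle M \<Longrightarrow> eventually (\<lambda>xs. length xs = length us) (type_of M us)"
  using in_star_True by (simp add: eventually_type_of)

lemma eventually_type_of_project:
  assumes M: "transfer_principle M" and vs: "vs = map ((!) us) js" and js: "\<forall>j\<in>set js. j < length us"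
  shows "eventually P (type_of M vs) \<longleftrightarrow> eventually (\<lambda>xs. P (map ((!) xs) js)) (type_of M us)"
proof -
  have e: "map ((!) (map e [0..<length us])) js = map e js" for e :: "nat \<Rightarrow> 'c"
    using js by simp
  have e': "map (tuple_env (star_of M undefined) us) js = map ((!) us) js"
    using js by (simp add: tuple_env_def)
  let ?A = "Rel {xs. P xs} js" and ?B = "Rel {xs. P (map ((!) xs) js)} [0..<length us]"
  have "sat (\<lambda>R. R) (Neg (Conj ?A (Neg ?B))) e" "sat (\<lambda>R. R) (Neg (Conj ?B (Neg ?A))) e" for e
    unfolding sat.simps mem_Collect_eq e by blast+
  then have "sat (star_rel M) (Neg (Conj ?A (Neg ?B))) (tuple_env (star_of M undefined) us)"
    "sat (star_rel M) (Neg (Conj ?B (Neg ?A))) (tuple_env (star_of M undefined) us)"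
    by (auto intro!: transfer_valid[OF M] simp del: sat.simps)
  then show ?thesis
    unfolding eventually_type_of[OF M] sat.simps map_tuple_env e' vs by blast
qed

lemma eventually_type_of_eq:
  assumes M: "transfer_principle M" and "i < length us" "j < length us"
  shows "eventually (\<lambda>xs. xs ! i = xs ! j) (type_of M us) \<longleftrightarrow> us ! i = us ! j"
proof -
  let ?A = "Rel {xs. xs ! i = xs ! j} [0..<length us]" and ?B = "Eq i j"
  have "sat (star_rel M) (Neg (Conj ?A (Neg ?B))) (tuple_env (star_of M undefined) us)"
    "sat (star_rel M) (Neg (Conj ?B (Neg ?A))) (tuple_env (star_of M undefined) us)"
    by (rule transfer_valid[OF M], use assms(2,3) in simp)+
  then show ?thesis
    unfolding eventually_type_of[OF M] using assms(2,3) by (auto simp: map_tuple_env) (auto simp: tuple_env_def)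
qed

text \<open>Los' theorem for the quantifier: an internal witness exists exactly if standard witnesses exist for
  almost all values of the tuple.\<close>

lemma eventually_type_of_ex:
  assumes M: "transfer_principle M"
  shows "(\<exists>u. eventually P (type_of M (u # us))) \<longleftrightarrow> eventually (\<lambda>xs. \<exists>x. P (x # xs)) (type_of M us)"
proof -
  let ?n = "length us"
  let ?A = "Exists ?n (Rel {xs. P xs} (?n # [0..<?n]))" and ?B = "Rel {xs. \<exists>x. P (x # xs)} [0..<?n]"
  have m: "map (e(?n := u)) (?n # [0..<?n]) = u # map e [0..<?n]" for e :: "nat \<Rightarrow> 'c" and u by simp
  have "sat (\<lambda>R. R) (Neg (Conj ?A (Neg ?B))) e" "sat (\<lambda>R. R) (Neg (Conj ?B (Neg ?A))) e" for e
    unfolding sat.simps mem_Collect_eq m by blast+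
  then have "sat (star_rel M) (Neg (Conj ?A (Neg ?B))) (tuple_env (star_of M undefined) us)"
    "sat (star_rel M) (Neg (Conj ?B (Neg ?A))) (tuple_env (star_of M undefined) us)"
    by (auto intro!: transfer_valid[OF M] simp del: sat.simps)
  then show ?thesis
    unfolding eventually_type_of[OF M] sat.simps m map_tuple_env by blast
qed

lemma eventually_type_of_all:
  assumes M: "transfer_principle M"
  shows "(\<forall>u. eventually P (type_of M (u # us))) \<longleftrightarrow> eventually (\<lambda>xs. \<forall>x. P (x # xs)) (type_of M us)"
  using eventually_type_of_ex[OF M, of "\<lambda>xs. \<not> P xs" us]
    eventually_type_of_not[OF M, of "\<lambda>xs. \<exists>x. \<not> P (x # xs)" us]
  unfolding eventually_type_of_not[OF M, of P] by auto

section \<open>Internal elements as values of starred functions\<close>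

text \<open>The value of \<open>\<^sup>*F\<close> at the tuple \<open>us\<close>, described by its graph.\<close>

definition star_value :: "('s, 'u) nsmodel \<Rightarrow> ('s list \<Rightarrow> 's) \<Rightarrow> 'u list \<Rightarrow> 'u" where
  "star_value M F us = (THE w. \<forall>\<^sub>F xs in type_of M (w # us). hd xs = F (tl xs))"

lemma star_graph_unique:
  assumes M: "transfer_principle M"
    and w: "\<forall>\<^sub>F xs in type_of M (w # us). hd xs = F (tl xs)"
    and w': "\<forall>\<^sub>F xs in type_of M (w' # us). hd xs = F (tl xs)"
  shows "w = w'"
proof -
  let ?n = "length us" and ?us = "w # w' # us"
  have p1: "w # us = map ((!) ?us) (0 # map (\<lambda>i. i + 2) [0..<?n])"
    and p2: "w' # us = map ((!) ?us) (1 # map (\<lambda>i. i + 2) [0..<?n])"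
    by (simp_all add: comp_def map_nth)
  have b: "\<forall>j\<in>set (0 # map (\<lambda>i. i + 2) [0..<?n]). j < length ?us" by auto
  have b': "\<forall>j\<in>set (1 # map (\<lambda>i. i + 2) [0..<?n]). j < length ?us" by auto
  have "\<forall>\<^sub>F xs in type_of M ?us. xs ! 0 = F (map (\<lambda>i. xs ! (i + 2)) [0..<?n])"
    using w unfolding eventually_type_of_project[OF M p1 b] by (simp add: comp_def)
  moreover have "\<forall>\<^sub>F xs in type_of M ?us. xs ! 1 = F (map (\<lambda>i. xs ! (i + 2)) [0..<?n])"
    using w' unfolding eventually_type_of_project[OF M p2 b'] by (simp add: comp_def)
  ultimately have "\<forall>\<^sub>F xs in type_of M ?us. xs ! 0 = xs ! 1"
    by eventually_elim simp
  then show ?thesis using eventually_type_of_eq[OF M, of 0 ?us 1] by simp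
qed

lemma star_value_eqI:
  assumes M: "transfer_principle M" and "\<forall>\<^sub>F xs in type_of M (w # us). hd xs = F (tl xs)"
  shows "star_value M F us = w"
  unfolding star_value_def using assms star_graph_unique[OF M] by (intro the_equality) blast+

lemma star_value_graph:
  assumes M: "transfer_principle M"
  shows "\<forall>\<^sub>F xs in type_of M (star_value M F us # us). hd xs = F (tl xs)"
proof -
  have "\<exists>w. \<forall>\<^sub>F xs in type_of M (w # us). hd xs = F (tl xs)"
    unfolding eventually_type_of_ex[OF M] by simp
  then show ?thesis using star_value_eqI[OF M] by blast
qed

text \<open>Reduces statements about the elements \<open>\<^sup>*F us\<close> to the type of \<open>us\<close>.  In the joint type of \<open>us\<close>
  and these elements, both tuples are projections, linked by the graphs of the functions.\<close>

lemma eventually_type_of_star_values: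
  assumes M: "transfer_principle M"
  shows "eventually P (type_of M (map (\<lambda>F. star_value M F us) Fs)) \<longleftrightarrow>
    eventually (\<lambda>xs. P (map (\<lambda>F. F xs) Fs)) (type_of M us)"
proof -
  let ?ws = "map (\<lambda>F. star_value M F us) Fs" and ?n = "length us" and ?m = "length Fs"
  let ?us = "us @ ?ws"
  have pw: "?ws = map ((!) ?us) [?n..<?n + ?m]"
    by (rule nth_equalityI) (auto simp: nth_append)
  have pu: "us = map ((!) ?us) [0..<?n]"
    by (rule nth_equalityI) (auto simp: nth_append)
  have bw: "\<forall>j\<in>set [?n..<?n + ?m]. j < length ?us" by auto
  have bu: "\<forall>j\<in>set [0..<?n]. j < length ?us" by auto
  have graph: "\<forall>\<^sub>F zs in type_of M ?us. zs ! (?n + j) = (Fs ! j) (map ((!) zs) [0..<?n])" if j: "j < ?m" for j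
  proof -
    have p: "star_value M (Fs ! j) us # us = map ((!) ?us) ((?n + j) # [0..<?n])"
      using j pu by (simp add: nth_append)
    have b: "\<forall>i\<in>set ((?n + j) # [0..<?n]). i < length ?us" using j by auto
    show ?thesis
      using star_value_graph[OF M, of "Fs ! j" us] unfolding eventually_type_of_project[OF M p b] by simp
  qed
  have "\<forall>\<^sub>F zs in type_of M ?us. \<forall>j\<in>{..<?m}. zs ! (?n + j) = (Fs ! j) (map ((!) zs) [0..<?n])"
    using graph by (intro eventually_ball_finite) auto
  then have eq: "\<forall>\<^sub>F zs in type_of M ?us. map ((!) zs) [?n..<?n + ?m] = map (\<lambda>F. F (map ((!) zs) [0..<?n])) Fs"
    by eventually_elim (rule nth_equalityI, auto)
  have "eventually P (type_of M ?ws) \<longleftrightarrow> eventually (\<lambda>zs. P (map ((!) zs) [?n..<?n + ?m])) (type_of M ?us)"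
    by (rule eventually_type_of_project[OF M pw bw])
  also have "\<dots> \<longleftrightarrow> eventually (\<lambda>zs. P (map (\<lambda>F. F (map ((!) zs) [0..<?n])) Fs)) (type_of M ?us)"
    by (rule eventually_subst) (use eq in \<open>eventually_elim, simp\<close>)
  also have "\<dots> \<longleftrightarrow> eventually (\<lambda>xs. P (map (\<lambda>F. F xs) Fs)) (type_of M us)"
    by (rule eventually_type_of_project[OF M pu bu, symmetric])
  finally show ?thesis .
qed

lemma star_value_eq_iff:
  assumes M: "transfer_principle M"
  shows "star_value M F us = star_value M G us \<longleftrightarrow> (\<forall>\<^sub>F xs in type_of M us. F xs = G xs)"
  using eventually_type_of_eq[OF M, of 0 "[star_value M F us, star_value M G us]" 1]
    eventually_type_of_star_values[OF M, of "\<lambda>xs. xs ! 0 = xs ! 1" us "[F, G]"]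
  by simp

lemma star_value_nth:
  assumes M: "transfer_principle M" and i: "i < length us"
  shows "star_value M (\<lambda>xs. xs ! i) us = us ! i"
proof (rule star_value_eqI[OF M])
  have p: "us ! i # us = map ((!) us) (i # [0..<length us])" by (simp add: map_nth)
  have b: "\<forall>j\<in>set (i # [0..<length us]). j < length us" using i by auto
  show "\<forall>\<^sub>F xs in type_of M (us ! i # us). hd xs = tl xs ! i"
    unfolding eventually_type_of_project[OF M p b] using i by simp
qed

lemma star_value_const:
  assumes M: "transfer_principle M"
  shows "star_value M (\<lambda>xs. c) us = star_of M c"
proof (rule star_value_eqI[OF M])
  let ?n = "length us"
  have "sat (star_rel M) (Rel {xs. hd xs = c} (?n # [0..<?n])) (tuple_env (star_of M c) us)"
    by (rule transfer_valid[OF M]) simp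
  then show "\<forall>\<^sub>F xs in type_of M (star_of M c # us). hd xs = c"
    unfolding eventually_type_of[OF M] by (simp add: map_tuple_env) (simp add: tuple_env_def)
qed

text \<open>Adjoining \<open>u\<close> to the parameters makes it possible to quantify over \<open>u\<close>.\<close>

lemma star_value_weaken:
  assumes M: "transfer_principle M"
  shows "star_value M F us = star_value M (\<lambda>xs. F (tl xs)) (u # us)"
proof (rule star_value_eqI[OF M])
  let ?w = "star_value M (\<lambda>xs. F (tl xs)) (u # us)" and ?n = "length us"
  let ?us = "?w # u # us"
  have p: "?w # us = map ((!) ?us) (0 # map (\<lambda>i. i + 2) [0..<?n])" by (simp add: comp_def map_nth)
  have b: "\<forall>j\<in>set (0 # map (\<lambda>i. i + 2) [0..<?n]). j < length ?us" by auto
  have "\<forall>\<^sub>F xs in type_of M ?us. xs ! 0 = F (map (\<lambda>i. xs ! (i + 2)) [0..<?n])"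
    using star_value_graph[OF M, of "\<lambda>xs. F (tl xs)" "u # us"] eventually_length_type_of[OF M, of ?us]
  proof eventually_elim
    case (elim xs)
    then obtain a b ys where xs: "xs = a # b # ys" "length ys = ?n" by (auto simp: length_Suc_conv)
    have "map (\<lambda>i. xs ! (i + 2)) [0..<?n] = ys" by (rule nth_equalityI) (auto simp: xs)
    then show ?case using elim(1) by (simp add: xs)
  qed
  then show "\<forall>\<^sub>F xs in type_of M (?w # us). hd xs = F (tl xs)"
    unfolding eventually_type_of_project[OF M p b] by (simp add: comp_def)
qed

lemma star_set_star_value:
  assumes M: "transfer_principle M"
  shows "star_value M F us \<in> star_set M A \<longleftrightarrow> (\<forall>\<^sub>F xs in type_of M us. F xs \<in> A)"
  using eventually_type_of_star_values[OF M, of "\<lambda>xs. \<exists>x. xs = [x] \<and> x \<in> A" us "[F]"]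
  by (simp add: star_set_def eventually_type_of[OF M])

lemma star_pred2_star_value:
  assumes M: "transfer_principle M"
  shows "star_pred2 M P (star_value M F us) (star_value M G us) \<longleftrightarrow> (\<forall>\<^sub>F xs in type_of M us. P (F xs) (G xs))"
  using eventually_type_of_star_values[OF M, of "\<lambda>xs. \<exists>x y. xs = [x, y] \<and> P x y" us "[F, G]"]
  by (simp add: star_pred2_def eventually_type_of[OF M])

text \<open>The common form of the nonstandard extensions of functions of one, two and three arguments.\<close>

lemma star_graph_the:
  assumes M: "transfer_principle M"
  shows "(THE w. vs @ [w] \<in> star_rel M {xs @ [G xs] | xs. length xs = length vs}) = star_value M G vs"
proof -
  have "vs @ [w] \<in> star_rel M {xs @ [G xs] | xs. length xs = length vs} \<longleftrightarrow> star_value M G vs = w" for w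
  proof -
    let ?n = "length vs"
    let ?us = "w # vs"
    have p: "vs @ [w] = map ((!) ?us) (map (\<lambda>i. i + 1) [0..<?n] @ [0])"
      by (simp add: comp_def map_nth del: map_Suc_upt upt_Suc)
    have b: "\<forall>j\<in>set (map (\<lambda>i. i + 1) [0..<?n] @ [0]). j < length ?us" by auto
    have "vs @ [w] \<in> star_rel M {xs @ [G xs] | xs. length xs = length vs} \<longleftrightarrow>
      (\<forall>\<^sub>F ys in type_of M (vs @ [w]). \<exists>xs. ys = xs @ [G xs] \<and> length xs = length vs)"
      by (simp add: eventually_type_of[OF M])
    also have "\<dots> \<longleftrightarrow> (\<forall>\<^sub>F ys in type_of M ?us. hd ys = G (tl ys))"
      unfolding eventually_type_of_project[OF M p b]
    proof (rule eventually_subst)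
      show "\<forall>\<^sub>F ys in type_of M ?us. (\<exists>xs. map ((!) ys) (map (\<lambda>i. i + 1) [0..<?n] @ [0]) = xs @ [G xs] \<and> length xs = ?n) =
        (hd ys = G (tl ys))"
        using eventually_length_type_of[OF M, of ?us]
      proof eventually_elim
        case (elim ys)
        then obtain y zs where ys: "ys = y # zs" "length zs = ?n" by (auto simp: length_Suc_conv)
        have "map ((!) ys) (map (\<lambda>i. i + 1) [0..<?n] @ [0]) = zs @ [y]"
          using ys(2) by (simp add: ys(1) comp_def) (metis map_nth)
        then show ?case by (auto simp: ys)
      qed
    qed
    also have "\<dots> \<longleftrightarrow> star_value M G vs = w"
      using star_value_graph[OF M, of G vs] star_value_eqI[OF M] by blast
    finally show ?thesis .
  qed
  then show ?thesis by simp
qed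

lemma star_value_comp:
  assumes M: "transfer_principle M"
  shows "star_value M G (map (\<lambda>F. star_value M F us) Fs) = star_value M (\<lambda>xs. G (map (\<lambda>F. F xs) Fs)) us"
proof (rule star_value_eqI[OF M])
  let ?H = "\<lambda>xs. G (map (\<lambda>F. F xs) Fs)"
  show "\<forall>\<^sub>F xs in type_of M (star_value M ?H us # map (\<lambda>F. star_value M F us) Fs). hd xs = G (tl xs)"
    using eventually_type_of_star_values[OF M, of "\<lambda>xs. hd xs = G (tl xs)" us "?H # Fs"] by simp
qed

lemma star_fun1_star_value:
  assumes M: "transfer_principle M"
  shows "star_fun1 M g (star_value M F us) = star_value M (\<lambda>xs. g (F xs)) us"
proof -
  have "{[x, g x] | x. True} = {xs @ [g (xs ! 0)] | xs. length xs = length [star_value M F us]}"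
    (is "?A = ?B")
  proof (intro set_eqI iffI)
    fix zs assume "zs \<in> ?A"
    then obtain x where "zs = [x] @ [g ([x] ! 0)]" by auto
    then show "zs \<in> ?B" by (intro CollectI exI[of _ "[x]"]) simp
  qed (auto simp: length_Suc_conv)
  then show ?thesis
    using star_graph_the[OF M, of "[star_value M F us]" "\<lambda>xs. g (xs ! 0)"]
      star_value_comp[OF M, of "\<lambda>xs. g (xs ! 0)" us "[F]"]
    by (simp add: star_fun1_def)
qed

lemma star_fun2_star_value:
  assumes M: "transfer_principle M"
  shows "star_fun2 M g (star_value M F us) (star_value M G us) = star_value M (\<lambda>xs. g (F xs) (G xs)) us"
proof -
  have "{[x, y, g x y] | x y. True} = {xs @ [g (xs ! 0) (xs ! 1)] | xs. length xs = length [star_value M F us, star_value M G us]}"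
    (is "?A = ?B")
  proof (intro set_eqI iffI)
    fix zs assume "zs \<in> ?A"
    then obtain x y where "zs = [x, y] @ [g ([x, y] ! 0) ([x, y] ! 1)]" by auto
    then show "zs \<in> ?B" by (intro CollectI exI[of _ "[x, y]"]) simp
  qed (auto simp: length_Suc_conv)
  then show ?thesis
    using star_graph_the[OF M, of "[star_value M F us, star_value M G us]" "\<lambda>xs. g (xs ! 0) (xs ! 1)"]
      star_value_comp[OF M, of "\<lambda>xs. g (xs ! 0) (xs ! 1)" us "[F, G]"]
    by (simp add: star_fun2_def)
qed

lemma star_fun3_star_value:
  assumes M: "transfer_principle M"
  shows "star_fun3 M g (star_value M E us) (star_value M F us) (star_value M G us)
    = star_value M (\<lambda>xs. g (E xs) (F xs) (G xs)) us"
proof -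
  have "{[x, y, z, g x y z] | x y z. True} = {xs @ [g (xs ! 0) (xs ! 1) (xs ! 2)] | xs.
      length xs = length [star_value M E us, star_value M F us, star_value M G us]}"
    (is "?A = ?B")
  proof (intro set_eqI iffI)
    fix zs assume "zs \<in> ?A"
    then obtain x y z where "zs = [x, y, z] @ [g ([x, y, z] ! 0) ([x, y, z] ! 1) ([x, y, z] ! 2)]" by auto
    then show "zs \<in> ?B" by (intro CollectI exI[of _ "[x, y, z]"]) simp
  qed (auto simp: length_Suc_conv)
  then show ?thesis
    using star_graph_the[OF M, of "[star_value M E us, star_value M F us, star_value M G us]"
        "\<lambda>xs. g (xs ! 0) (xs ! 1) (xs ! 2)"]
      star_value_comp[OF M, of "\<lambda>xs. g (xs ! 0) (xs ! 1) (xs ! 2)" us "[E, F, G]"]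
    by (simp add: star_fun3_def)
qed

lemmas star_value_simps = star_set_star_value star_pred2_star_value star_value_eq_iff
  star_fun1_star_value star_fun2_star_value star_fun3_star_value

section \<open>Moderate and negligible nets\<close>

definition infinitesimal_scale :: "'x filter \<Rightarrow> ('x \<Rightarrow> real) \<Rightarrow> bool" where
  "infinitesimal_scale \<F> r \<longleftrightarrow> (\<forall>\<^sub>F x in \<F>. 0 < r x) \<and> (\<forall>\<epsilon>>0. \<forall>\<^sub>F x in \<F>. r x < \<epsilon>)"

text \<open>A net of numbers is treated as a net of functions on the one-point type \<open>unit\<close>, so that numbers
  and functions on compact sets share one set of rules.\<close>

definition moderate_on :: "'x filter \<Rightarrow> ('x \<Rightarrow> real) \<Rightarrow> 'y set \<Rightarrow> ('x \<Rightarrow> 'y \<Rightarrow> complex) \<Rightarrow> bool" where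
  "moderate_on \<F> r K g \<longleftrightarrow> (\<exists>n\<ge>1. \<forall>\<^sub>F x in \<F>. \<forall>y\<in>K. norm (g x y) < inverse (r x ^ n))"

definition negligible_on :: "'x filter \<Rightarrow> ('x \<Rightarrow> real) \<Rightarrow> 'y set \<Rightarrow> ('x \<Rightarrow> 'y \<Rightarrow> complex) \<Rightarrow> bool" where
  "negligible_on \<F> r K g \<longleftrightarrow> (\<forall>n\<ge>1. \<forall>\<^sub>F x in \<F>. \<forall>y\<in>K. norm (g x y) < r x ^ n)"

lemma infinitesimal_scaleD:
  "infinitesimal_scale \<F> r \<Longrightarrow> \<epsilon> > 0 \<Longrightarrow> \<forall>\<^sub>F x in \<F>. 0 < r x \<and> r x < \<epsilon>"
  by (auto simp: infinitesimal_scale_def eventually_conj)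

lemma mult_small_less_one:
  fixes C t :: real
  assumes "0 < t" "t < 1 / (\<bar>C\<bar> + 1)"
  shows "C * t < 1"
proof -
  have "C * t \<le> \<bar>C\<bar> * t" using assms by (intro mult_right_mono) auto
  also have "\<dots> < 1" using assms by (simp add: field_simps)
  finally show ?thesis .
qed

text \<open>One more power of the infinitesimal scale absorbs the constant.\<close>

lemma moderate_onI:
  assumes r: "infinitesimal_scale \<F> r" and e: "\<forall>\<^sub>F x in \<F>. \<forall>y\<in>K. norm (g x y) \<le> C * inverse (r x ^ n)"
  shows "moderate_on \<F> r K g"
proof -
  have pos: "1 / (\<bar>C\<bar> + 1) > 0" by (simp add: add_nonneg_pos)
  have "\<forall>\<^sub>F x in \<F>. \<forall>y\<in>K. norm (g x y) < inverse (r x ^ Suc n)"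
    using infinitesimal_scaleD[OF r pos] e
  proof eventually_elim
    case (elim x)
    have "C * r x < 1" using elim(1) by (intro mult_small_less_one) auto
    then have "C * inverse (r x ^ n) < inverse (r x ^ Suc n)" using elim(1) by (simp add: field_simps)
    then show ?case using elim(2) by (meson le_less_trans)
  qed
  then show ?thesis unfolding moderate_on_def by (intro exI[of _ "Suc n"]) simp
qed

lemma negligible_onI:
  assumes r: "infinitesimal_scale \<F> r"
    and e: "\<And>n. n \<ge> 1 \<Longrightarrow> \<exists>C. \<forall>\<^sub>F x in \<F>. \<forall>y\<in>K. norm (g x y) \<le> C * r x ^ n"
  shows "negligible_on \<F> r K g"
  unfolding negligible_on_def
proof (intro allI impI)
  fix n :: nat
  obtain C where C: "\<forall>\<^sub>F x in \<F>. \<forall>y\<in>K. norm (g x y) \<le> C * r x ^ Suc n" using e[of "Suc n"] by auto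
  have pos: "1 / (\<bar>C\<bar> + 1) > 0" by (simp add: add_nonneg_pos)
  show "\<forall>\<^sub>F x in \<F>. \<forall>y\<in>K. norm (g x y) < r x ^ n"
    using infinitesimal_scaleD[OF r pos] C
  proof eventually_elim
    case (elim x)
    have "C * r x < 1" using elim(1) by (intro mult_small_less_one) auto
    then have "(C * r x) * r x ^ n < 1 * r x ^ n" using elim(1) by (intro mult_strict_right_mono) auto
    then have "C * r x ^ Suc n < r x ^ n" by (simp add: mult_ac)
    then show ?case using elim(2) by (meson le_less_trans)
  qed
qed

text \<open>Stated for every bound \<open>B\<close> of \<open>g\<close> on \<open>K\<close>, domination covers multiples of a function as well as
  its integrals.\<close>

lemma moderate_on_dominated:
  assumes r: "infinitesimal_scale \<F> r" and g: "moderate_on \<F> r K g"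
    and d: "\<forall>\<^sub>F x in \<F>. \<forall>B\<ge>0. (\<forall>z\<in>K. norm (g x z) \<le> B) \<longrightarrow> (\<forall>y\<in>L. norm (h x y) \<le> C * B)"
  shows "moderate_on \<F> r L h"
proof -
  obtain n where n: "\<forall>\<^sub>F x in \<F>. \<forall>y\<in>K. norm (g x y) < inverse (r x ^ n)" using g by (auto simp: moderate_on_def)
  show ?thesis
  proof (rule moderate_onI[OF r])
    show "\<forall>\<^sub>F x in \<F>. \<forall>y\<in>L. norm (h x y) \<le> C * inverse (r x ^ n)"
      using infinitesimal_scaleD[OF r zero_less_one] n d
    proof eventually_elim
      case (elim x)
      then have "0 \<le> inverse (r x ^ n)" "\<forall>z\<in>K. norm (g x z) \<le> inverse (r x ^ n)" by (auto intro: less_imp_le)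
      then show ?case using elim(3) by blast
    qed
  qed
qed

lemma negligible_on_dominated:
  assumes r: "infinitesimal_scale \<F> r" and g: "negligible_on \<F> r K g"
    and d: "\<forall>\<^sub>F x in \<F>. \<forall>B\<ge>0. (\<forall>z\<in>K. norm (g x z) \<le> B) \<longrightarrow> (\<forall>y\<in>L. norm (h x y) \<le> C * B)"
  shows "negligible_on \<F> r L h"
proof (rule negligible_onI[OF r], rule exI[of _ C])
  fix n :: nat assume "n \<ge> 1"
  then have n: "\<forall>\<^sub>F x in \<F>. \<forall>y\<in>K. norm (g x y) < r x ^ n" using g by (auto simp: negligible_on_def)
  show "\<forall>\<^sub>F x in \<F>. \<forall>y\<in>L. norm (h x y) \<le> C * r x ^ n"
    using infinitesimal_scaleD[OF r zero_less_one] n d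
  proof eventually_elim
    case (elim x)
    then have "0 \<le> r x ^ n" "\<forall>z\<in>K. norm (g x z) \<le> r x ^ n" by (auto intro: less_imp_le)
    then show ?case using elim(3) by blast
  qed
qed

lemma moderate_on_add:
  assumes r: "infinitesimal_scale \<F> r" and g: "moderate_on \<F> r K g" and h: "moderate_on \<F> r K h"
  shows "moderate_on \<F> r K (\<lambda>x y. g x y + h x y)"
proof -
  obtain n where n: "\<forall>\<^sub>F x in \<F>. \<forall>y\<in>K. norm (g x y) < inverse (r x ^ n)" using g by (auto simp: moderate_on_def)
  obtain m where m: "\<forall>\<^sub>F x in \<F>. \<forall>y\<in>K. norm (h x y) < inverse (r x ^ m)" using h by (auto simp: moderate_on_def)
  show ?thesis
  proof (rule moderate_onI[OF r])
    show "\<forall>\<^sub>F x in \<F>. \<forall>y\<in>K. norm (g x y + h x y) \<le> 2 * inverse (r x ^ (n + m))"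
      using infinitesimal_scaleD[OF r zero_less_one] n m
    proof eventually_elim
      case (elim x)
      have "inverse (r x ^ n) \<le> inverse (r x ^ (n + m))" "inverse (r x ^ m) \<le> inverse (r x ^ (n + m))"
        using elim(1) by (auto intro!: le_imp_inverse_le power_decreasing)
      moreover have "norm (g x y + h x y) \<le> norm (g x y) + norm (h x y)" for y by (rule norm_triangle_ineq)
      ultimately show ?case using elim(2,3) by (smt (verit, best))
    qed
  qed
qed

lemma negligible_on_add:
  assumes r: "infinitesimal_scale \<F> r" and g: "negligible_on \<F> r K g" and h: "negligible_on \<F> r K h"
  shows "negligible_on \<F> r K (\<lambda>x y. g x y + h x y)"
proof (rule negligible_onI[OF r], rule exI[of _ 2])
  fix n :: nat assume n: "n \<ge> 1"
  have "\<forall>\<^sub>F x in \<F>. \<forall>y\<in>K. norm (g x y) < r x ^ n" "\<forall>\<^sub>F x in \<F>. \<forall>y\<in>K. norm (h x y) < r x ^ n"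
    using g h n by (auto simp: negligible_on_def)
  then show "\<forall>\<^sub>F x in \<F>. \<forall>y\<in>K. norm (g x y + h x y) \<le> 2 * r x ^ n"
    by eventually_elim (smt (verit, best) norm_triangle_ineq)
qed

lemma moderate_on_cong:
  assumes "\<forall>\<^sub>F x in \<F>. \<forall>y\<in>K. g x y = h x y"
  shows "moderate_on \<F> r K g \<longleftrightarrow> moderate_on \<F> r K h"
proof -
  have "(\<forall>\<^sub>F x in \<F>. \<forall>y\<in>K. norm (g x y) < inverse (r x ^ n)) \<longleftrightarrow>
    (\<forall>\<^sub>F x in \<F>. \<forall>y\<in>K. norm (h x y) < inverse (r x ^ n))" for n
    by (rule eventually_subst) (use assms in \<open>eventually_elim, auto\<close>)
  then show ?thesis by (simp add: moderate_on_def)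
qed

lemma negligible_on_cong:
  assumes "\<forall>\<^sub>F x in \<F>. \<forall>y\<in>K. g x y = h x y"
  shows "negligible_on \<F> r K g \<longleftrightarrow> negligible_on \<F> r K h"
proof -
  have "(\<forall>\<^sub>F x in \<F>. \<forall>y\<in>K. norm (g x y) < r x ^ n) \<longleftrightarrow>
    (\<forall>\<^sub>F x in \<F>. \<forall>y\<in>K. norm (h x y) < r x ^ n)" for n
    by (rule eventually_subst) (use assms in \<open>eventually_elim, auto\<close>)
  then show ?thesis by (simp add: negligible_on_def)
qed

lemma moderate_on_cmult:
  assumes "infinitesimal_scale \<F> r" "moderate_on \<F> r K g"
  shows "moderate_on \<F> r K (\<lambda>x y. c * g x y)"
  by (rule moderate_on_dominated[OF assms, where C = "norm c"]) (simp add: norm_mult mult_left_mono)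

lemma negligible_on_cmult:
  assumes "infinitesimal_scale \<F> r" "negligible_on \<F> r K g"
  shows "negligible_on \<F> r K (\<lambda>x y. c * g x y)"
  by (rule negligible_on_dominated[OF assms, where C = "norm c"]) (simp add: norm_mult mult_left_mono)

lemma negligible_on_zero:
  assumes r: "infinitesimal_scale \<F> r"
  shows "negligible_on \<F> r K (\<lambda>x y. 0)"
  unfolding negligible_on_def
proof (intro allI impI)
  fix n :: nat
  show "\<forall>\<^sub>F x in \<F>. \<forall>y\<in>K. norm (0 :: complex) < r x ^ n"
    using infinitesimal_scaleD[OF r zero_less_one] by eventually_elim simp
qed

definition smooth_net :: "'x filter \<Rightarrow> (real^'d) set \<Rightarrow> ('x \<Rightarrow> 'd::finite cfun) \<Rightarrow> bool" where
  "smooth_net \<F> \<Omega> f \<longleftrightarrow> (\<forall>\<^sub>F x in \<F>. f x \<in> smooth_functions \<Omega>)"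

definition moderate_net :: "'x filter \<Rightarrow> ('x \<Rightarrow> real) \<Rightarrow> (real^'d) set \<Rightarrow> ('x \<Rightarrow> 'd::finite cfun) \<Rightarrow> bool" where
  "moderate_net \<F> r \<Omega> f \<longleftrightarrow> smooth_net \<F> \<Omega> f \<and>
     (\<forall>\<alpha> K. compact K \<and> K \<subseteq> \<Omega> \<longrightarrow> moderate_on \<F> r K (\<lambda>x. mderiv \<alpha> (f x)))"

definition negligible_net :: "'x filter \<Rightarrow> ('x \<Rightarrow> real) \<Rightarrow> (real^'d) set \<Rightarrow> ('x \<Rightarrow> 'd::finite cfun) \<Rightarrow> bool" where
  "negligible_net \<F> r \<Omega> f \<longleftrightarrow> smooth_net \<F> \<Omega> f \<and>
     (\<forall>\<alpha> K. compact K \<and> K \<subseteq> \<Omega> \<longrightarrow> negligible_on \<F> r K (\<lambda>x. mderiv \<alpha> (f x)))"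

lemma mderiv_add: "open S \<Longrightarrow> f \<in> smooth_functions S \<Longrightarrow> g \<in> smooth_functions S \<Longrightarrow> y \<in> S \<Longrightarrow>
    mderiv \<alpha> (\<lambda>x. f x + g x) y = mderiv \<alpha> f y + mderiv \<alpha> g y"
  by (simp add: mderiv_def partial_derivs_add)

lemma mderiv_cmult: "open S \<Longrightarrow> f \<in> smooth_functions S \<Longrightarrow> y \<in> S \<Longrightarrow>
    mderiv \<alpha> (\<lambda>x. c * f x) y = c * mderiv \<alpha> f y"
  by (simp add: mderiv_def partial_derivs_cmult)

lemma smooth_net_add:
  assumes "open \<Omega>" "smooth_net \<F> \<Omega> f" "smooth_net \<F> \<Omega> g"
  shows "smooth_net \<F> \<Omega> (\<lambda>x y. f x y + g x y)"
  using assms(2,3) unfolding smooth_net_def by eventually_elim (rule smooth_add[OF assms(1)])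

lemma smooth_net_cmult:
  assumes "open \<Omega>" "smooth_net \<F> \<Omega> f"
  shows "smooth_net \<F> \<Omega> (\<lambda>x y. c * f x y)"
  using assms(2) unfolding smooth_net_def by eventually_elim (rule smooth_cmult[OF assms(1)])

lemma smooth_net_mderiv:
  assumes "smooth_net \<F> \<Omega> f"
  shows "smooth_net \<F> \<Omega> (\<lambda>x. mderiv \<alpha> (f x))"
  using assms unfolding smooth_net_def by eventually_elim (rule smooth_mderiv)

lemma eventually_mderiv_add:
  assumes \<Omega>: "open \<Omega>" and "smooth_net \<F> \<Omega> f" "smooth_net \<F> \<Omega> g" and K: "K \<subseteq> \<Omega>"
  shows "\<forall>\<^sub>F x in \<F>. \<forall>y\<in>K. mderiv \<alpha> (\<lambda>y. f x y + g x y) y = mderiv \<alpha> (f x) y + mderiv \<alpha> (g x) y"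
  using assms(2,3) unfolding smooth_net_def by eventually_elim (use K in \<open>auto simp: mderiv_add[OF \<Omega>]\<close>)

lemma eventually_mderiv_cmult:
  assumes \<Omega>: "open \<Omega>" and "smooth_net \<F> \<Omega> f" and K: "K \<subseteq> \<Omega>"
  shows "\<forall>\<^sub>F x in \<F>. \<forall>y\<in>K. mderiv \<alpha> (\<lambda>y. c * f x y) y = c * mderiv \<alpha> (f x) y"
  using assms(2) unfolding smooth_net_def by eventually_elim (use K in \<open>auto simp: mderiv_cmult[OF \<Omega>]\<close>)

lemma eventually_mderiv_mderiv:
  assumes \<Omega>: "open \<Omega>" and "smooth_net \<F> \<Omega> f" and K: "K \<subseteq> \<Omega>"
  shows "\<forall>\<^sub>F x in \<F>. \<forall>y\<in>K. mderiv \<beta> (mderiv \<alpha> (f x)) y = mderiv (\<lambda>i. \<beta> i + \<alpha> i) (f x) y"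
  using assms(2) unfolding smooth_net_def by eventually_elim (use K in \<open>auto simp: mderiv_mderiv[OF \<Omega>]\<close>)

lemma mderiv_zero: "mderiv \<alpha> (\<lambda>x. 0) = (\<lambda>x. 0)"
  by (simp add: mderiv_def partial_derivs_zero)

lemma mderiv_0: "mderiv (\<lambda>i :: 'd::finite. 0) f = f"
proof -
  obtain "is" :: "'d list" where i: "length is = msize (\<lambda>i :: 'd. 0)"
      "\<And>f. mderiv (\<lambda>i. 0) f = partial_derivs is f"
    using mderiv_as_list[of "\<lambda>i :: 'd. 0"] by metis
  then show ?thesis by (simp add: msize_def)
qed

lemma set_integrable_smooth_mult_test:
  assumes \<Omega>: "open \<Omega>" and f: "f \<in> smooth_functions \<Omega>" and \<phi>: "\<phi> \<in> test_functions \<Omega>"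
  shows "set_integrable lebesgue \<Omega> (\<lambda>x. f x * \<phi> x)"
    and "(LINT x:\<Omega>|lebesgue. f x * \<phi> x) = (LINT x|lebesgue. \<phi> x * f x)"
    and "integrable lebesgue (\<lambda>x. \<phi> x * f x)"
proof -
  note t = test_mult_smooth[OF \<Omega> \<phi> f]
  show int: "integrable lebesgue (\<lambda>x. \<phi> x * f x)" using integrable_test_mult[OF t, of "\<lambda>x. 1"] by simp
  have eq: "indicator \<Omega> x *\<^sub>R (f x * \<phi> x) = \<phi> x * f x" for x
    using zero_outside_supp[of x \<phi>] test_supp_subset[OF \<phi>] by (auto simp: indicator_def)
  show "set_integrable lebesgue \<Omega> (\<lambda>x. f x * \<phi> x)" using int by (simp only: set_integrable_def eq)
  show "(LINT x:\<Omega>|lebesgue. f x * \<phi> x) = (LINT x|lebesgue. \<phi> x * f x)" by (simp only: set_lebesgue_integral_def eq)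
qed

lemma norm_pairing_le:
  assumes \<Omega>: "open \<Omega>" and f: "f \<in> smooth_functions \<Omega>" and \<phi>: "\<phi> \<in> test_functions \<Omega>"
    and B: "\<And>x. x \<in> supp \<phi> \<Longrightarrow> norm (f x) \<le> B"
  shows "norm (LINT x:\<Omega>|lebesgue. f x * \<phi> x) \<le> (LINT x|lebesgue. norm (\<phi> x)) * B"
proof -
  have "norm (LINT x|lebesgue. \<phi> x * f x) \<le> (LINT x|lebesgue. norm (\<phi> x) * B)"
  proof (rule Bochner_Integration.integral_norm_bound_integral)
    show "integrable lebesgue (\<lambda>x. \<phi> x * f x)" by (rule set_integrable_smooth_mult_test(3)[OF \<Omega> f \<phi>])
    show "integrable lebesgue (\<lambda>x. norm (\<phi> x) * B)" by (intro integrable_mult_left integrable_norm_test[OF \<phi>])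
    show "norm (\<phi> x * f x) \<le> norm (\<phi> x) * B" for x
      using B[of x] zero_outside_supp[of x \<phi>] by (cases "x \<in> supp \<phi>") (auto simp: norm_mult intro!: mult_left_mono)
  qed
  then show ?thesis by (simp add: set_integrable_smooth_mult_test(2)[OF \<Omega> f \<phi>])
qed

lemma pairing_diff:
  assumes \<Omega>: "open \<Omega>" and "f \<in> smooth_functions \<Omega>" "g \<in> smooth_functions \<Omega>" "\<phi> \<in> test_functions \<Omega>"
  shows "(LINT y:\<Omega>|lebesgue. (f y - g y) * \<phi> y)
    = (LINT y:\<Omega>|lebesgue. f y * \<phi> y) - (LINT y:\<Omega>|lebesgue. g y * \<phi> y)"
  using set_integral_diff(2)[OF set_integrable_smooth_mult_test(1)[OF \<Omega> assms(2,4)]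
      set_integrable_smooth_mult_test(1)[OF \<Omega> assms(3,4)]]
  by (simp add: left_diff_distrib)

context
  fixes \<F> :: "'x filter" and r :: "'x \<Rightarrow> real" and \<Omega> :: "(real^'d::finite) set"
  assumes r: "infinitesimal_scale \<F> r" and \<Omega>: "open \<Omega>"
begin

lemma moderate_net_add:
  assumes "moderate_net \<F> r \<Omega> f" "moderate_net \<F> r \<Omega> g"
  shows "moderate_net \<F> r \<Omega> (\<lambda>x y. f x y + g x y)"
  using assms moderate_on_cong[OF eventually_mderiv_add[OF \<Omega>, of \<F> f g]]
  by (auto simp: moderate_net_def smooth_net_add[OF \<Omega>] intro!: moderate_on_add[OF r])

lemma moderate_net_cmult:
  assumes "moderate_net \<F> r \<Omega> f"
  shows "moderate_net \<F> r \<Omega> (\<lambda>x y. c * f x y)"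
  using assms moderate_on_cong[OF eventually_mderiv_cmult[OF \<Omega>, of \<F> f]]
  by (auto simp: moderate_net_def smooth_net_cmult[OF \<Omega>] intro!: moderate_on_cmult[OF r])

lemma moderate_net_mderiv:
  assumes "moderate_net \<F> r \<Omega> f"
  shows "moderate_net \<F> r \<Omega> (\<lambda>x. mderiv \<alpha> (f x))"
  using assms moderate_on_cong[OF eventually_mderiv_mderiv[OF \<Omega>, of \<F> f]]
  by (auto simp: moderate_net_def smooth_net_mderiv)

lemma negligible_net_add:
  assumes "negligible_net \<F> r \<Omega> f" "negligible_net \<F> r \<Omega> g"
  shows "negligible_net \<F> r \<Omega> (\<lambda>x y. f x y + g x y)"
  using assms negligible_on_cong[OF eventually_mderiv_add[OF \<Omega>, of \<F> f g]]
  by (auto simp: negligible_net_def smooth_net_add[OF \<Omega>] intro!: negligible_on_add[OF r])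

lemma negligible_net_cmult:
  assumes "negligible_net \<F> r \<Omega> f"
  shows "negligible_net \<F> r \<Omega> (\<lambda>x y. c * f x y)"
  using assms negligible_on_cong[OF eventually_mderiv_cmult[OF \<Omega>, of \<F> f]]
  by (auto simp: negligible_net_def smooth_net_cmult[OF \<Omega>] intro!: negligible_on_cmult[OF r])

lemma negligible_net_mderiv:
  assumes "negligible_net \<F> r \<Omega> f"
  shows "negligible_net \<F> r \<Omega> (\<lambda>x. mderiv \<alpha> (f x))"
  using assms negligible_on_cong[OF eventually_mderiv_mderiv[OF \<Omega>, of \<F> f]]
  by (auto simp: negligible_net_def smooth_net_mderiv)

lemma negligible_net_zero: "negligible_net \<F> r \<Omega> (\<lambda>x y. 0)"
  by (auto simp: negligible_net_def smooth_net_def smooth_zero mderiv_zero negligible_on_zero[OF r])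

lemma negligible_net_cong:
  assumes "\<forall>\<^sub>F x in \<F>. \<forall>y\<in>\<Omega>. f x y = g x y" "negligible_net \<F> r \<Omega> f"
  shows "negligible_net \<F> r \<Omega> g"
proof -
  have "smooth_net \<F> \<Omega> g"
    using assms(1) assms(2)[unfolded negligible_net_def smooth_net_def, THEN conjunct1] unfolding smooth_net_def
    by eventually_elim (rule smooth_cong[OF \<Omega>], auto)
  moreover have "negligible_on \<F> r K (\<lambda>x. mderiv \<alpha> (g x))" if K: "compact K \<and> K \<subseteq> \<Omega>" for \<alpha> K
  proof -
    have "\<forall>\<^sub>F x in \<F>. \<forall>y\<in>K. mderiv \<alpha> (f x) y = mderiv \<alpha> (g x) y"
      using assms(1) by eventually_elim (use K in \<open>auto intro!: mderiv_cong[OF \<Omega>]\<close>)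
    then show ?thesis
      using negligible_on_cong[of K "\<lambda>x. mderiv \<alpha> (f x)" "\<lambda>x. mderiv \<alpha> (g x)" \<F> r] assms(2) K
      by (simp add: negligible_net_def)
  qed
  ultimately show ?thesis unfolding negligible_net_def by blast
qed

text \<open>Pairing with a test function only sees the values on its compact support.\<close>

lemma eventually_norm_pairing_le:
  assumes f: "smooth_net \<F> \<Omega> f" and \<phi>: "\<phi> \<in> test_functions \<Omega>"
  shows "\<forall>\<^sub>F x in \<F>. \<forall>B\<ge>0. (\<forall>z\<in>supp \<phi>. norm (mderiv (\<lambda>i. 0) (f x) z) \<le> B) \<longrightarrow>
    (\<forall>y\<in>UNIV. norm (LINT y:\<Omega>|lebesgue. f x y * \<phi> y) \<le> (LINT x|lebesgue. norm (\<phi> x)) * B)"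
  using f unfolding smooth_net_def
  by eventually_elim (auto simp: mderiv_0 intro!: norm_pairing_le[OF \<Omega> _ \<phi>])

lemma moderate_pairing:
  assumes f: "moderate_net \<F> r \<Omega> f" and \<phi>: "\<phi> \<in> test_functions \<Omega>"
  shows "moderate_on \<F> r (UNIV :: unit set) (\<lambda>x _. LINT y:\<Omega>|lebesgue. f x y * \<phi> y)"
  by (rule moderate_on_dominated[OF r _ eventually_norm_pairing_le[OF _ \<phi>]])
     (use f test_compact_supp[OF \<phi>] test_supp_subset[OF \<phi>] in \<open>auto simp: moderate_net_def\<close>)

lemma negligible_pairing:
  assumes f: "negligible_net \<F> r \<Omega> f" and \<phi>: "\<phi> \<in> test_functions \<Omega>"
  shows "negligible_on \<F> r (UNIV :: unit set) (\<lambda>x _. LINT y:\<Omega>|lebesgue. f x y * \<phi> y)"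
  by (rule negligible_on_dominated[OF r _ eventually_norm_pairing_le[OF _ \<phi>]])
     (use f test_compact_supp[OF \<phi>] test_supp_subset[OF \<phi>] in \<open>auto simp: negligible_net_def\<close>)

end

section \<open>Nearstandard points and moderate internal functions\<close>

abbreviation scale_of :: "('x \<Rightarrow> 'd::finite obj) \<Rightarrow> 'x \<Rightarrow> real" where
  "scale_of R x \<equiv> Re (cpx_of (R x))"

lemma mem_Fn_image: "u \<in> Fn ` S \<longleftrightarrow> u \<in> range Fn \<and> fn_of u \<in> S"
  by (auto simp: image_iff)

lemma star_value_hd:
  assumes M: "transfer_principle M"
  shows "star_value M hd (u # us) = u"
proof -
  have "star_value M hd (u # us) = star_value M (\<lambda>xs. xs ! 0) (u # us)"
    unfolding star_value_eq_iff[OF M] using eventually_length_type_of[OF M, of "u # us"]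
    by eventually_elim (auto simp: length_Suc_conv)
  then show ?thesis by (simp add: star_value_nth[OF M])
qed

lemma eventually_type_of_tl:
  assumes M: "transfer_principle M"
  shows "eventually (\<lambda>xs. P (tl xs)) (type_of M (u # us)) \<longleftrightarrow> eventually P (type_of M us)"
proof -
  have 1: "eventually (\<lambda>xs. Q (tl xs)) (type_of M (u # us))" if "eventually Q (type_of M us)" for Q
    using eventually_type_of_all[OF M, of "\<lambda>xs. Q (tl xs)" us] that by simp
  then show ?thesis
    using eventually_type_of_not[OF M] by blast
qed

definition value_at ::
    "('d::finite, 'u) model \<Rightarrow> ('d obj list \<Rightarrow> 'd cfun) \<Rightarrow> 'u \<Rightarrow> 'u list \<Rightarrow> 'u" where
  "value_at M g \<xi> us = star_value M (\<lambda>zs. Cpx (g (tl zs) (pt_of (hd zs)))) (\<xi> # us)"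

context
  fixes M :: "('d::finite, 'u) model"
  assumes M: "transfer_principle M"
begin

lemma star_of_value: "star_of M c = star_value M (\<lambda>_. c) us"
  by (simp add: star_value_const[OF M])

lemma moderate_numbers_star_value:
  "star_value M c us \<in> moderate_numbers M (star_value M R us) \<longleftrightarrow>
    (\<forall>\<^sub>F xs in type_of M us. c xs \<in> range Cpx) \<and>
    moderate_on (type_of M us) (scale_of R) (UNIV :: unit set) (\<lambda>xs _. cpx_of (c xs))"
  by (simp add: moderate_numbers_def star_Cpx_def star_value_simps[OF M] moderate_on_def)

lemma negligible_numbers_star_value:
  "star_value M c us \<in> negligible_numbers M (star_value M R us) \<longleftrightarrow>
    (\<forall>\<^sub>F xs in type_of M us. c xs \<in> range Cpx) \<and>
    negligible_on (type_of M us) (scale_of R) (UNIV :: unit set) (\<lambda>xs _. cpx_of (c xs))"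
  by (simp add: negligible_numbers_def star_Cpx_def star_value_simps[OF M] negligible_on_def)

lemma infinitesimal_scale_star_value:
  assumes "positive_infinitesimal M (star_value M R us)"
  shows "infinitesimal_scale (type_of M us) (scale_of R)"
proof -
  have "\<forall>\<^sub>F xs in type_of M us. R xs \<in> {Cpx (of_real r) |r. 0 < r}"
    and small: "\<forall>\<^sub>F xs in type_of M us. dist (cpx_of (R xs)) 0 < \<epsilon>" if "\<epsilon> > 0" for \<epsilon>
    using assms that
    by (simp_all add: positive_infinitesimal_def cpx_approx_def star_of_value[of "Cpx 0" us] star_value_simps[OF M])
  from this(1)[OF zero_less_one] have pos: "\<forall>\<^sub>F xs in type_of M us. 0 < scale_of R xs"
    by eventually_elim auto
  moreover have "\<forall>\<^sub>F xs in type_of M us. scale_of R xs < \<epsilon>" if "\<epsilon> > 0" for \<epsilon>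
    using small[OF that]
  proof eventually_elim
    case (elim xs)
    then show ?case using abs_Re_le_cmod[of "cpx_of (R xs)"] by simp
  qed
  ultimately show ?thesis by (simp add: infinitesimal_scale_def)
qed

lemma star_points_star_value:
  "star_value M F us \<in> star_points M X \<longleftrightarrow> (\<forall>\<^sub>F xs in type_of M us. F xs \<in> Pt ` X)"
  by (simp add: star_points_def star_value_simps[OF M])

lemma pt_approx_unique:
  assumes "pt_approx M \<xi> (star_of M (Pt x))" "pt_approx M \<xi> (star_of M (Pt y))"
  shows "x = y"
proof (rule ccontr)
  assume "x \<noteq> y"
  then have e: "dist x y / 2 > 0" by simp
  define us where "us = [\<xi>]"
  have \<xi>: "\<xi> = star_value M hd us" by (simp add: us_def star_value_hd[OF M])
  have "\<forall>\<epsilon>>0. \<forall>\<^sub>F xs in type_of M us. dist (pt_of (hd xs)) x < \<epsilon>"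
    "\<forall>\<epsilon>>0. \<forall>\<^sub>F xs in type_of M us. dist (pt_of (hd xs)) y < \<epsilon>"
    using assms
    by (simp_all add: pt_approx_def \<xi> star_of_value[of "Pt x" us] star_of_value[of "Pt y" us] star_value_simps[OF M])
  from this(1)[rule_format, OF e] this(2)[rule_format, OF e]
  have "\<forall>\<^sub>F xs in type_of M us. False"
    by eventually_elim (metis dist_commute dist_triangle_half_l order_less_irrefl)
  then show False using type_of_neq_bot[OF M, of us] by simp
qed

lemma standard_part_eqI: "pt_approx M \<xi> (star_of M (Pt x)) \<Longrightarrow> standard_part M \<xi> = x"
  unfolding standard_part_def using pt_approx_unique by blast

text \<open>By compactness, the image of the type of \<open>\<xi>\<close> accumulates at some \<open>k \<in> K\<close>; since the type is an
  ultrafilter, it converges to \<open>k\<close>.\<close>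

lemma star_points_compact_standard_part:
  assumes K: "compact K" and \<xi>K: "\<xi> \<in> star_points M K"
  obtains k where "k \<in> K" "pt_approx M \<xi> (star_of M (Pt k))"
proof -
  define us where "us = [\<xi>]"
  have \<xi>: "\<xi> = star_value M hd us" by (simp add: us_def star_value_hd[OF M])
  let ?F = "filtermap (\<lambda>xs. pt_of (hd xs)) (type_of M us)"
  have "\<forall>\<^sub>F xs in type_of M us. hd xs \<in> Pt ` K" using \<xi>K by (simp add: \<xi> star_points_star_value)
  then have "\<forall>\<^sub>F y in ?F. y \<in> K" unfolding eventually_filtermap by eventually_elim auto
  moreover have "?F \<noteq> bot" using type_of_neq_bot[OF M, of us] by (simp add: filtermap_bot_iff)
  ultimately obtain k where k: "k \<in> K" "inf (nhds k) ?F \<noteq> bot"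
    using K unfolding compact_filter by blast
  have "\<forall>\<^sub>F xs in type_of M us. dist (pt_of (hd xs)) k < \<epsilon>" if e: "\<epsilon> > 0" for \<epsilon>
  proof (rule ccontr)
    assume "\<not> ?thesis"
    then have "\<forall>\<^sub>F y in ?F. \<not> dist y k < \<epsilon>"
      by (simp add: eventually_filtermap eventually_type_of_not[OF M])
    moreover have "\<forall>\<^sub>F y in nhds k. dist y k < \<epsilon>" using e by (auto simp: eventually_nhds_metric)
    ultimately have "\<forall>\<^sub>F y in inf (nhds k) ?F. False"
      unfolding eventually_inf by blast
    then show False using k(2) by simp
  qed
  then have "pt_approx M \<xi> (star_of M (Pt k))"
    by (simp add: pt_approx_def \<xi> star_of_value[of "Pt k" us] star_value_simps[OF M])
  then show ?thesis using that k(1) by blast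
qed

lemma star_points_mono:
  assumes "X \<subseteq> Y" "\<xi> \<in> star_points M X" shows "\<xi> \<in> star_points M Y"
proof -
  define us where "us = [\<xi>]"
  have \<xi>: "\<xi> = star_value M hd us" by (simp add: us_def star_value_hd[OF M])
  have "\<forall>\<^sub>F xs in type_of M us. hd xs \<in> Pt ` X" using assms(2) by (simp add: \<xi> star_points_star_value)
  then show ?thesis unfolding \<xi> star_points_star_value by eventually_elim (use assms(1) in auto)
qed

text \<open>One direction takes \<open>K\<close> to be a closed ball around the standard part; the other is the existence
  of standard parts in compact sets.\<close>

lemma nearstandard_iff:
  assumes \<Omega>: "open \<Omega>"
  shows "\<xi> \<in> nearstandard M \<Omega> \<longleftrightarrow> (\<exists>K. compact K \<and> K \<subseteq> \<Omega> \<and> \<xi> \<in> star_points M K)"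
proof
  assume "\<exists>K. compact K \<and> K \<subseteq> \<Omega> \<and> \<xi> \<in> star_points M K"
  then obtain K where K: "compact K" "K \<subseteq> \<Omega>" "\<xi> \<in> star_points M K" by blast
  obtain k where k: "k \<in> K" "pt_approx M \<xi> (star_of M (Pt k))"
    using star_points_compact_standard_part[OF K(1,3)] by blast
  obtain B where "\<forall>x\<in>K. norm x < B"
    using compact_imp_bounded[OF K(1)] unfolding bounded_pos_less by blast
  then have "K \<subseteq> {x. norm x < B}" by auto
  then have "finite_pt M \<xi>" unfolding finite_pt_def using star_points_mono K(3) by blast
  then show "\<xi> \<in> nearstandard M \<Omega>"
    using standard_part_eqI[OF k(2)] k(1) K(2) star_points_mono[OF K(2,3)] by (auto simp: nearstandard_def)
next
  assume "\<xi> \<in> nearstandard M \<Omega>"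
  then obtain s where s: "\<xi> \<in> star_points M {x. norm x < s}" and \<xi>\<Omega>: "\<xi> \<in> star_points M \<Omega>" "standard_part M \<xi> \<in> \<Omega>"
    by (auto simp: nearstandard_def finite_pt_def)
  have "{x. norm x < s} \<subseteq> cball 0 s" by auto
  then obtain k where k: "pt_approx M \<xi> (star_of M (Pt k))"
    using star_points_compact_standard_part[OF compact_cball star_points_mono[OF _ s]] by blast
  then have "k \<in> \<Omega>" using standard_part_eqI[OF k] \<xi>\<Omega>(2) by simp
  then obtain e where e: "e > 0" "cball k e \<subseteq> \<Omega>" using \<Omega> open_contains_cball by blast
  define us where "us = [\<xi>]"
  have \<xi>: "\<xi> = star_value M hd us" by (simp add: us_def star_value_hd[OF M])
  have "\<forall>\<^sub>F xs in type_of M us. dist (pt_of (hd xs)) k < e"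
    using k e(1) by (simp add: pt_approx_def \<xi> star_of_value[of "Pt k" us] star_value_simps[OF M])
  moreover have "\<forall>\<^sub>F xs in type_of M us. hd xs \<in> Pt ` \<Omega>" using \<xi>\<Omega>(1) by (simp add: \<xi> star_points_star_value)
  ultimately have "\<forall>\<^sub>F xs in type_of M us. hd xs \<in> Pt ` cball k e"
    by eventually_elim (auto simp: dist_commute)
  then have "\<xi> \<in> star_points M (cball k e)" by (simp add: \<xi> star_points_star_value)
  then show "\<exists>K. compact K \<and> K \<subseteq> \<Omega> \<and> \<xi> \<in> star_points M K" using e(2) compact_cball by blast
qed

lemma all_star_points_iff:
  "(\<forall>\<xi>\<in>star_points M K. \<forall>\<^sub>F zs in type_of M (\<xi> # us). Q (tl zs) (pt_of (hd zs))) \<longleftrightarrow>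
    (\<forall>\<^sub>F xs in type_of M us. \<forall>y\<in>K. Q xs y)"
proof -
  have mem: "\<xi> \<in> star_points M K \<longleftrightarrow> (\<forall>\<^sub>F zs in type_of M (\<xi> # us). hd zs \<in> Pt ` K)" for \<xi>
    using star_points_star_value[of hd "\<xi> # us" K] by (simp add: star_value_hd[OF M])
  have "(\<forall>\<xi>\<in>star_points M K. \<forall>\<^sub>F zs in type_of M (\<xi> # us). Q (tl zs) (pt_of (hd zs))) \<longleftrightarrow>
    (\<forall>\<xi>. \<forall>\<^sub>F zs in type_of M (\<xi> # us). hd zs \<in> Pt ` K \<longrightarrow> Q (tl zs) (pt_of (hd zs)))"
  proof (intro iffI allI ballI)
    fix \<xi> assume *: "\<forall>\<xi>\<in>star_points M K. \<forall>\<^sub>F zs in type_of M (\<xi> # us). Q (tl zs) (pt_of (hd zs))"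
    show "\<forall>\<^sub>F zs in type_of M (\<xi> # us). hd zs \<in> Pt ` K \<longrightarrow> Q (tl zs) (pt_of (hd zs))"
    proof (cases "\<xi> \<in> star_points M K")
      case True
      show ?thesis using *[rule_format, OF True] by eventually_elim simp
    next
      case False
      then have "\<forall>\<^sub>F zs in type_of M (\<xi> # us). hd zs \<notin> Pt ` K"
        unfolding mem eventually_type_of_not[OF M] .
      then show ?thesis by eventually_elim simp
    qed
  next
    fix \<xi> assume *: "\<forall>\<xi>. \<forall>\<^sub>F zs in type_of M (\<xi> # us). hd zs \<in> Pt ` K \<longrightarrow> Q (tl zs) (pt_of (hd zs))"
      and "\<xi> \<in> star_points M K"
    then have "\<forall>\<^sub>F zs in type_of M (\<xi> # us). hd zs \<in> Pt ` K" by (simp add: mem)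
    then show "\<forall>\<^sub>F zs in type_of M (\<xi> # us). Q (tl zs) (pt_of (hd zs))"
      using *[rule_format, of \<xi>] by eventually_elim simp
  qed
  also have "\<dots> \<longleftrightarrow> (\<forall>\<^sub>F xs in type_of M us. \<forall>x. x \<in> Pt ` K \<longrightarrow> Q xs (pt_of x))"
    unfolding eventually_type_of_all[OF M] by simp
  also have "(\<lambda>xs. \<forall>x. x \<in> Pt ` K \<longrightarrow> Q xs (pt_of x)) = (\<lambda>xs. \<forall>y\<in>K. Q xs y)"
  proof
    fix xs
    have "(\<forall>x\<in>Pt ` K. Q xs (pt_of x)) \<longleftrightarrow> (\<forall>y\<in>K. Q xs y)" by simp
    then show "(\<forall>x. x \<in> Pt ` K \<longrightarrow> Q xs (pt_of x)) \<longleftrightarrow> (\<forall>y\<in>K. Q xs y)" by (simp only: Ball_def)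
  qed
  finally show ?thesis .
qed

lemma apply_star_mderiv:
  "apply_fn M (star_mderiv M \<alpha> (star_value M f us)) \<xi> = value_at M (\<lambda>xs. mderiv \<alpha> (fn_of (f xs))) \<xi> us"
proof -
  have "apply_fn M (star_mderiv M \<alpha> (star_value M f us)) \<xi>
    = apply_fn M (star_mderiv M \<alpha> (star_value M (\<lambda>zs. f (tl zs)) (\<xi> # us))) (star_value M hd (\<xi> # us))"
    by (simp add: star_value_hd[OF M] star_value_weaken[OF M, of f us \<xi>])
  then show ?thesis
    by (simp add: apply_fn_def star_mderiv_def star_value_simps[OF M] value_at_def)
qed

lemma value_at_negligible_iff:
  "(\<forall>\<xi>\<in>star_points M K. value_at M g \<xi> us \<in> negligible_numbers M (star_value M R us)) \<longleftrightarrow>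
    negligible_on (type_of M us) (scale_of R) K g"
proof -
  have "value_at M g \<xi> us \<in> negligible_numbers M (star_value M R us) \<longleftrightarrow>
    (\<forall>n\<ge>1. \<forall>\<^sub>F zs in type_of M (\<xi> # us). norm (g (tl zs) (pt_of (hd zs))) < scale_of R (tl zs) ^ n)" for \<xi>
    unfolding value_at_def star_value_weaken[OF M, of R us \<xi>] negligible_numbers_star_value
    by (simp add: negligible_on_def)
  then show ?thesis
    using all_star_points_iff[where K = K and us = us and Q = "\<lambda>xs y. norm (g xs y) < scale_of R xs ^ n" for n]
    unfolding negligible_on_def by blast
qed

lemma value_at_moderate_iff:
  "value_at M g \<xi> us \<in> moderate_numbers M (star_value M R us) \<longleftrightarrow>
    (\<exists>n\<ge>1. \<forall>\<^sub>F zs in type_of M (\<xi> # us). norm (g (tl zs) (pt_of (hd zs))) < inverse (scale_of R (tl zs) ^ n))"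
  unfolding value_at_def star_value_weaken[OF M, of R us \<xi>] moderate_numbers_star_value
  by (simp add: moderate_on_def)

text \<open>Moderateness at each point provides an exponent that depends on the point.  The exponent that
  belongs to a point of \<open>\<^sup>*K\<close> where \<open>g\<close> is largest is good for all of \<open>\<^sup>*K\<close>.\<close>

lemma all_value_at_moderate_iff:
  assumes K: "compact K" and cont: "\<forall>\<^sub>F xs in type_of M us. continuous_on K (g xs)"
  shows "(\<forall>\<xi>\<in>star_points M K. value_at M g \<xi> us \<in> moderate_numbers M (star_value M R us)) \<longleftrightarrow>
    moderate_on (type_of M us) (scale_of R) K g"
proof
  assume "moderate_on (type_of M us) (scale_of R) K g"
  then obtain n where n: "n \<ge> 1" "\<forall>\<^sub>F xs in type_of M us. \<forall>y\<in>K. norm (g xs y) < inverse (scale_of R xs ^ n)"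
    by (auto simp: moderate_on_def)
  from n(2)[folded all_star_points_iff]
  show "\<forall>\<xi>\<in>star_points M K. value_at M g \<xi> us \<in> moderate_numbers M (star_value M R us)"
    unfolding value_at_moderate_iff using n(1) by blast
next
  assume mod: "\<forall>\<xi>\<in>star_points M K. value_at M g \<xi> us \<in> moderate_numbers M (star_value M R us)"
  show "moderate_on (type_of M us) (scale_of R) K g"
  proof (cases "K = {}")
    case True
    then show ?thesis by (auto simp: moderate_on_def)
  next
    case False
    define a where "a xs = (SOME y. y \<in> K \<and> (\<forall>z\<in>K. norm (g xs z) \<le> norm (g xs y)))" for xs
    have a: "a xs \<in> K \<and> (\<forall>z\<in>K. norm (g xs z) \<le> norm (g xs (a xs)))" if "continuous_on K (g xs)" for xs
    proof -
      have "\<exists>y\<in>K. \<forall>z\<in>K. norm (g xs z) \<le> norm (g xs y)"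
        by (rule continuous_attains_sup[OF K False]) (intro continuous_intros that)
      then have "\<exists>y. y \<in> K \<and> (\<forall>z\<in>K. norm (g xs z) \<le> norm (g xs y))" by blast
      then show ?thesis unfolding a_def by (rule someI_ex)
    qed
    define \<xi> where "\<xi> = star_value M (\<lambda>xs. Pt (a xs)) us"
    have "\<xi> \<in> star_points M K"
      unfolding \<xi>_def star_points_star_value using cont by eventually_elim (use a in auto)
    then obtain n where n: "n \<ge> 1" "\<forall>\<^sub>F zs in type_of M (\<xi> # us). norm (g (tl zs) (pt_of (hd zs))) < inverse (scale_of R (tl zs) ^ n)"
      using mod unfolding value_at_moderate_iff by blast
    have "\<forall>\<^sub>F zs in type_of M (\<xi> # us). hd zs = Pt (a (tl zs))"
      unfolding \<xi>_def by (rule star_value_graph[OF M])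
    with n(2) have "\<forall>\<^sub>F zs in type_of M (\<xi> # us). norm (g (tl zs) (a (tl zs))) < inverse (scale_of R (tl zs) ^ n)"
      by eventually_elim simp
    then have "\<forall>\<^sub>F xs in type_of M us. norm (g xs (a xs)) < inverse (scale_of R xs ^ n)"
      using eventually_type_of_tl[OF M, of "\<lambda>xs. norm (g xs (a xs)) < inverse (scale_of R xs ^ n)" \<xi> us] by simp
    with cont have "\<forall>\<^sub>F xs in type_of M us. \<forall>y\<in>K. norm (g xs y) < inverse (scale_of R xs ^ n)"
      by eventually_elim (use a in \<open>meson le_less_trans\<close>)
    then show ?thesis using n(1) by (auto simp: moderate_on_def)
  qed
qed

lemma star_smooth_star_value:
  "star_value M f us \<in> star_smooth M \<Omega> \<longleftrightarrow>
    (\<forall>\<^sub>F xs in type_of M us. f xs \<in> range Fn) \<and> smooth_net (type_of M us) \<Omega> (\<lambda>xs. fn_of (f xs))"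
  unfolding star_smooth_def star_set_star_value[OF M] mem_Fn_image[of _ "smooth_functions \<Omega>"]
    smooth_net_def eventually_conj_iff ..

lemma moderate_functions_star_value:
  assumes \<Omega>: "open \<Omega>"
  shows "star_value M f us \<in> moderate_functions M (star_value M R us) \<Omega> \<longleftrightarrow>
    (\<forall>\<^sub>F xs in type_of M us. f xs \<in> range Fn) \<and>
    moderate_net (type_of M us) (scale_of R) \<Omega> (\<lambda>xs. fn_of (f xs))"
proof (cases "smooth_net (type_of M us) \<Omega> (\<lambda>xs. fn_of (f xs))")
  case True
  have cont: "\<forall>\<^sub>F xs in type_of M us. continuous_on K (mderiv \<alpha> (fn_of (f xs)))" if "K \<subseteq> \<Omega>" for K \<alpha>
    using True unfolding smooth_net_def
    by eventually_elim (rule continuous_on_subset[OF smooth_continuous_on[OF smooth_mderiv] that])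
  have "(\<forall>\<xi>\<in>nearstandard M \<Omega>. apply_fn M (star_mderiv M \<alpha> (star_value M f us)) \<xi> \<in> moderate_numbers M (star_value M R us))
    \<longleftrightarrow> (\<forall>K. compact K \<and> K \<subseteq> \<Omega> \<longrightarrow> moderate_on (type_of M us) (scale_of R) K (\<lambda>xs. mderiv \<alpha> (fn_of (f xs))))" for \<alpha>
    unfolding apply_star_mderiv Ball_def nearstandard_iff[OF \<Omega>]
    using all_value_at_moderate_iff[OF _ cont, of _ \<alpha> R] by blast
  then show ?thesis
    using True by (auto simp: moderate_functions_def moderate_net_def star_smooth_star_value)
next
  case False
  then show ?thesis by (simp add: moderate_functions_def moderate_net_def star_smooth_star_value)
qed

lemma negligible_functions_star_value:
  assumes \<Omega>: "open \<Omega>"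
  shows "star_value M f us \<in> negligible_functions M (star_value M R us) \<Omega> \<longleftrightarrow>
    (\<forall>\<^sub>F xs in type_of M us. f xs \<in> range Fn) \<and>
    negligible_net (type_of M us) (scale_of R) \<Omega> (\<lambda>xs. fn_of (f xs))"
proof -
  have "(\<forall>\<xi>\<in>nearstandard M \<Omega>. apply_fn M (star_mderiv M \<alpha> (star_value M f us)) \<xi> \<in> negligible_numbers M (star_value M R us))
    \<longleftrightarrow> (\<forall>K. compact K \<and> K \<subseteq> \<Omega> \<longrightarrow> negligible_on (type_of M us) (scale_of R) K (\<lambda>xs. mderiv \<alpha> (fn_of (f xs))))" for \<alpha>
    unfolding apply_star_mderiv Ball_def nearstandard_iff[OF \<Omega>]
    using value_at_negligible_iff[of _ "\<lambda>xs. mderiv \<alpha> (fn_of (f xs))" us R] by blast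
  then show ?thesis
    by (auto simp: negligible_functions_def negligible_net_def star_smooth_star_value)
qed

lemma function_rel_star_value:
  assumes \<Omega>: "open \<Omega>"
  shows "(star_value M f us, star_value M g us) \<in> function_rel M (star_value M R us) \<Omega> \<longleftrightarrow>
    star_value M f us \<in> moderate_functions M (star_value M R us) \<Omega> \<and>
    star_value M g us \<in> moderate_functions M (star_value M R us) \<Omega> \<and>
    negligible_net (type_of M us) (scale_of R) \<Omega> (\<lambda>xs y. fn_of (f xs) y - fn_of (g xs) y)"
  by (simp add: function_rel_def star_fun2_star_value[OF M] negligible_functions_star_value[OF \<Omega>])

lemma number_rel_star_value:
  "(star_value M a us, star_value M b us) \<in> number_rel M (star_value M R us) \<longleftrightarrow>
    star_value M a us \<in> moderate_numbers M (star_value M R us) \<and>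
    star_value M b us \<in> moderate_numbers M (star_value M R us) \<and>
    negligible_on (type_of M us) (scale_of R) (UNIV :: unit set) (\<lambda>xs _. cpx_of (a xs) - cpx_of (b xs))"
  by (simp add: number_rel_def star_fun2_star_value[OF M] negligible_numbers_star_value)

section \<open>The quotient spaces and their operations\<close>

lemma equiv_number_rel:
  assumes \<rho>: "positive_infinitesimal M \<rho>"
  shows "equiv (moderate_numbers M \<rho>) (number_rel M \<rho>)"
proof (rule equivI)
  show "number_rel M \<rho> \<subseteq> moderate_numbers M \<rho> \<times> moderate_numbers M \<rho>"
    by (auto simp: number_rel_def)
  show "refl_on (moderate_numbers M \<rho>) (number_rel M \<rho>)"
  proof (rule refl_onI)
    fix a assume a: "a \<in> moderate_numbers M \<rho>"
    define us where "us = [a, \<rho>]"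
    have v: "a = star_value M (\<lambda>xs. xs ! 0) us" "\<rho> = star_value M (\<lambda>xs. xs ! 1) us"
      by (simp_all add: us_def star_value_nth[OF M])
    note r = infinitesimal_scale_star_value[OF \<rho>[unfolded v(2)]]
    show "(a, a) \<in> number_rel M \<rho>"
      using a unfolding v number_rel_star_value by (simp add: negligible_on_zero[OF r] del: One_nat_def)
  qed
  show "sym (number_rel M \<rho>)"
  proof (rule symI)
    fix a b assume ab: "(a, b) \<in> number_rel M \<rho>"
    define us where "us = [a, b, \<rho>]"
    have v: "a = star_value M (\<lambda>xs. xs ! 0) us" "b = star_value M (\<lambda>xs. xs ! 1) us"
      "\<rho> = star_value M (\<lambda>xs. xs ! 2) us"
      by (simp_all add: us_def star_value_nth[OF M])
    note r = infinitesimal_scale_star_value[OF \<rho>[unfolded v(3)]]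
    show "(b, a) \<in> number_rel M \<rho>"
      using ab negligible_on_cmult[OF r, of "UNIV :: unit set" "\<lambda>xs _. cpx_of (xs ! 0) - cpx_of (xs ! 1)" "-1"]
      unfolding v number_rel_star_value by simp
  qed
  show "trans (number_rel M \<rho>)"
  proof (rule transI)
    fix a b c assume ab: "(a, b) \<in> number_rel M \<rho>" and bc: "(b, c) \<in> number_rel M \<rho>"
    define us where "us = [a, b, c, \<rho>]"
    have v: "a = star_value M (\<lambda>xs. xs ! 0) us" "b = star_value M (\<lambda>xs. xs ! 1) us"
      "c = star_value M (\<lambda>xs. xs ! 2) us" "\<rho> = star_value M (\<lambda>xs. xs ! 3) us"
      by (simp_all add: us_def star_value_nth[OF M])
    note r = infinitesimal_scale_star_value[OF \<rho>[unfolded v(4)]]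
    show "(a, c) \<in> number_rel M \<rho>"
      using ab bc negligible_on_add[OF r, of "UNIV :: unit set" "\<lambda>xs _. cpx_of (xs ! 0) - cpx_of (xs ! 1)"
          "\<lambda>xs _. cpx_of (xs ! 1) - cpx_of (xs ! 2)"]
      unfolding v number_rel_star_value by simp
  qed
qed

lemma number_class_eqI:
  "positive_infinitesimal M \<rho> \<Longrightarrow> (a, b) \<in> number_rel M \<rho> \<Longrightarrow> number_class M \<rho> a = number_class M \<rho> b"
  unfolding number_class_def by (rule equiv_class_eq[OF equiv_number_rel])

context
  fixes \<rho> :: 'u and \<Omega> :: "(real^'d) set"
  assumes \<Omega>: "open \<Omega>" and \<rho>: "positive_infinitesimal M \<rho>"
begin

lemma equiv_function_rel: "equiv (moderate_functions M \<rho> \<Omega>) (function_rel M \<rho> \<Omega>)"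
proof (rule equivI)
  show "function_rel M \<rho> \<Omega> \<subseteq> moderate_functions M \<rho> \<Omega> \<times> moderate_functions M \<rho> \<Omega>"
    by (auto simp: function_rel_def)
  show "refl_on (moderate_functions M \<rho> \<Omega>) (function_rel M \<rho> \<Omega>)"
  proof (rule refl_onI)
    fix f assume f: "f \<in> moderate_functions M \<rho> \<Omega>"
    define us where "us = [f, \<rho>]"
    have v: "f = star_value M (\<lambda>xs. xs ! 0) us" "\<rho> = star_value M (\<lambda>xs. xs ! 1) us"
      by (simp_all add: us_def star_value_nth[OF M])
    note r = infinitesimal_scale_star_value[OF \<rho>[unfolded v(2)]]
    show "(f, f) \<in> function_rel M \<rho> \<Omega>"
      using f unfolding v function_rel_star_value[OF \<Omega>] by (simp add: negligible_net_zero[OF r \<Omega>] del: One_nat_def)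
  qed
  show "sym (function_rel M \<rho> \<Omega>)"
  proof (rule symI)
    fix f g assume fg: "(f, g) \<in> function_rel M \<rho> \<Omega>"
    define us where "us = [f, g, \<rho>]"
    have v: "f = star_value M (\<lambda>xs. xs ! 0) us" "g = star_value M (\<lambda>xs. xs ! 1) us"
      "\<rho> = star_value M (\<lambda>xs. xs ! 2) us"
      by (simp_all add: us_def star_value_nth[OF M])
    note r = infinitesimal_scale_star_value[OF \<rho>[unfolded v(3)]]
    show "(g, f) \<in> function_rel M \<rho> \<Omega>"
      using fg negligible_net_cmult[OF r \<Omega>, of "\<lambda>xs y. fn_of (xs ! 0) y - fn_of (xs ! 1) y" "-1"]
      unfolding v function_rel_star_value[OF \<Omega>] by simp
  qed
  show "trans (function_rel M \<rho> \<Omega>)"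
  proof (rule transI)
    fix f g h assume fg: "(f, g) \<in> function_rel M \<rho> \<Omega>" and gh: "(g, h) \<in> function_rel M \<rho> \<Omega>"
    define us where "us = [f, g, h, \<rho>]"
    have v: "f = star_value M (\<lambda>xs. xs ! 0) us" "g = star_value M (\<lambda>xs. xs ! 1) us"
      "h = star_value M (\<lambda>xs. xs ! 2) us" "\<rho> = star_value M (\<lambda>xs. xs ! 3) us"
      by (simp_all add: us_def star_value_nth[OF M])
    note r = infinitesimal_scale_star_value[OF \<rho>[unfolded v(4)]]
    show "(f, h) \<in> function_rel M \<rho> \<Omega>"
      using fg gh negligible_net_add[OF r \<Omega>, of "\<lambda>xs y. fn_of (xs ! 0) y - fn_of (xs ! 1) y"
          "\<lambda>xs y. fn_of (xs ! 1) y - fn_of (xs ! 2) y"]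
      unfolding v function_rel_star_value[OF \<Omega>] by simp
  qed
qed

lemma function_class_eqI:
  "(f, g) \<in> function_rel M \<rho> \<Omega> \<Longrightarrow> function_class M \<rho> \<Omega> f = function_class M \<rho> \<Omega> g"
  unfolding function_class_def by (rule equiv_class_eq[OF equiv_function_rel])

lemma asym_add_class:
  assumes f: "f \<in> moderate_functions M \<rho> \<Omega>" and g: "g \<in> moderate_functions M \<rho> \<Omega>"
  shows "asym_add M \<rho> \<Omega> (function_class M \<rho> \<Omega> f) (function_class M \<rho> \<Omega> g)
    = function_class M \<rho> \<Omega> (star_fun2 M (\<lambda>f g. Fn (\<lambda>x. fn_of f x + fn_of g x)) f g)"
  unfolding asym_add_def function_class_def[of M \<rho> \<Omega> f] function_class_def[of M \<rho> \<Omega> g]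
proof (rule UN_equiv_class2[OF equiv_function_rel equiv_function_rel congruent2I' f g])
  fix f f' g g' assume ff: "(f, f') \<in> function_rel M \<rho> \<Omega>" and gg: "(g, g') \<in> function_rel M \<rho> \<Omega>"
  define us where "us = [f, f', g, g', \<rho>]"
  have v: "f = star_value M (\<lambda>xs. xs ! 0) us" "f' = star_value M (\<lambda>xs. xs ! 1) us"
    "g = star_value M (\<lambda>xs. xs ! 2) us" "g' = star_value M (\<lambda>xs. xs ! 3) us"
    "\<rho> = star_value M (\<lambda>xs. xs ! 4) us"
    by (simp_all add: us_def star_value_nth[OF M])
  note r = infinitesimal_scale_star_value[OF \<rho>[unfolded v(5)]]
  show "function_class M \<rho> \<Omega> (star_fun2 M (\<lambda>f g. Fn (\<lambda>x. fn_of f x + fn_of g x)) f g)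
     = function_class M \<rho> \<Omega> (star_fun2 M (\<lambda>f g. Fn (\<lambda>x. fn_of f x + fn_of g x)) f' g')"
  proof (rule function_class_eqI)
    have eq: "(\<lambda>xs y. (fn_of (xs ! 0) y + fn_of (xs ! 2) y) - (fn_of (xs ! 1) y + fn_of (xs ! 3) y))
      = (\<lambda>xs y. (fn_of (xs ! 0) y - fn_of (xs ! 1) y) + (fn_of (xs ! 2) y - fn_of (xs ! 3) y))"
      by (simp add: fun_eq_iff)
    have "negligible_net (type_of M us) (scale_of (\<lambda>xs. xs ! 4)) \<Omega>
      (\<lambda>xs y. (fn_of (xs ! 0) y + fn_of (xs ! 2) y) - (fn_of (xs ! 1) y + fn_of (xs ! 3) y))"
      unfolding eq
      by (rule negligible_net_add[OF r \<Omega>])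
        (use ff gg in \<open>simp_all add: v function_rel_star_value[OF \<Omega>] del: One_nat_def\<close>)
    then show "(star_fun2 M (\<lambda>f g. Fn (\<lambda>x. fn_of f x + fn_of g x)) f g,
        star_fun2 M (\<lambda>f g. Fn (\<lambda>x. fn_of f x + fn_of g x)) f' g') \<in> function_rel M \<rho> \<Omega>"
      using ff gg moderate_net_add[OF r \<Omega>]
      unfolding v star_fun2_star_value[OF M] function_rel_star_value[OF \<Omega>] moderate_functions_star_value[OF \<Omega>]
      by (simp del: One_nat_def)
  qed
qed

lemma asym_scale_class:
  assumes f: "f \<in> moderate_functions M \<rho> \<Omega>"
  shows "asym_scale M \<rho> \<Omega> c (function_class M \<rho> \<Omega> f)
    = function_class M \<rho> \<Omega> (star_fun2 M (\<lambda>a f. Fn (\<lambda>x. cpx_of a * fn_of f x)) (star_of M (Cpx c)) f)"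
  unfolding asym_scale_def function_class_def[of M \<rho> \<Omega> f]
proof (rule UN_equiv_class[OF equiv_function_rel congruentI f])
  fix f f' assume ff: "(f, f') \<in> function_rel M \<rho> \<Omega>"
  define us where "us = [f, f', \<rho>]"
  have v: "f = star_value M (\<lambda>xs. xs ! 0) us" "f' = star_value M (\<lambda>xs. xs ! 1) us"
    "\<rho> = star_value M (\<lambda>xs. xs ! 2) us"
    by (simp_all add: us_def star_value_nth[OF M])
  note r = infinitesimal_scale_star_value[OF \<rho>[unfolded v(3)]]
  show "function_class M \<rho> \<Omega> (star_fun2 M (\<lambda>a f. Fn (\<lambda>x. cpx_of a * fn_of f x)) (star_of M (Cpx c)) f)
     = function_class M \<rho> \<Omega> (star_fun2 M (\<lambda>a f. Fn (\<lambda>x. cpx_of a * fn_of f x)) (star_of M (Cpx c)) f')"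
    by (rule function_class_eqI)
      (use ff moderate_net_cmult[OF r \<Omega>] negligible_net_cmult[OF r \<Omega>] in
       \<open>simp add: v star_of_value[of "Cpx c" us] star_fun2_star_value[OF M] function_rel_star_value[OF \<Omega>]
         moderate_functions_star_value[OF \<Omega>] right_diff_distrib[symmetric]\<close>)
qed

lemma asym_deriv_class:
  assumes f: "f \<in> moderate_functions M \<rho> \<Omega>"
  shows "asym_deriv M \<rho> \<Omega> \<alpha> (function_class M \<rho> \<Omega> f) = function_class M \<rho> \<Omega> (star_mderiv M \<alpha> f)"
  unfolding asym_deriv_def function_class_def[of M \<rho> \<Omega> f]
proof (rule UN_equiv_class[OF equiv_function_rel congruentI f])
  fix f f' assume ff: "(f, f') \<in> function_rel M \<rho> \<Omega>"
  define us where "us = [f, f', \<rho>]"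
  have v: "f = star_value M (\<lambda>xs. xs ! 0) us" "f' = star_value M (\<lambda>xs. xs ! 1) us"
    "\<rho> = star_value M (\<lambda>xs. xs ! 2) us"
    by (simp_all add: us_def star_value_nth[OF M])
  note r = infinitesimal_scale_star_value[OF \<rho>[unfolded v(3)]]
  have ff': "moderate_net (type_of M us) (scale_of (\<lambda>xs. xs ! 2)) \<Omega> (\<lambda>xs. fn_of (xs ! 0))"
    "moderate_net (type_of M us) (scale_of (\<lambda>xs. xs ! 2)) \<Omega> (\<lambda>xs. fn_of (xs ! 1))"
    "negligible_net (type_of M us) (scale_of (\<lambda>xs. xs ! 2)) \<Omega> (\<lambda>xs y. fn_of (xs ! 0) y - fn_of (xs ! 1) y)"
    using ff unfolding v function_rel_star_value[OF \<Omega>] moderate_functions_star_value[OF \<Omega>] by auto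
  have sm: "smooth_net (type_of M us) \<Omega> (\<lambda>xs. fn_of (xs ! 0))" "smooth_net (type_of M us) \<Omega> (\<lambda>xs. fn_of (xs ! 1))"
    using ff'(1,2) by (auto simp: moderate_net_def)
  have "\<forall>\<^sub>F xs in type_of M us. \<forall>y\<in>\<Omega>. mderiv \<alpha> (\<lambda>y. fn_of (xs ! 0) y - fn_of (xs ! 1) y) y
      = mderiv \<alpha> (fn_of (xs ! 0)) y - mderiv \<alpha> (fn_of (xs ! 1)) y"
    using sm unfolding smooth_net_def
    by eventually_elim (simp add: mderiv_def partial_derivs_diff[OF \<Omega>])
  from negligible_net_cong[OF r \<Omega> this negligible_net_mderiv[OF r \<Omega> ff'(3)]]
  have neg: "negligible_net (type_of M us) (scale_of (\<lambda>xs. xs ! 2)) \<Omega>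
    (\<lambda>xs y. mderiv \<alpha> (fn_of (xs ! 0)) y - mderiv \<alpha> (fn_of (xs ! 1)) y)" .
  show "function_class M \<rho> \<Omega> (star_mderiv M \<alpha> f) = function_class M \<rho> \<Omega> (star_mderiv M \<alpha> f')"
    by (rule function_class_eqI)
      (use neg moderate_net_mderiv[OF r \<Omega>] ff' in
       \<open>simp add: v star_mderiv_def star_fun1_star_value[OF M] function_rel_star_value[OF \<Omega>]
         moderate_functions_star_value[OF \<Omega>]\<close>)
qed

lemma asym_pairing_class:
  assumes f: "f \<in> moderate_functions M \<rho> \<Omega>" and \<phi>: "\<phi> \<in> test_functions \<Omega>"
  shows "asym_pairing M \<rho> \<Omega> (function_class M \<rho> \<Omega> f) \<phi>
    = number_class M \<rho> (star_fun2 M (\<lambda>f g. Cpx (LINT x:\<Omega>|lebesgue. fn_of f x * fn_of g x)) f (star_of M (Fn \<phi>)))"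
  unfolding asym_pairing_def function_class_def[of M \<rho> \<Omega> f]
proof (rule UN_equiv_class[OF equiv_function_rel congruentI f])
  fix f f' assume ff: "(f, f') \<in> function_rel M \<rho> \<Omega>"
  define us where "us = [f, f', \<rho>]"
  have v: "f = star_value M (\<lambda>xs. xs ! 0) us" "f' = star_value M (\<lambda>xs. xs ! 1) us"
    "\<rho> = star_value M (\<lambda>xs. xs ! 2) us"
    by (simp_all add: us_def star_value_nth[OF M])
  note r = infinitesimal_scale_star_value[OF \<rho>[unfolded v(3)]]
  have ff': "moderate_net (type_of M us) (scale_of (\<lambda>xs. xs ! 2)) \<Omega> (\<lambda>xs. fn_of (xs ! 0))"
    "moderate_net (type_of M us) (scale_of (\<lambda>xs. xs ! 2)) \<Omega> (\<lambda>xs. fn_of (xs ! 1))"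
    "negligible_net (type_of M us) (scale_of (\<lambda>xs. xs ! 2)) \<Omega> (\<lambda>xs y. fn_of (xs ! 0) y - fn_of (xs ! 1) y)"
    using ff unfolding v function_rel_star_value[OF \<Omega>] moderate_functions_star_value[OF \<Omega>] by auto
  have sm: "smooth_net (type_of M us) \<Omega> (\<lambda>xs. fn_of (xs ! 0))" "smooth_net (type_of M us) \<Omega> (\<lambda>xs. fn_of (xs ! 1))"
    using ff'(1,2) by (auto simp: moderate_net_def)
  have "\<forall>\<^sub>F xs in type_of M us. \<forall>y\<in>(UNIV :: unit set). (LINT y:\<Omega>|lebesgue. (fn_of (xs ! 0) y - fn_of (xs ! 1) y) * \<phi> y)
      = (LINT y:\<Omega>|lebesgue. fn_of (xs ! 0) y * \<phi> y) - (LINT y:\<Omega>|lebesgue. fn_of (xs ! 1) y * \<phi> y)"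
    using sm unfolding smooth_net_def by eventually_elim (simp add: pairing_diff[OF \<Omega> _ _ \<phi>])
  from negligible_on_cong[OF this] negligible_pairing[OF r \<Omega> ff'(3) \<phi>]
  have neg: "negligible_on (type_of M us) (scale_of (\<lambda>xs. xs ! 2)) (UNIV :: unit set) (\<lambda>xs _.
      (LINT y:\<Omega>|lebesgue. fn_of (xs ! 0) y * \<phi> y) - (LINT y:\<Omega>|lebesgue. fn_of (xs ! 1) y * \<phi> y))"
    by simp
  show "number_class M \<rho> (star_fun2 M (\<lambda>f g. Cpx (LINT x:\<Omega>|lebesgue. fn_of f x * fn_of g x)) f (star_of M (Fn \<phi>)))
    = number_class M \<rho> (star_fun2 M (\<lambda>f g. Cpx (LINT x:\<Omega>|lebesgue. fn_of f x * fn_of g x)) f' (star_of M (Fn \<phi>)))"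
    by (rule number_class_eqI[OF \<rho>])
      (use neg moderate_pairing[OF r \<Omega> ff'(1) \<phi>] moderate_pairing[OF r \<Omega> ff'(2) \<phi>] in
       \<open>simp add: v star_of_value[of "Fn \<phi>" us] star_fun2_star_value[OF M] number_rel_star_value
         moderate_numbers_star_value\<close>)
qed

end

end

section \<open>Delta functions and cut-off functions in coordinates\<close>

lemma eventually_type_of_imp:
  assumes M: "transfer_principle M"
  shows "eventually (\<lambda>xs. P xs \<longrightarrow> Q xs) (type_of M us) \<longleftrightarrow>
    (eventually P (type_of M us) \<longrightarrow> eventually Q (type_of M us))"
proof
  assume "eventually (\<lambda>xs. P xs \<longrightarrow> Q xs) (type_of M us)"
  then show "eventually P (type_of M us) \<longrightarrow> eventually Q (type_of M us)" using eventually_mp by blast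
next
  assume *: "eventually P (type_of M us) \<longrightarrow> eventually Q (type_of M us)"
  show "eventually (\<lambda>xs. P xs \<longrightarrow> Q xs) (type_of M us)"
  proof (cases "eventually P (type_of M us)")
    case True
    from *[rule_format, OF True] show ?thesis by eventually_elim simp
  next
    case False
    then have "eventually (\<lambda>xs. \<not> P xs) (type_of M us)" unfolding eventually_type_of_not[OF M] .
    then show ?thesis by eventually_elim simp
  qed
qed

lemma abs_ln_lt_inverse:
  fixes s :: real
  assumes "0 < s" "s < 1"
  shows "0 < \<bar>ln s\<bar>" "\<bar>ln s\<bar> < inverse s"
proof -
  have "ln s < 0" using assms by simp
  then show "0 < \<bar>ln s\<bar>" by simp
  have "ln (inverse s) \<le> inverse s - 1" using assms by (intro ln_le_minus_one) simp
  then show "\<bar>ln s\<bar> < inverse s" using \<open>ln s < 0\<close> assms by (simp add: ln_inverse)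
qed

text \<open>The tuple \<open>params\<close> is a variable, so that \<open>\<rho>\<close>, \<open>D\<close> and \<open>P\<close> can be rewritten as values of
  starred projections at \<open>params\<close> without recurring on the right-hand side.\<close>

locale regularization =
  fixes M :: "('d::finite, 'u) model" and \<rho> D P :: 'u and \<Omega> :: "(real^'d) set" and params :: "'u list"
  assumes params_def: "params = [\<rho>, D, P]"
    and M: "transfer_principle M" and \<Omega>: "open \<Omega>" and \<rho>: "positive_infinitesimal M \<rho>"
    and delta: "delta_function M \<rho> D" and cutoff: "cutoff_function M \<rho> \<Omega> P"
begin

abbreviation (input) \<F> :: "'d obj list filter" where "\<F> \<equiv> type_of M params"
abbreviation (input) scale :: "'d obj list \<Rightarrow> real" where "scale xs \<equiv> scale_of hd xs"
abbreviation (input) delta_at :: "'d obj list \<Rightarrow> 'd cfun" where "delta_at xs \<equiv> fn_of (xs ! 1)"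
abbreviation (input) cutoff_at :: "'d obj list \<Rightarrow> 'd cfun" where "cutoff_at xs \<equiv> fn_of (xs ! 2)"

lemma param_values:
  "\<rho> = star_value M hd params" "D = star_value M (\<lambda>xs. xs ! 1) params" "P = star_value M (\<lambda>xs. xs ! 2) params"
  unfolding params_def star_value_hd[OF M] by (simp_all add: star_value_nth[OF M])

lemma infinitesimal: "infinitesimal_scale \<F> scale"
  using infinitesimal_scale_star_value[OF M \<rho>[unfolded param_values(1)]] .

lemma scale_real: "\<forall>\<^sub>F xs in \<F>. hd xs = Cpx (of_real (scale xs))"
proof -
  have "\<forall>\<^sub>F xs in \<F>. hd xs \<in> {Cpx (of_real r) |r. 0 < r}"
    using \<rho> by (simp add: positive_infinitesimal_def param_values(1) star_set_star_value[OF M])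
  then show ?thesis by eventually_elim auto
qed

lemma apply_delta: "apply_fn M D \<xi> = star_value M (\<lambda>zs. Cpx (delta_at (tl zs) (pt_of (hd zs)))) (\<xi> # params)"
proof -
  have "apply_fn M D \<xi> = apply_fn M (star_value M (\<lambda>zs. tl zs ! 1) (\<xi> # params)) (star_value M hd (\<xi> # params))"
    by (simp only: star_value_hd[OF M] param_values(2) star_value_weaken[OF M, of "\<lambda>xs. xs ! 1" params \<xi>])
  then show ?thesis by (simp add: apply_fn_def star_value_simps[OF M])
qed

lemma delta_test: "\<forall>\<^sub>F xs in \<F>. delta_at xs \<in> test_functions UNIV"
proof -
  have "D \<in> star_test M UNIV" using delta unfolding delta_function_def by (elim conjE)
  then have "\<forall>\<^sub>F xs in \<F>. xs ! 1 \<in> Fn ` test_functions UNIV"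
    by (simp only: star_test_def param_values(2) star_set_star_value[OF M])
  then show ?thesis by eventually_elim auto
qed

lemma delta_support: "\<forall>\<^sub>F xs in \<F>. \<forall>x. scale xs \<le> norm x \<longrightarrow> delta_at xs x = 0"
proof -
  have *: "\<forall>\<xi>\<in>star_points M UNIV. star_real_le M \<rho> (star_norm_pt M \<xi>) \<longrightarrow> apply_fn M D \<xi> = star_of M (Cpx 0)"
    using delta unfolding delta_function_def by (elim conjE)
  have le: "star_real_le M \<rho> (star_norm_pt M \<xi>) \<longleftrightarrow> (\<forall>\<^sub>F zs in type_of M (\<xi> # params).
      \<exists>a b. hd (tl zs) = Cpx (of_real a) \<and> (Cpx (of_real (norm (pt_of (hd zs)))) :: 'd obj) = Cpx (of_real b) \<and> a \<le> b)" for \<xi>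
  proof -
    have "star_norm_pt M \<xi> = star_norm_pt M (star_value M hd (\<xi> # params))"
      by (simp only: star_value_hd[OF M])
    also have "\<dots> = star_value M (\<lambda>zs. Cpx (of_real (norm (pt_of (hd zs))))) (\<xi> # params)"
      by (simp only: star_norm_pt_def star_fun1_star_value[OF M])
    finally have n: "star_norm_pt M \<xi> = \<dots>" .
    show ?thesis
      unfolding n param_values(1) star_value_weaken[OF M, of hd params \<xi>] star_real_le_def star_pred2_star_value[OF M]
      by (rule refl)
  qed
  have "\<forall>\<xi>\<in>star_points M UNIV. \<forall>\<^sub>F zs in type_of M (\<xi> # params).
      (\<exists>a b. hd (tl zs) = Cpx (of_real a) \<and> (Cpx (of_real (norm (pt_of (hd zs)))) :: 'd obj) = Cpx (of_real b) \<and> a \<le> b)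
      \<longrightarrow> (Cpx (delta_at (tl zs) (pt_of (hd zs))) :: 'd obj) = Cpx 0"
    unfolding eventually_type_of_imp[OF M] le[symmetric] star_value_eq_iff[OF M, symmetric]
      apply_delta[symmetric] star_value_const[OF M] by (rule *)
  then have "\<forall>\<^sub>F xs in \<F>. \<forall>y\<in>UNIV. (\<exists>a b. hd xs = Cpx (of_real a) \<and> (Cpx (of_real (norm y)) :: 'd obj) = Cpx (of_real b) \<and> a \<le> b)
      \<longrightarrow> (Cpx (delta_at xs y) :: 'd obj) = Cpx 0"
    using all_star_points_iff[OF M, where K = UNIV and us = params and
      Q = "\<lambda>xs y. (\<exists>a b. hd xs = Cpx (of_real a) \<and> (Cpx (of_real (norm y)) :: 'd obj) = Cpx (of_real b) \<and> a \<le> b)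
        \<longrightarrow> (Cpx (delta_at xs y) :: 'd obj) = Cpx 0"] by simp
  with scale_real show ?thesis
  proof eventually_elim
    case (elim xs)
    show ?case
    proof (intro allI impI)
      fix x :: "real^'d" assume "scale xs \<le> norm x"
      then show "delta_at xs x = 0" using elim(2)[rule_format, of x, OF UNIV_I] elim(1) by auto
    qed
  qed
qed

lemma delta_symmetric: "\<forall>\<^sub>F xs in \<F>. \<forall>x. delta_at xs (- x) = delta_at xs x"
proof -
  have *: "\<forall>\<xi>\<in>star_points M UNIV. apply_fn M D (star_fun1 M (\<lambda>x. Pt (- pt_of x)) \<xi>) = apply_fn M D \<xi>"
    using delta unfolding delta_function_def by (elim conjE)
  have neg: "apply_fn M D (star_fun1 M (\<lambda>x. Pt (- pt_of x)) \<xi>)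
      = star_value M (\<lambda>zs. Cpx (delta_at (tl zs) (- pt_of (hd zs)))) (\<xi> # params)" for \<xi>
  proof -
    have "apply_fn M D (star_fun1 M (\<lambda>x. Pt (- pt_of x)) \<xi>) = apply_fn M (star_value M (\<lambda>zs. tl zs ! 1) (\<xi> # params))
        (star_fun1 M (\<lambda>x. Pt (- pt_of x)) (star_value M hd (\<xi> # params)))"
      by (simp only: star_value_hd[OF M] param_values(2) star_value_weaken[OF M, of "\<lambda>xs. xs ! 1" params \<xi>])
    then show ?thesis by (simp add: apply_fn_def star_value_simps[OF M])
  qed
  have "\<forall>\<xi>\<in>star_points M UNIV. \<forall>\<^sub>F zs in type_of M (\<xi> # params).
      (Cpx (delta_at (tl zs) (- pt_of (hd zs))) :: 'd obj) = Cpx (delta_at (tl zs) (pt_of (hd zs)))"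
    unfolding star_value_eq_iff[OF M, symmetric] neg[symmetric] apply_delta[symmetric] by (rule *)
  then show ?thesis
    using all_star_points_iff[OF M, where K = UNIV and us = params and
      Q = "\<lambda>xs y. (Cpx (delta_at xs (- y)) :: 'd obj) = Cpx (delta_at xs y)"] by simp
qed

lemma delta_integral: "\<forall>\<^sub>F xs in \<F>. (LINT x|lebesgue. delta_at xs x) = 1"
proof -
  have "star_fun1 M (\<lambda>f. Cpx (LINT x|lebesgue. fn_of f x)) D = star_of M (Cpx 1)"
    using delta unfolding delta_function_def by (elim conjE)
  then show ?thesis
    by (simp add: param_values(2) star_of_value[OF M, of "Cpx 1" params] star_value_simps[OF M] del: One_nat_def)
qed

lemma delta_moment:
  assumes "\<alpha> \<noteq> (\<lambda>i. 0)"
  shows "\<forall>\<^sub>F xs in \<F>. (LINT x|lebesgue. delta_at xs x * of_real (mpower x \<alpha>)) = 0"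
proof -
  have "\<forall>\<alpha>. \<alpha> \<noteq> (\<lambda>i. 0) \<longrightarrow>
        star_fun1 M (\<lambda>f. Cpx (LINT x|lebesgue. fn_of f x * of_real (mpower x \<alpha>))) D = star_of M (Cpx 0)"
    using delta unfolding delta_function_def by (elim conjE)
  from this[rule_format, OF assms] show ?thesis
    by (simp add: param_values(2) star_of_value[OF M, of "Cpx 0" params] star_value_simps[OF M] del: One_nat_def)
qed

lemma delta_norm_integral: "\<forall>\<^sub>F xs in \<F>. (LINT x|lebesgue. norm (delta_at xs x)) \<le> 2"
proof -
  have "cpx_approx M (star_fun1 M (\<lambda>f. Cpx (of_real (LINT x|lebesgue. norm (fn_of f x)))) D) (star_of M (Cpx 1))"
    using delta unfolding delta_function_def by (elim conjE)
  then have "\<forall>\<epsilon>>0. \<forall>\<^sub>F xs in \<F>. dist (complex_of_real (LINT x|lebesgue. norm (delta_at xs x))) 1 < \<epsilon>"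
    by (simp add: cpx_approx_def param_values(2) star_of_value[OF M, of "Cpx 1" params] star_value_simps[OF M] del: One_nat_def)
  from this[rule_format, OF zero_less_one] show ?thesis
  proof eventually_elim
    case (elim xs)
    then have "dist (complex_of_real (LINT x|lebesgue. norm (delta_at xs x))) (complex_of_real 1) < 1" by simp
    then have "\<bar>(LINT x|lebesgue. norm (delta_at xs x)) - 1\<bar> < 1" unfolding dist_of_real by (simp add: dist_real_def)
    then show ?case by linarith
  qed
qed

lemma delta_mollifier: "\<forall>\<^sub>F xs in \<F>. mollifier n (scale xs) (delta_at xs)"
proof -
  have "\<forall>\<^sub>F xs in \<F>. \<forall>\<alpha>\<in>{\<alpha>. msize \<alpha> \<le> n}. 0 < msize \<alpha> \<longrightarrow>
      (LINT x|lebesgue. delta_at xs x * of_real (mpower x \<alpha>)) = 0"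
  proof (intro eventually_ball_finite ballI finite_msize_le)
    fix \<alpha> :: "'d \<Rightarrow> nat"
    show "\<forall>\<^sub>F xs in \<F>. 0 < msize \<alpha> \<longrightarrow> (LINT x|lebesgue. delta_at xs x * of_real (mpower x \<alpha>)) = 0"
    proof (cases "\<alpha> = (\<lambda>i. 0)")
      case True
      then show ?thesis by (simp add: msize_def)
    next
      case False
      from delta_moment[OF this] show ?thesis by eventually_elim simp
    qed
  qed
  with delta_test delta_support delta_symmetric delta_integral delta_norm_integral
    infinitesimal_scaleD[OF infinitesimal zero_less_one]
  show ?thesis by eventually_elim (simp add: mollifier_def)
qed

text \<open>Since \<open>\<bar>ln r\<bar> < 1 / r\<close>, the logarithmic factor costs one further power of \<open>r\<close>.\<close>

lemma delta_mderiv_bound: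
  "\<forall>\<^sub>F xs in \<F>. \<forall>x. norm (mderiv \<alpha> (delta_at xs) x) \<le> inverse (scale xs ^ Suc (CARD('d) + msize \<alpha>))"
proof -
  let ?S = "\<lambda>xs. SUP x. norm (mderiv \<alpha> (delta_at xs) x)" and ?e = "CARD('d) + msize \<alpha>"
  have "\<forall>\<alpha>. cpx_approx M
        (star_fun2 M
           (\<lambda>r f. let s = Re (cpx_of r) in
              Cpx (of_real (inverse \<bar>ln s\<bar> *
                (s ^ (CARD('d) + msize \<alpha>) * (SUP x. norm (mderiv \<alpha> (fn_of f) x))))))
           \<rho> D)
        (star_of M (Cpx 0))"
    using delta unfolding delta_function_def by (elim conjE)
  then have "\<forall>\<epsilon>>0. \<forall>\<^sub>F xs in \<F>. dist (complex_of_real (inverse \<bar>ln (scale xs)\<bar> * (scale xs ^ ?e * ?S xs))) 0 < \<epsilon>"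
    unfolding cpx_approx_def param_values(1,2) star_of_value[OF M, of "Cpx 0" params] star_value_simps[OF M] Let_def obj.sel
    by blast
  from this[rule_format, OF zero_less_one] infinitesimal_scaleD[OF infinitesimal zero_less_one] delta_test
  show ?thesis
  proof eventually_elim
    case (elim xs)
    let ?s = "scale xs"
    have s: "0 < ?s" "?s < 1" using elim(2) by auto
    note l = abs_ln_lt_inverse[OF s]
    have "norm (complex_of_real (inverse \<bar>ln ?s\<bar> * (?s ^ ?e * ?S xs))) < 1" using elim(1) by (simp only: dist_norm diff_zero)
    then have "\<bar>inverse \<bar>ln ?s\<bar> * (?s ^ ?e * ?S xs)\<bar> < 1" unfolding norm_of_real .
    then have "inverse \<bar>ln ?s\<bar> * (?s ^ ?e * ?S xs) < 1" by linarith
    then have "?s ^ ?e * ?S xs < \<bar>ln ?s\<bar>" using l(1) by (simp add: field_simps)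
    also have "\<dots> < inverse ?s" by (rule l(2))
    finally have S: "?S xs \<le> inverse (?s ^ Suc ?e)" using s by (simp add: field_simps)
    obtain B where B: "\<And>is x. length is \<le> 0 \<Longrightarrow> norm (partial_derivs is (mderiv \<alpha> (delta_at xs)) x) \<le> B"
      using test_bounded[OF test_mderiv[OF elim(3)], where N = 0] by metis
    have bdd: "bdd_above (range (\<lambda>x. norm (mderiv \<alpha> (delta_at xs) x)))"
      by (rule bdd_aboveI2[of _ _ B]) (use B[of "[]"] in simp)
    show ?case using order_trans[OF cSUP_upper[OF UNIV_I bdd] S] by blast
  qed
qed

lemma delta_partial_derivs_bound:
  "\<forall>\<^sub>F xs in \<F>. \<forall>is x. length is \<le> k \<longrightarrow>
     norm (partial_derivs is (delta_at xs) x) \<le> inverse (scale xs ^ Suc (CARD('d) + k))"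
proof -
  have "\<forall>\<^sub>F xs in \<F>. \<forall>is\<in>{is. length is \<le> k}. \<forall>x. norm (mderiv (count_list is) (delta_at xs) x)
      \<le> inverse (scale xs ^ Suc (CARD('d) + msize (count_list is)))"
    by (intro eventually_ball_finite ballI finite_lists_length_le_UNIV delta_mderiv_bound)
  with delta_test infinitesimal_scaleD[OF infinitesimal zero_less_one]
  show ?thesis
  proof eventually_elim
    case (elim xs)
    show ?case
    proof (intro allI impI)
      fix "is" :: "'d list" and x assume l: "length is \<le> k"
      have "partial_derivs is (delta_at xs) x = mderiv (count_list is) (delta_at xs) x"
        by (rule partial_derivs_eq_mderiv[OF open_UNIV test_smooth[OF elim(1)] UNIV_I])
      also have "norm \<dots> \<le> inverse (scale xs ^ Suc (CARD('d) + msize (count_list is)))"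
        using elim(3) l by blast
      also have "\<dots> \<le> inverse (scale xs ^ Suc (CARD('d) + k))"
        using elim(2) l by (intro le_imp_inverse_le power_decreasing) (auto simp: length_eq_msize[symmetric])
      finally show "norm (partial_derivs is (delta_at xs) x) \<le> inverse (scale xs ^ Suc (CARD('d) + k))" .
    qed
  qed
qed

lemma cutoff_test: "\<forall>\<^sub>F xs in \<F>. cutoff_at xs \<in> test_functions \<Omega>"
proof -
  have "P \<in> star_test M \<Omega>" using cutoff by (simp add: cutoff_function_def)
  then have "\<forall>\<^sub>F xs in \<F>. xs ! 2 \<in> Fn ` test_functions \<Omega>"
    by (simp only: star_test_def param_values(3) star_set_star_value[OF M])
  then show ?thesis by eventually_elim auto
qed

lemma cutoff_one:
  assumes "compact K" "K \<subseteq> \<Omega>"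
  shows "\<forall>\<^sub>F xs in \<F>. \<forall>y\<in>K. cutoff_at xs y = 1"
proof -
  have app: "apply_fn M P \<xi> = star_value M (\<lambda>zs. Cpx (cutoff_at (tl zs) (pt_of (hd zs)))) (\<xi> # params)" for \<xi>
  proof -
    have "apply_fn M P \<xi> = apply_fn M (star_value M (\<lambda>zs. tl zs ! 2) (\<xi> # params)) (star_value M hd (\<xi> # params))"
      by (simp only: star_value_hd[OF M] param_values(3) star_value_weaken[OF M, of "\<lambda>xs. xs ! 2" params \<xi>])
    then show ?thesis by (simp add: apply_fn_def star_value_simps[OF M])
  qed
  have one: "apply_fn M P \<xi> = star_of M (Cpx 1)" if "\<xi> \<in> star_points M K" for \<xi>
  proof -
    have "\<xi> \<in> nearstandard M \<Omega>" using nearstandard_iff[OF M \<Omega>] assms that by blast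
    then show ?thesis using cutoff by (simp add: cutoff_function_def)
  qed
  have "\<forall>\<xi>\<in>star_points M K. \<forall>\<^sub>F zs in type_of M (\<xi> # params). (Cpx (cutoff_at (tl zs) (pt_of (hd zs))) :: 'd obj) = Cpx 1"
    unfolding star_value_eq_iff[OF M, symmetric] app[symmetric] star_value_const[OF M] using one by blast
  then show ?thesis
    using all_star_points_iff[OF M, where K = K and us = params and Q = "\<lambda>xs y. (Cpx (cutoff_at xs y) :: 'd obj) = Cpx 1"]
    by simp
qed

section \<open>The embedding of distributions\<close>

abbreviation regularize :: "'d functional \<Rightarrow> 'd obj list \<Rightarrow> 'd cfun" where
  "regularize T xs \<equiv> dist_convolution (schwartz_product T (cutoff_at xs)) (delta_at xs)"

abbreviation representative :: "'d functional \<Rightarrow> 'u" where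
  "representative T \<equiv> star_value M (\<lambda>xs. Fn (regularize T xs)) params"

abbreviation embed :: "'d functional \<Rightarrow> 'u set" where
  "embed \<equiv> distribution_embedding M \<rho> \<Omega> D P"

lemma embed_eq: "embed T = function_class M \<rho> \<Omega> (representative T)"
proof -
  have "star_fun3 M (\<lambda>T p g. Fn (dist_convolution (schwartz_product (fnl_of T) (fn_of p)) (fn_of g))) (star_of M (Fnl T)) P D
      = representative T"
    unfolding param_values(2,3) star_of_value[OF M, of "Fnl T" params] star_fun3_star_value[OF M] obj.sel ..
  then show ?thesis by (simp only: distribution_embedding_def)
qed

text \<open>For almost all values of the parameters, the standard estimates near \<open>K\<close> apply with the same
  \<open>\<delta>\<close>, which is fixed before the infinitesimal scale.\<close>

lemma eventually_near_compact:
  assumes "compact K" "closed_nbhd K (2 * \<delta>) \<subseteq> \<Omega>" "\<delta> > 0"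
  shows "\<forall>\<^sub>F xs in \<F>. cutoff_at xs \<in> test_functions \<Omega> \<and> (\<forall>y\<in>closed_nbhd K (2 * \<delta>). cutoff_at xs y = 1) \<and>
    mollifier n (scale xs) (delta_at xs) \<and> scale xs \<le> \<delta>"
  using cutoff_test cutoff_one[OF compact_closed_nbhd[OF assms(1)] assms(2)] delta_mollifier[of n]
    infinitesimal_scaleD[OF infinitesimal assms(3)]
  by eventually_elim auto

lemma smooth_regularize:
  assumes T: "T \<in> distributions \<Omega>"
  shows "smooth_net \<F> \<Omega> (regularize T)"
  unfolding smooth_net_def using cutoff_test delta_test
  by eventually_elim (rule smooth_subset[OF smooth_convolution[OF \<Omega> T] subset_UNIV])

lemma moderate_regularize:
  assumes T: "T \<in> distributions \<Omega>"
  shows "moderate_net \<F> scale \<Omega> (regularize T)"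
  unfolding moderate_net_def
proof (intro conjI allI impI smooth_regularize[OF T])
  fix \<alpha> :: "'d \<Rightarrow> nat" and K :: "(real^'d) set" assume K: "compact K \<and> K \<subseteq> \<Omega>"
  obtain "is" where al: "length is = msize \<alpha>" "\<And>f. mderiv \<alpha> f = partial_derivs is f"
    using mderiv_as_list[of \<alpha>] by metis
  obtain \<delta> where \<delta>: "\<delta> > 0" "closed_nbhd K (2 * \<delta>) \<subseteq> \<Omega>"
    using exists_closed_nbhd_subset[of K \<Omega>] K \<Omega> by metis
  obtain C N where CN: "\<And>p D r x is B. p \<in> test_functions \<Omega> \<Longrightarrow> (\<And>y. y \<in> closed_nbhd K (2 * \<delta>) \<Longrightarrow> p y = 1) \<Longrightarrow>
      D \<in> test_functions UNIV \<Longrightarrow> (\<And>x. r \<le> norm x \<Longrightarrow> D x = 0) \<Longrightarrow> r \<le> \<delta> \<Longrightarrow> x \<in> K \<Longrightarrow>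
      (\<And>js x. length js \<le> N + length is \<Longrightarrow> norm (partial_derivs js D x) \<le> B) \<Longrightarrow>
      norm (partial_derivs is (dist_convolution (schwartz_product T p) D) x) \<le> C * B"
    using convolution_bound[OF \<Omega> T conjunct1[OF K] \<delta>(2,1)] by metis
  show "moderate_on \<F> scale K (\<lambda>xs. mderiv \<alpha> (regularize T xs))"
  proof (rule moderate_onI[OF infinitesimal])
    show "\<forall>\<^sub>F xs in \<F>. \<forall>y\<in>K. norm (mderiv \<alpha> (regularize T xs) y)
        \<le> C * inverse (scale xs ^ Suc (CARD('d) + (N + length is)))"
      using eventually_near_compact[OF conjunct1[OF K] \<delta>(2,1), of 1] delta_partial_derivs_bound[of "N + length is"]
    proof eventually_elim
      case (elim xs)
      show ?case
      proof
        fix y assume y: "y \<in> K"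
        show "norm (mderiv \<alpha> (regularize T xs) y) \<le> C * inverse (scale xs ^ Suc (CARD('d) + (N + length is)))"
          unfolding al(2)
        proof (rule CN[OF _ _ _ _ _ y, where r = "scale xs"])
          show "cutoff_at xs \<in> test_functions \<Omega>" "\<And>y. y \<in> closed_nbhd K (2 * \<delta>) \<Longrightarrow> cutoff_at xs y = 1"
            "scale xs \<le> \<delta>"
            using elim(1) by blast+
          show "delta_at xs \<in> test_functions UNIV" "\<And>x. scale xs \<le> norm x \<Longrightarrow> delta_at xs x = 0"
            using elim(1) unfolding mollifier_def by blast+
        qed (use elim(2) in blast)
      qed
    qed
  qed
qed

lemma number_rel_iff:
  "(star_value M a params, star_value M b params) \<in> number_rel M \<rho> \<longleftrightarrow>
    star_value M a params \<in> moderate_numbers M \<rho> \<and> star_value M b params \<in> moderate_numbers M \<rho> \<and>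
    negligible_on \<F> scale (UNIV :: unit set) (\<lambda>xs _. cpx_of (a xs) - cpx_of (b xs))"
  using number_rel_star_value[OF M, of a params b hd] unfolding param_values(1)[symmetric] .

lemma function_rel_iff:
  "(star_value M f params, star_value M g params) \<in> function_rel M \<rho> \<Omega> \<longleftrightarrow>
    star_value M f params \<in> moderate_functions M \<rho> \<Omega> \<and> star_value M g params \<in> moderate_functions M \<rho> \<Omega> \<and>
    negligible_net \<F> scale \<Omega> (\<lambda>xs y. fn_of (f xs) y - fn_of (g xs) y)"
  using function_rel_star_value[OF M \<Omega>, of f params g hd] unfolding param_values(1)[symmetric] .

lemma moderate_numbers_iff:
  "star_value M a params \<in> moderate_numbers M \<rho> \<longleftrightarrow> (\<forall>\<^sub>F xs in \<F>. a xs \<in> range Cpx) \<and>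
    moderate_on \<F> scale (UNIV :: unit set) (\<lambda>xs _. cpx_of (a xs))"
  using moderate_numbers_star_value[OF M, of a params hd] unfolding param_values(1)[symmetric] .

lemma moderate_functions_iff:
  "star_value M f params \<in> moderate_functions M \<rho> \<Omega> \<longleftrightarrow> (\<forall>\<^sub>F xs in \<F>. f xs \<in> range Fn) \<and>
    moderate_net \<F> scale \<Omega> (\<lambda>xs. fn_of (f xs))"
  using moderate_functions_star_value[OF M \<Omega>, of f params hd] unfolding param_values(1)[symmetric] .

lemma moderate_representative:
  assumes T: "T \<in> distributions \<Omega>"
  shows "representative T \<in> moderate_functions M \<rho> \<Omega>"
  using moderate_regularize[OF T] by (simp add: moderate_functions_iff)

lemma embed_asymptotic: "T \<in> distributions \<Omega> \<Longrightarrow> embed T \<in> asymptotic_functions M \<rho> \<Omega>"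
  unfolding embed_eq asymptotic_functions_def function_class_def
  by (rule quotientI[OF moderate_representative])

lemma moderate_standard_number: "star_value M (\<lambda>_. Cpx c) params \<in> moderate_numbers M \<rho>"
  unfolding moderate_numbers_iff
  by (auto intro!: moderate_onI[OF infinitesimal, of _ _ "norm c" 0])

lemma standard_number_eq: "standard_number M \<rho> c = number_class M \<rho> (star_value M (\<lambda>_. Cpx c) params)"
  by (simp only: standard_number_def star_value_const[OF M])

lemma embed_pairing:
  assumes T: "T \<in> distributions \<Omega>" and \<phi>: "\<phi> \<in> test_functions \<Omega>"
  shows "standard_number M \<rho> (T \<phi>) = asym_pairing M \<rho> \<Omega> (embed T) \<phi>"
proof -
  let ?pair = "star_value M (\<lambda>xs. Cpx (LINT x:\<Omega>|lebesgue. regularize T xs x * \<phi> x)) params"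
  have eq: "asym_pairing M \<rho> \<Omega> (embed T) \<phi> = number_class M \<rho> ?pair"
    unfolding embed_eq asym_pairing_class[OF M \<Omega> \<rho> moderate_representative[OF T] \<phi>]
      star_of_value[OF M, of "Fn \<phi>" params] star_fun2_star_value[OF M] obj.sel ..
  have "(?pair, star_value M (\<lambda>_. Cpx (T \<phi>)) params) \<in> number_rel M \<rho>"
    unfolding number_rel_iff obj.sel
  proof (intro conjI moderate_standard_number)
    show "?pair \<in> moderate_numbers M \<rho>"
      using moderate_pairing[OF infinitesimal \<Omega> moderate_regularize[OF T] \<phi>] by (simp add: moderate_numbers_iff)
    show "negligible_on \<F> scale (UNIV :: unit set)
        (\<lambda>xs _. (LINT x:\<Omega>|lebesgue. regularize T xs x * \<phi> x) - T \<phi>)"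
    proof (rule negligible_onI[OF infinitesimal])
      fix n :: nat assume "n \<ge> 1"
      then have n: "n > 0" by simp
      obtain \<delta> where \<delta>: "\<delta> > 0" "closed_nbhd (supp \<phi>) (2 * \<delta>) \<subseteq> \<Omega>"
        using exists_closed_nbhd_subset[OF test_compact_supp[OF \<phi>] \<Omega> test_supp_subset[OF \<phi>]] by metis
      obtain C where C: "\<forall>p D r. p \<in> test_functions \<Omega> \<longrightarrow> (\<forall>y\<in>closed_nbhd (supp \<phi>) (2 * \<delta>). p y = 1) \<longrightarrow>
          mollifier n r D \<longrightarrow> r \<le> \<delta> \<longrightarrow>
          norm ((LINT x:\<Omega>|lebesgue. dist_convolution (schwartz_product T p) D x * \<phi> x) - T \<phi>) \<le> C * r ^ n"
        using pairing_convolution_approx[OF \<Omega> T \<phi> n \<delta>(2,1)] by (elim exE)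
      have "\<forall>\<^sub>F xs in \<F>. \<forall>y\<in>(UNIV :: unit set).
          norm ((LINT x:\<Omega>|lebesgue. regularize T xs x * \<phi> x) - T \<phi>) \<le> C * scale xs ^ n"
        using eventually_near_compact[OF test_compact_supp[OF \<phi>] \<delta>(2,1), of n]
        by eventually_elim (intro ballI C[rule_format], blast+)
      then show "\<exists>C. \<forall>\<^sub>F xs in \<F>. \<forall>y\<in>(UNIV :: unit set).
          norm ((LINT x:\<Omega>|lebesgue. regularize T xs x * \<phi> x) - T \<phi>) \<le> C * scale xs ^ n" by blast
    qed
  qed
  from number_class_eqI[OF M \<rho> this] show ?thesis by (simp only: eq standard_number_eq)
qed

lemma standard_number_inject:
  assumes "standard_number M \<rho> a = standard_number M \<rho> b"
  shows "a = b"
proof (rule ccontr)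
  assume ne: "a \<noteq> b"
  have "(star_value M (\<lambda>_. Cpx a) params, star_value M (\<lambda>_. Cpx b) params) \<in> number_rel M \<rho>"
    using assms eq_equiv_class_iff[OF equiv_number_rel[OF M \<rho>] moderate_standard_number moderate_standard_number]
    unfolding standard_number_eq number_class_def by blast
  then have "negligible_on \<F> scale (UNIV :: unit set) (\<lambda>xs _. a - b)"
    unfolding number_rel_iff obj.sel by blast
  then have "\<forall>\<^sub>F xs in \<F>. \<forall>y\<in>(UNIV :: unit set). norm (a - b) < scale xs ^ 1"
    unfolding negligible_on_def by (rule allE[of _ 1]) simp
  then have "\<forall>\<^sub>F xs in \<F>. norm (a - b) < scale xs" by simp
  moreover have "\<forall>\<^sub>F xs in \<F>. 0 < scale xs \<and> scale xs < norm (a - b)"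
    using ne by (intro infinitesimal_scaleD[OF infinitesimal]) simp
  ultimately have "\<forall>\<^sub>F xs in \<F>. False" by eventually_elim simp
  then show False using type_of_neq_bot[OF M, of params] by simp
qed

lemma embed_inj: "inj_on embed (distributions \<Omega>)"
proof (rule inj_onI)
  fix S T assume S: "S \<in> distributions \<Omega>" and T: "T \<in> distributions \<Omega>" and eq: "embed S = embed T"
  show "S = T"
  proof
    fix \<phi>
    show "S \<phi> = T \<phi>"
    proof (cases "\<phi> \<in> test_functions \<Omega>")
      case True
      have "standard_number M \<rho> (S \<phi>) = standard_number M \<rho> (T \<phi>)"
        unfolding embed_pairing[OF S True] embed_pairing[OF T True] eq ..
      then show ?thesis by (rule standard_number_inject)
    next
      case False
      then show ?thesis using S T by (simp add: distributions_def)
    qed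
  qed
qed

lemma embed_add:
  assumes S: "S \<in> distributions \<Omega>" and T: "T \<in> distributions \<Omega>"
  shows "embed (dist_add S T) = asym_add M \<rho> \<Omega> (embed S) (embed T)"
proof -
  have "regularize (dist_add S T) xs = (\<lambda>x. regularize S xs x + regularize T xs x)" for xs
    by (simp add: dist_convolution_def schwartz_product_def dist_add_def)
  then show ?thesis
    unfolding embed_eq
    by (simp only: asym_add_class[OF M \<Omega> \<rho> moderate_representative[OF S] moderate_representative[OF T]]
        star_fun2_star_value[OF M] obj.sel)
qed

lemma embed_scale:
  assumes T: "T \<in> distributions \<Omega>"
  shows "embed (dist_scale c T) = asym_scale M \<rho> \<Omega> c (embed T)"
proof -
  have "regularize (dist_scale c T) xs = (\<lambda>x. c * regularize T xs x)" for xs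
    by (simp add: dist_convolution_def schwartz_product_def dist_scale_def)
  then show ?thesis
    unfolding embed_eq
    by (simp only: asym_scale_class[OF M \<Omega> \<rho> moderate_representative[OF T]]
        star_of_value[OF M, of "Cpx c" params] star_fun2_star_value[OF M] obj.sel)
qed

lemma embed_deriv:
  assumes T: "T \<in> distributions \<Omega>"
  shows "embed (dist_deriv \<Omega> \<alpha> T) = asym_deriv M \<rho> \<Omega> \<alpha> (embed T)"
proof -
  note T' = dist_deriv_distribution[OF T, of \<alpha>]
  let ?diff = "\<lambda>xs y. regularize (dist_deriv \<Omega> \<alpha> T) xs y - mderiv \<alpha> (regularize T xs) y"
  have "negligible_net \<F> scale \<Omega> ?diff"
    unfolding negligible_net_def
  proof (intro conjI allI impI)
    have "smooth_net \<F> \<Omega> (\<lambda>xs. mderiv \<alpha> (regularize T xs))" by (rule smooth_net_mderiv[OF smooth_regularize[OF T]])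
    with smooth_regularize[OF T'] show "smooth_net \<F> \<Omega> ?diff"
      unfolding smooth_net_def by eventually_elim (rule smooth_diff[OF \<Omega>])
    fix \<beta> :: "'d \<Rightarrow> nat" and K :: "(real^'d) set" assume K: "compact K \<and> K \<subseteq> \<Omega>"
    obtain \<delta> where \<delta>: "\<delta> > 0" "closed_nbhd K (2 * \<delta>) \<subseteq> \<Omega>"
      using exists_closed_nbhd_subset[of K \<Omega>] K \<Omega> by metis
    have "\<forall>\<^sub>F xs in \<F>. \<forall>y\<in>K. mderiv \<beta> (?diff xs) y = 0"
      using eventually_near_compact[OF conjunct1[OF K] \<delta>(2,1), of 1]
    proof eventually_elim
      case (elim xs)
      show ?case
      proof
        fix y assume y: "y \<in> K"
        show "mderiv \<beta> (?diff xs) y = 0"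
          unfolding mderiv_def[of \<beta>]
        proof (rule convolution_dist_deriv[OF \<Omega> T conjunct1[OF K] \<delta>(1) _ _ _ _ _ y, where r = "scale xs"])
          show "cutoff_at xs \<in> test_functions \<Omega>" "\<And>y. y \<in> closed_nbhd K (2 * \<delta>) \<Longrightarrow> cutoff_at xs y = 1"
            "scale xs \<le> \<delta>"
            using elim by blast+
          show "delta_at xs \<in> test_functions UNIV" "\<And>x. scale xs \<le> norm x \<Longrightarrow> delta_at xs x = 0"
            using elim unfolding mollifier_def by blast+
        qed
      qed
    qed
    from negligible_on_cong[OF this, of scale] negligible_on_zero[OF infinitesimal]
    show "negligible_on \<F> scale K (\<lambda>xs. mderiv \<beta> (?diff xs))" by blast
  qed
  then have "(representative (dist_deriv \<Omega> \<alpha> T), star_value M (\<lambda>xs. Fn (mderiv \<alpha> (regularize T xs))) params)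
      \<in> function_rel M \<rho> \<Omega>"
    unfolding function_rel_iff obj.sel
    using moderate_representative[OF T'] moderate_net_mderiv[OF infinitesimal \<Omega> moderate_regularize[OF T]]
    by (simp add: moderate_functions_iff)
  then show ?thesis
    unfolding embed_eq asym_deriv_class[OF M \<Omega> \<rho> moderate_representative[OF T]]
      star_mderiv_def star_fun1_star_value[OF M] obj.sel
    by (rule function_class_eqI[OF M \<Omega> \<rho>])
qed

lemma embed_smooth:
  assumes f: "f \<in> smooth_functions \<Omega>"
  shows "canonical_embedding M \<rho> \<Omega> f = embed (schwartz_embedding \<Omega> f)"
proof -
  note L = schwartz_embedding_distribution[OF \<Omega> f]
  let ?f = "star_value M (\<lambda>_. Fn f) params"
  have "moderate_net \<F> scale \<Omega> (\<lambda>_. f)"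
    unfolding moderate_net_def smooth_net_def
  proof (intro conjI allI impI)
    fix \<alpha> :: "'d \<Rightarrow> nat" and K :: "(real^'d) set" assume K: "compact K \<and> K \<subseteq> \<Omega>"
    obtain B where B: "\<And>is x. length is \<le> 0 \<Longrightarrow> x \<in> K \<Longrightarrow> norm (partial_derivs is (mderiv \<alpha> f) x) \<le> B"
      using smooth_bounded_on_compact[OF smooth_mderiv[OF f] conjunct1[OF K] conjunct2[OF K], where N = 0] by metis
    show "moderate_on \<F> scale K (\<lambda>_. mderiv \<alpha> f)"
      by (rule moderate_onI[OF infinitesimal, of _ _ B 0]) (use B[of "[]"] in simp)
  qed (use f in simp)
  then have fm: "?f \<in> moderate_functions M \<rho> \<Omega>" by (simp add: moderate_functions_iff)
  let ?diff = "\<lambda>xs y. regularize (schwartz_embedding \<Omega> f) xs y - f y"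
  have "negligible_net \<F> scale \<Omega> ?diff"
    unfolding negligible_net_def
  proof (intro conjI allI impI)
    from smooth_regularize[OF L] show "smooth_net \<F> \<Omega> ?diff"
      unfolding smooth_net_def by eventually_elim (rule smooth_diff[OF \<Omega> _ f])
    fix \<alpha> :: "'d \<Rightarrow> nat" and K :: "(real^'d) set" assume K: "compact K \<and> K \<subseteq> \<Omega>"
    obtain \<delta> where \<delta>: "\<delta> > 0" "closed_nbhd K (2 * \<delta>) \<subseteq> \<Omega>"
      using exists_closed_nbhd_subset[of K \<Omega>] K \<Omega> by metis
    obtain "is" where al: "\<And>f. mderiv \<alpha> f = partial_derivs is f"
      using mderiv_as_list[of \<alpha>] by metis
    show "negligible_on \<F> scale K (\<lambda>xs. mderiv \<alpha> (?diff xs))"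
    proof (rule negligible_onI[OF infinitesimal])
      fix n :: nat assume "n \<ge> 1"
      then have n: "n > 0" by simp
      obtain C where C: "\<forall>p D r x. p \<in> test_functions \<Omega> \<longrightarrow> (\<forall>y\<in>closed_nbhd K (2 * \<delta>). p y = 1) \<longrightarrow>
          mollifier n r D \<longrightarrow> r \<le> \<delta> \<longrightarrow> x \<in> K \<longrightarrow>
          norm (partial_derivs is (\<lambda>x. dist_convolution (schwartz_product (schwartz_embedding \<Omega> f) p) D x - f x) x) \<le> C * r ^ n"
        using convolution_schwartz_embedding_approx[OF \<Omega> f conjunct1[OF K] n \<delta>(2,1), where ks = "is"] by (elim exE)
      have "\<forall>\<^sub>F xs in \<F>. \<forall>y\<in>K. norm (mderiv \<alpha> (?diff xs) y) \<le> C * scale xs ^ n"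
        unfolding al using eventually_near_compact[OF conjunct1[OF K] \<delta>(2,1), of n]
        by eventually_elim (intro ballI C[rule_format], blast+)
      then show "\<exists>C. \<forall>\<^sub>F xs in \<F>. \<forall>y\<in>K. norm (mderiv \<alpha> (?diff xs) y) \<le> C * scale xs ^ n" by blast
    qed
  qed
  then have "(representative (schwartz_embedding \<Omega> f), ?f) \<in> function_rel M \<rho> \<Omega>"
    unfolding function_rel_iff obj.sel using fm moderate_representative[OF L] by blast
  from function_class_eqI[OF M \<Omega> \<rho> this] show ?thesis
    unfolding embed_eq canonical_embedding_def star_value_const[OF M] by (rule sym)
qed

end

theorem theorem5p7:
  fixes M :: "('d::finite, 'u) model"
    and \<rho> D P :: 'u
    and \<Omega> :: "(real^'d) set"
  assumes "nonstandard_model M"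
    and "open \<Omega>"
    and "positive_infinitesimal M \<rho>"
    and "delta_function M \<rho> D"
    and "cutoff_function M \<rho> \<Omega> P"
  shows "let emb = distribution_embedding M \<rho> \<Omega> D P in
    emb \<in> distributions \<Omega> \<rightarrow> asymptotic_functions M \<rho> \<Omega>
    \<and> (\<forall>T\<in>distributions \<Omega>. \<forall>\<phi>\<in>test_functions \<Omega>.
          standard_number M \<rho> (T \<phi>) = asym_pairing M \<rho> \<Omega> (emb T) \<phi>)
    \<and> (inj_on emb (distributions \<Omega>)
       \<and> (\<forall>S\<in>distributions \<Omega>. \<forall>T\<in>distributions \<Omega>.
            emb (dist_add S T) = asym_add M \<rho> \<Omega> (emb S) (emb T))
       \<and> (\<forall>T\<in>distributions \<Omega>. \<forall>c. emb (dist_scale c T) = asym_scale M \<rho> \<Omega> c (emb T))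
       \<and> (\<forall>T\<in>distributions \<Omega>. \<forall>\<alpha>.
            emb (dist_deriv \<Omega> \<alpha> T) = asym_deriv M \<rho> \<Omega> \<alpha> (emb T)))
    \<and> (\<forall>f\<in>smooth_functions \<Omega>.
          canonical_embedding M \<rho> \<Omega> f = emb (schwartz_embedding \<Omega> f))"
proof -
  interpret regularization M \<rho> D P \<Omega> "[\<rho>, D, P]"
    using assms by unfold_locales (simp_all add: nonstandard_model_def)
  show ?thesis
    unfolding Let_def
    by (intro conjI funcsetI ballI allI embed_asymptotic embed_pairing embed_inj embed_add embed_scale
        embed_deriv embed_smooth)
qed

end
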